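(* Let $(M,\omega)$ be a finite dimensional symplectic manifold with a Hamiltonian action of a Lie group $G$ and equivariant momentum map $\mathbf{J}:M\to\mathfrak{g}^*$. Let $m_e\in M$, $\mu:=\mathbf{J}(m_e)$, and fix complements $\mathfrak{m}$ of $\mathfrak{g}_{m_e}$ in $\mathfrak{g}_\mu$ and $\mathfrak{q}$ of $\mathfrak{g}_\mu$ in $\mathfrak{g}$, so that $\mathfrak{g}=\mathfrak{g}_{m_e}\oplus\mathfrak{m}\oplus\mathfrak{q}$. Let $\psi:U\subset X\to M$ be a coordinate chart around $m_e$ (with $X$ a vector space and $U$ an open neighborhood of $0$), and let $V$ and $W$ be subspaces of $X$ satisfying: (i) $\psi(0)=m_e$; (ii) $T_0\psi\cdot V$ is a complement to $\mathfrak{m}\cdot m_e$ in $\ker D\mathbf{J}(m_e)$; (iii) the map $A:W\to(\mathfrak{g}_{m_e}\oplus\mathfrak{q})^\circ$, $A(w):=D\mathbf{J}(m_e)(T_0\psi(w))$, is an isomorphism (onto the annihilator $(\mathfrak{g}_{m_e}\oplus\mathfrak{q})^\circ\subset\mathfrak{g}^*$). Let $V'$ and $W'$ be neighborhoods of the origin in $V$ and $W$ such that $V'\times W'\subset U$ (where $(v,w)$ is identified with $v+w\in X$), and set $\mathcal{U}:=i_{\mathfrak{m}}^*(AW')\times V'\subset\mathfrak{m}^*\times V$. Then the map $$\Psi:\mathcal{U}\subset\mathfrak{m}^*\times V\to M,\qquad \Psi(\eta,v):=\psi\left(v+A^{-1}\mathbb{P}_{\mathfrak{m}}^*\eta\right)$$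 is a slice mapping at $m_e\in M$.
   Context: Notation: $\mathbf{J}$ is equivariant: $\mathbf{J}(g\cdot m)=\mathrm{Ad}^*_{g^{-1}}\mathbf{J}(m)$. $\zeta_M$ is the infinitesimal generator vector field of $\zeta\in\mathfrak{g}$; for a subspace $\mathfrak{s}\subset\mathfrak{g}$, $\mathfrak{s}\cdot m:=\{\zeta_M(m):\zeta\in\mathfrak{s}\}$. $\mathfrak{g}_{m_e}$ and $\mathfrak{g}_\mu$ are the Lie algebras of the isotropy subgroups $G_{m_e}$ of $m_e$ and $G_\mu$ of $\mu$ (coadjoint action). $i_{\mathfrak{m}}:\mathfrak{m}\to\mathfrak{g}$ and $\mathbb{P}_{\mathfrak{m}}:\mathfrak{g}\to\mathfrak{m}$ are the injection and projection associated with the splitting $\mathfrak{g}=\mathfrak{g}_{m_e}\oplus\mathfrak{m}\oplus\mathfrak{q}$; $i_{\mathfrak{m}}^*:\mathfrak{g}^*\to\mathfrak{m}^*$ and $\mathbb{P}_{\mathfrak{m}}^*:\mathfrak{m}^*\to\mathfrak{g}^*$ are their duals. Definition (slice mapping). Let $V$ be a vector space and $\mathcal{U}\subset\mathfrak{m}^*\times V$ an open neighborhood of $(0,0)$. A smooth map $\Psi:\mathcal{U}\to M$ is a slice mapping at $m_e$ if it is a diffeomorphism onto its image satisfying: (SM1) $\Psi(0,0)=m_e$; (SM2) for any $(\eta,v)\in\mathcal{U}$, $T_{\Psi(\eta,v)}M=(\mathfrak{m}\oplus\mathfrak{q})\cdot\Psi(\eta,v)+T_{(\eta,v)}\Psi\cdot(\mathfrak{m}^*\times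 V)$; (SM3) $\mathbf{j}:=\mathbf{J}\circ\Psi:\mathcal{U}\to\mathfrak{g}^*$ satisfies $D\mathbf{j}(0,0)(\delta\eta,\delta v)=\mathbb{P}_{\mathfrak{m}}^*\delta\eta$ for all $\delta\eta\in\mathfrak{m}^*$, $\delta v\in V$.
   Formalization: (SM2) can fail for arbitrary V', W' with V'×W' ⊂ U (S¹ rotating R², m_e=(1,0), W'=R e_1), so Ψ is shown to be a slice mapping for all sufficiently small V', W'; openness of the domain, diffeomorphism onto image, (SM1) and (SM3) are shown for all given (open) V', W'. *)

theory Defs
  imports "HOL-Analysis.Analysis" "HOL-Algebra.Group_Action"
begin

section \<open>Finite-dimensional vector spaces as types\<close>

text \<open>
  Unlike \<^class>\<open>euclidean_space\<close>, whose instances have dimension at least one, this class also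
  has zero-dimensional instances. These matter here: discrete groups have Lie algebra zero, and
  the complement of $\mathfrak{g}_{m_e}$ in $\mathfrak{g}_\mu$ is often zero. The norm only
  serves to fix the (unique) vector space topology.
\<close>

class finite_dim_normed = real_normed_vector +
  assumes finite_spanning_set: "\<exists>B::'a set. finite B \<and> (\<forall>x. \<exists>c. x = (\<Sum>b\<in>B. c b *\<^sub>R b))"

instance euclidean_space \<subseteq> finite_dim_normed
  by standard (metis euclidean_representation finite_Basis)

text \<open>\<open>complement_in K S T\<close>: the subspace \<open>T\<close> is a complement to \<open>S\<close> in \<open>K\<close>, i.e. $K = S \oplus T$.\<close>

definition complement_in :: "'a::real_vector set \<Rightarrow> 'a set \<Rightarrow> 'a set \<Rightarrow> bool" where
  "complement_in K S T \<longleftrightarrow> subspace T \<and> S \<inter> T = {0} \<and> K = S + T"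

definition annihilator :: "'g::real_normed_vector set \<Rightarrow> ('g \<Rightarrow>\<^sub>L real) set" where
  "annihilator S = {\<alpha>. \<forall>\<zeta>\<in>S. blinfun_apply \<alpha> \<zeta> = 0}"

text \<open>In finite dimension every linear map is bounded, so \<^const>\<open>Blinfun\<close> loses nothing here.\<close>

definition dual_map ::
    "('a::real_normed_vector \<Rightarrow> 'b::real_normed_vector) \<Rightarrow> ('b \<Rightarrow>\<^sub>L real) \<Rightarrow> ('a \<Rightarrow>\<^sub>L real)" where
  "dual_map f \<alpha> = \<alpha> o\<^sub>L Blinfun f"


section \<open>Smooth functions between vector spaces\<close>

text \<open>
  \<open>ck_on k S f\<close> is meant for open \<open>S\<close> in a finite-dimensional space, where \<open>f\<close> is of class $C^k$
  iff it is differentiable and all its directional derivatives are of class $C^{k-1}$.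
\<close>

primrec ck_on :: "nat \<Rightarrow> 'a::real_normed_vector set \<Rightarrow> ('a \<Rightarrow> 'b::real_normed_vector) \<Rightarrow> bool" where
  "ck_on 0 S f \<longleftrightarrow> continuous_on S f"
| "ck_on (Suc k) S f \<longleftrightarrow> (\<forall>x\<in>S. f differentiable (at x)) \<and>
     (\<forall>v. ck_on k S (\<lambda>x. frechet_derivative f (at x) v))"

definition smooth_on :: "'a::real_normed_vector set \<Rightarrow> ('a \<Rightarrow> 'b::real_normed_vector) \<Rightarrow> bool" where
  "smooth_on S f \<longleftrightarrow> (\<forall>k. ck_on k S f)"


section \<open>Manifolds\<close>

type_synonym ('m, 'e) chart = "'m set \<times> ('m \<Rightarrow> 'e)"
type_synonym ('m, 'e) atlas = "('m, 'e) chart set"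

definition chart_inv :: "('m, 'e) chart \<Rightarrow> 'e \<Rightarrow> 'm" where
  "chart_inv c = inv_into (fst c) (snd c)"

definition is_chart :: "('m::topological_space, 'e::real_normed_vector) chart \<Rightarrow> bool" where
  "is_chart c \<longleftrightarrow> open (fst c) \<and> open (snd c ` fst c) \<and>
     homeomorphism (fst c) (snd c ` fst c) (snd c) (chart_inv c)"

definition smooth_manifold ::
    "('m::{t2_space, second_countable_topology}, 'e::finite_dim_normed) atlas \<Rightarrow> bool" where
  "smooth_manifold A \<longleftrightarrow> (\<forall>c\<in>A. is_chart c) \<and> (\<Union>c\<in>A. fst c) = UNIV \<and>
     (\<forall>c\<in>A. \<forall>d\<in>A. smooth_on (snd c ` (fst c \<inter> fst d)) (snd d \<circ> chart_inv c))"

definition vec_atlas :: "('e, 'e) atlas" where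
  "vec_atlas = {(UNIV, id)}"

definition prod_atlas :: "('m, 'e) atlas \<Rightarrow> ('n, 'f) atlas \<Rightarrow> ('m \<times> 'n, 'e \<times> 'f) atlas" where
  "prod_atlas A B = {(fst c \<times> fst d, map_prod (snd c) (snd d)) |c d. c \<in> A \<and> d \<in> B}"

text \<open>Smooth maps defined on an open subset \<open>S\<close> of a manifold.\<close>

definition smooth_map ::
    "('m::topological_space, 'e::real_normed_vector) atlas \<Rightarrow>
     ('n::topological_space, 'f::real_normed_vector) atlas \<Rightarrow> 'm set \<Rightarrow> ('m \<Rightarrow> 'n) \<Rightarrow> bool" where
  "smooth_map A B S f \<longleftrightarrow> open S \<and> continuous_on S f \<and>
     (\<forall>c\<in>A. \<forall>d\<in>B. smooth_on (snd c ` (fst c \<inter> S \<inter> f -` fst d)) (snd d \<circ> f \<circ> chart_inv c))"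

text \<open>
  On an arbitrary subset \<open>S\<close>, smoothness means that smooth extensions to open sets exist locally.
  This is needed for maps on open subsets of a proper subspace, and for the inverse of an
  embedding, which is defined on a submanifold.
\<close>

definition smooth_map_on ::
    "('m::topological_space, 'e::real_normed_vector) atlas \<Rightarrow>
     ('n::topological_space, 'f::real_normed_vector) atlas \<Rightarrow> 'm set \<Rightarrow> ('m \<Rightarrow> 'n) \<Rightarrow> bool" where
  "smooth_map_on A B S f \<longleftrightarrow>
     (\<forall>p\<in>S. \<exists>N F. p \<in> N \<and> smooth_map A B N F \<and> (\<forall>x\<in>N \<inter> S. F x = f x))"

definition diffeo_onto_image ::
    "('m::topological_space, 'e::real_normed_vector) atlas \<Rightarrow>
     ('n::topological_space, 'f::real_normed_vector) atlas \<Rightarrow> 'm set \<Rightarrow> ('m \<Rightarrow> 'n) \<Rightarrow> bool" where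
  "diffeo_onto_image A B S f \<longleftrightarrow>
     smooth_map_on A B S f \<and> inj_on f S \<and> smooth_map_on B A (f ` S) (inv_into S f)"


section \<open>Tangent spaces and tangent maps\<close>

text \<open>
  The tangent space at \<open>m\<close> is the model space \<open>'e\<close>, a vector being represented by its coordinates
  in one chart chosen at \<open>m\<close>. For \<^const>\<open>vec_atlas\<close> that chart is the identity, so that tangent
  vectors of a vector space are its elements.
\<close>

definition chart_at :: "('m, 'e) atlas \<Rightarrow> 'm \<Rightarrow> ('m, 'e) chart" where
  "chart_at A m = (SOME c. c \<in> A \<and> m \<in> fst c)"

definition tangent_map ::
    "('m, 'e::real_normed_vector) atlas \<Rightarrow> ('n, 'f::real_normed_vector) atlas \<Rightarrow>
     ('m \<Rightarrow> 'n) \<Rightarrow> 'm \<Rightarrow> 'e \<Rightarrow> 'f" where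
  "tangent_map A B f m =
     frechet_derivative (snd (chart_at B (f m)) \<circ> f \<circ> chart_inv (chart_at A m))
       (at (snd (chart_at A m) m))"

lemma tangent_map_vec_atlas: "tangent_map vec_atlas vec_atlas f x = frechet_derivative f (at x)"
proof -
  have c: "chart_at vec_atlas y = (UNIV, id)" for y :: 'z
    unfolding chart_at_def vec_atlas_def by (rule some_equality) auto
  show ?thesis
    by (simp add: tangent_map_def c chart_inv_def)
qed

definition velocity :: "('m, 'e::real_normed_vector) atlas \<Rightarrow> (real \<Rightarrow> 'm) \<Rightarrow> 'e" where
  "velocity A c = tangent_map vec_atlas A c 0 1"

text \<open>
  The tangent map at \<open>p\<close>, in direction \<open>u\<close>, of a map defined on a subset of a vector space that is
  open in a subspace containing \<open>p\<close> and \<open>u\<close>. There the Frechet derivative within the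
  domain would not be unique.
\<close>

definition tangent_along ::
    "('m, 'e::real_normed_vector) atlas \<Rightarrow> ('x::real_vector \<Rightarrow> 'm) \<Rightarrow> 'x \<Rightarrow> 'x \<Rightarrow> 'e" where
  "tangent_along A f p u = velocity A (\<lambda>t. f (p + t *\<^sub>R u))"


section \<open>Symplectic forms\<close>

definition two_form_in_chart ::
    "('m, 'e::real_normed_vector) atlas \<Rightarrow> ('m \<Rightarrow> 'e \<Rightarrow> 'e \<Rightarrow> real) \<Rightarrow> ('m, 'e) chart \<Rightarrow>
     'e \<Rightarrow> 'e \<Rightarrow> 'e \<Rightarrow> real" where
  "two_form_in_chart A \<omega> c x u v =
     \<omega> (chart_inv c x) (tangent_map vec_atlas A (chart_inv c) x u)
       (tangent_map vec_atlas A (chart_inv c) x v)"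

text \<open>The last clause but one is $d\omega = 0$, evaluated on constant coordinate vector fields.\<close>

definition symplectic_form ::
    "('m, 'e::real_normed_vector) atlas \<Rightarrow> ('m \<Rightarrow> 'e \<Rightarrow> 'e \<Rightarrow> real) \<Rightarrow> bool" where
  "symplectic_form A \<omega> \<longleftrightarrow>
     (\<forall>m u. linear (\<omega> m u)) \<and>
     (\<forall>m u v. \<omega> m u v = - \<omega> m v u) \<and>
     (\<forall>c\<in>A. \<forall>u v. smooth_on (snd c ` fst c) (\<lambda>x. two_form_in_chart A \<omega> c x u v)) \<and>
     (\<forall>c\<in>A. \<forall>x\<in>snd c ` fst c. \<forall>u v w.
        frechet_derivative (\<lambda>y. two_form_in_chart A \<omega> c y v w) (at x) u +
        frechet_derivative (\<lambda>y. two_form_in_chart A \<omega> c y w u) (at x) v +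
        frechet_derivative (\<lambda>y. two_form_in_chart A \<omega> c y u v) (at x) w = 0) \<and>
     (\<forall>m u. (\<forall>v. \<omega> m u v = 0) \<longrightarrow> u = 0)"


section \<open>Lie groups and their actions\<close>

text \<open>The Lie algebra, i.e. the tangent space at the unit, is the model space \<open>'g\<close> of the atlas.\<close>

definition lie_group ::
    "'a::{t2_space, second_countable_topology} monoid \<Rightarrow> ('a, 'g::finite_dim_normed) atlas \<Rightarrow> bool" where
  "lie_group G AG \<longleftrightarrow> group G \<and> carrier G = UNIV \<and> smooth_manifold AG \<and>
     smooth_map (prod_atlas AG AG) AG UNIV (\<lambda>(g, h). g \<otimes>\<^bsub>G\<^esub> h) \<and>
     smooth_map AG AG UNIV (\<lambda>g. inv\<^bsub>G\<^esub> g)"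

definition one_param_subgroup ::
    "'a::topological_space monoid \<Rightarrow> ('a, 'g::real_normed_vector) atlas \<Rightarrow> (real \<Rightarrow> 'a) \<Rightarrow> bool" where
  "one_param_subgroup G AG c \<longleftrightarrow>
     smooth_map vec_atlas AG UNIV c \<and> (\<forall>s t. c (s + t) = c s \<otimes>\<^bsub>G\<^esub> c t)"

text \<open>
  The Lie algebra of a closed subgroup \<open>H\<close>: all $\zeta$ with $\exp(t\zeta) \in H$ for every real $t$,
  the curve $t \mapsto \exp(t\zeta)$ being the one-parameter subgroup with initial velocity $\zeta$.
\<close>

definition lie_algebra_of ::
    "'a::topological_space monoid \<Rightarrow> ('a, 'g::real_normed_vector) atlas \<Rightarrow> 'a set \<Rightarrow> 'g set" where
  "lie_algebra_of G AG H =
     {\<zeta>. \<exists>c. one_param_subgroup G AG c \<and> velocity AG c = \<zeta> \<and> (\<forall>t. c t \<in> H)}"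

definition Ad :: "'a monoid \<Rightarrow> ('a, 'g::real_normed_vector) atlas \<Rightarrow> 'a \<Rightarrow> 'g \<Rightarrow> 'g" where
  "Ad G AG g = tangent_map AG AG (\<lambda>h. g \<otimes>\<^bsub>G\<^esub> h \<otimes>\<^bsub>G\<^esub> inv\<^bsub>G\<^esub> g) \<one>\<^bsub>G\<^esub>"

text \<open>The (left) coadjoint action $g \cdot \mu = \mathrm{Ad}^*_{g^{-1}} \mu$.\<close>

definition coadjoint ::
    "'a monoid \<Rightarrow> ('a, 'g::real_normed_vector) atlas \<Rightarrow> 'a \<Rightarrow> ('g \<Rightarrow>\<^sub>L real) \<Rightarrow> ('g \<Rightarrow>\<^sub>L real)" where
  "coadjoint G AG g = dual_map (Ad G AG (inv\<^bsub>G\<^esub> g))"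

definition smooth_action ::
    "'a::topological_space monoid \<Rightarrow> ('a, 'g::real_normed_vector) atlas \<Rightarrow>
     ('m::topological_space, 'e::real_normed_vector) atlas \<Rightarrow> ('a \<Rightarrow> 'm \<Rightarrow> 'm) \<Rightarrow> bool" where
  "smooth_action G AG AM \<phi> \<longleftrightarrow>
     group_action G UNIV \<phi> \<and> smooth_map (prod_atlas AG AM) AM UNIV (\<lambda>(g, m). \<phi> g m)"

text \<open>$\zeta_M(m)$, the derivative at the unit of the orbit map $g \mapsto g \cdot m$ in direction $\zeta$.\<close>

definition inf_generator ::
    "'a monoid \<Rightarrow> ('a, 'g::real_normed_vector) atlas \<Rightarrow> ('m, 'e::real_normed_vector) atlas \<Rightarrow>
     ('a \<Rightarrow> 'm \<Rightarrow> 'm) \<Rightarrow> 'g \<Rightarrow> 'm \<Rightarrow> 'e" where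
  "inf_generator G AG AM \<phi> \<zeta> m = tangent_map AG AM (\<lambda>g. \<phi> g m) \<one>\<^bsub>G\<^esub> \<zeta>"

text \<open>$\mathfrak{s} \cdot m$\<close>

definition orbit_directions ::
    "'a monoid \<Rightarrow> ('a, 'g::real_normed_vector) atlas \<Rightarrow> ('m, 'e::real_normed_vector) atlas \<Rightarrow>
     ('a \<Rightarrow> 'm \<Rightarrow> 'm) \<Rightarrow> 'g set \<Rightarrow> 'm \<Rightarrow> 'e set" where
  "orbit_directions G AG AM \<phi> S m = (\<lambda>\<zeta>. inf_generator G AG AM \<phi> \<zeta> m) ` S"

definition canonical_action ::
    "('m, 'e::real_normed_vector) atlas \<Rightarrow> ('m \<Rightarrow> 'e \<Rightarrow> 'e \<Rightarrow> real) \<Rightarrow> ('a \<Rightarrow> 'm \<Rightarrow> 'm) \<Rightarrow> bool" where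
  "canonical_action AM \<omega> \<phi> \<longleftrightarrow> (\<forall>g m u v.
     \<omega> (\<phi> g m) (tangent_map AM AM (\<phi> g) m u) (tangent_map AM AM (\<phi> g) m v) = \<omega> m u v)"

text \<open>Sign convention: $d\langle \mathbf{J}, \zeta\rangle = \omega(\zeta_M, \cdot)$.\<close>

definition momentum_map ::
    "'a monoid \<Rightarrow> ('a, 'g::real_normed_vector) atlas \<Rightarrow>
     ('m::topological_space, 'e::real_normed_vector) atlas \<Rightarrow> ('m \<Rightarrow> 'e \<Rightarrow> 'e \<Rightarrow> real) \<Rightarrow>
     ('a \<Rightarrow> 'm \<Rightarrow> 'm) \<Rightarrow> ('m \<Rightarrow> 'g \<Rightarrow>\<^sub>L real) \<Rightarrow> bool" where
  "momentum_map G AG AM \<omega> \<phi> J \<longleftrightarrow> smooth_map AM vec_atlas UNIV J \<and>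
     (\<forall>m v \<zeta>. blinfun_apply (tangent_map AM vec_atlas J m v) \<zeta> =
        \<omega> m (inf_generator G AG AM \<phi> \<zeta> m) v)"

definition equivariant_map ::
    "'a monoid \<Rightarrow> ('a, 'g::real_normed_vector) atlas \<Rightarrow> ('a \<Rightarrow> 'm \<Rightarrow> 'm) \<Rightarrow>
     ('m \<Rightarrow> 'g \<Rightarrow>\<^sub>L real) \<Rightarrow> bool" where
  "equivariant_map G AG \<phi> J \<longleftrightarrow> (\<forall>g m. J (\<phi> g m) = coadjoint G AG g (J m))"


section \<open>Splittings of the Lie algebra and slice mappings\<close>

text \<open>
  Since the dual of \<open>\<mm>\<close> has to be a type, \<open>\<mm>\<close> is given as a vector space \<open>'k\<close> together with its
  injection \<open>im\<close> into the Lie algebra; as a subspace of the Lie algebra it is \<open>range im\<close>.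
\<close>

definition splitting_proj ::
    "'g::real_normed_vector set \<Rightarrow> ('k \<Rightarrow> 'g) \<Rightarrow> 'g set \<Rightarrow> 'g \<Rightarrow> 'k" where
  "splitting_proj gm im q \<zeta> = (THE k. \<exists>a\<in>gm. \<exists>b\<in>q. \<zeta> = a + im k + b)"

definition SM1 :: "'m \<Rightarrow> (('k::real_normed_vector \<Rightarrow>\<^sub>L real) \<times> 'x::real_normed_vector \<Rightarrow> 'm) \<Rightarrow> bool" where
  "SM1 me \<Psi> \<longleftrightarrow> \<Psi> (0, 0) = me"

definition SM2 ::
    "'a monoid \<Rightarrow> ('a, 'g::real_normed_vector) atlas \<Rightarrow> ('m, 'e::real_normed_vector) atlas \<Rightarrow>
     ('a \<Rightarrow> 'm \<Rightarrow> 'm) \<Rightarrow> ('k::real_normed_vector \<Rightarrow> 'g) \<Rightarrow> 'g set \<Rightarrow> 'x::real_normed_vector set \<Rightarrow>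
     (('k \<Rightarrow>\<^sub>L real) \<times> 'x) set \<Rightarrow> (('k \<Rightarrow>\<^sub>L real) \<times> 'x \<Rightarrow> 'm) \<Rightarrow> bool" where
  "SM2 G AG AM \<phi> im q V \<U> \<Psi> \<longleftrightarrow>
     (\<forall>p\<in>\<U>. UNIV = orbit_directions G AG AM \<phi> (range im + q) (\<Psi> p) +
        tangent_along AM \<Psi> p ` (UNIV \<times> V))"

definition SM3 ::
    "('m \<Rightarrow> 'g::real_normed_vector \<Rightarrow>\<^sub>L real) \<Rightarrow> 'g set \<Rightarrow> ('k::real_normed_vector \<Rightarrow> 'g) \<Rightarrow> 'g set \<Rightarrow>
     'x::real_normed_vector set \<Rightarrow> (('k \<Rightarrow>\<^sub>L real) \<times> 'x \<Rightarrow> 'm) \<Rightarrow> bool" where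
  "SM3 J gm im q V \<Psi> \<longleftrightarrow>
     (\<forall>\<delta>\<eta>. \<forall>\<delta>v\<in>V. tangent_along vec_atlas (J \<circ> \<Psi>) (0, 0) (\<delta>\<eta>, \<delta>v) =
        dual_map (splitting_proj gm im q) \<delta>\<eta>)"

definition slice_mapping ::
    "'a::topological_space monoid \<Rightarrow> ('a, 'g::real_normed_vector) atlas \<Rightarrow>
     ('m::topological_space, 'e::real_normed_vector) atlas \<Rightarrow>
     ('a \<Rightarrow> 'm \<Rightarrow> 'm) \<Rightarrow> ('m \<Rightarrow> 'g \<Rightarrow>\<^sub>L real) \<Rightarrow> 'm \<Rightarrow> ('k::real_normed_vector \<Rightarrow> 'g) \<Rightarrow> 'g set \<Rightarrow>
     'x::real_normed_vector set \<Rightarrow> (('k \<Rightarrow>\<^sub>L real) \<times> 'x) set \<Rightarrow> (('k \<Rightarrow>\<^sub>L real) \<times> 'x \<Rightarrow> 'm) \<Rightarrow> bool" where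
  "slice_mapping G AG AM \<phi> J me im q V \<U> \<Psi> \<longleftrightarrow>
     subspace V \<and> openin (top_of_set (UNIV \<times> V)) \<U> \<and> (0, 0) \<in> \<U> \<and>
     diffeo_onto_image vec_atlas AM \<U> \<Psi> \<and>
     SM1 me \<Psi> \<and>
     SM2 G AG AM \<phi> im q V \<U> \<Psi> \<and>
     SM3 J (lie_algebra_of G AG (stabilizer G \<phi> me)) im q V \<Psi>"

definition nbhd_of_0_in :: "'x::real_normed_vector set \<Rightarrow> 'x set \<Rightarrow> bool" where
  "nbhd_of_0_in V N \<longleftrightarrow> openin (top_of_set V) N \<and> 0 \<in> N"

end

theory Submission
  imports Defs
begin

text \<open>
  Put \<open>B = A\<^sup>-\<^sup>1 \<circ> P\<^sup>*\<close>, where \<open>P\<close> is the projection of the Lie algebra onto $\mathfrak{m}$. Then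
  \<open>\<Psi>\<close> is the chart \<open>\<psi>\<close> after the linear map \<open>L (\<eta>, v) = v + B \<eta>\<close>. The derivative of the momentum map kills
  the tangent vectors in \<open>V\<close>, so \<open>A\<close> vanishes on \<open>V\<close> and determines the \<open>W\<close>-component of a vector of \<open>V + W\<close>.
  Hence \<open>L\<close>, restricted to \<open>v \<in> V\<close>, has a linear left inverse, and \<open>\<Psi>\<close> is a diffeomorphism onto its image
  (\<open>diffeo_onto_image_compose_linear\<close>). Condition (SM3) is the chain rule: the derivative of
  \<open>J \<circ> \<Psi>\<close> at the origin is \<open>A \<circ> L\<close>, which sends \<open>(\<delta>\<eta>, \<delta>v)\<close> to \<open>P\<^sup>* \<delta>\<eta>\<close>.

  For (SM2) at the origin let \<open>u\<close> be a tangent vector at \<open>m\<^sub>e\<close>. The form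
  \<open>(b, c) \<mapsto> \<omega> (c\<^sub>M, b\<^sub>M)\<close> is nondegenerate on $\mathfrak{q}$, so that after subtracting a generator
  from $\mathfrak{q}$ the derivative of \<open>J\<close> along \<open>u\<close> annihilates
  $\mathfrak{g}_{m_e} \oplus \mathfrak{q}$ (\<open>momentum_residual_annihilates\<close>). It is then \<open>A w\<close> for some
  \<open>w \<in> W\<close>, and after subtracting the tangent vector of \<open>w\<close> the rest lies in the kernel of the derivative
  of \<open>J\<close>, which is $\mathfrak{m} \cdot m_e$ plus the tangent vectors in \<open>V\<close>. At other points (SM2)
  holds because spanning is an open condition (\<open>transversality_open\<close>), which is why the domain may have to
  be shrunk for it.

  The nondegeneracy uses that $\mathfrak{g}_\mu$ contains every \<open>\<zeta>\<close> for which the derivative of \<open>J\<close> along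
  \<open>\<zeta>\<^sub>M (m\<^sub>e)\<close> is zero. As isotropy algebras are defined by one-parameter subgroups, this is a statement about
  the exponential map: a one-parameter subgroup with velocity \<open>\<zeta>\<close> has to exist
  (\<open>one_param_subgroup_exists\<close>), and its orbits have to be constant when they start with velocity zero
  (\<open>lie_algebra_stabilizer\<close>, \<open>lie_algebra_coadjoint_stabilizer\<close>). Most of the text develops what
  this takes: calculus in finite-dimensional normed spaces, smooth maps between manifolds and
  their tangent maps, and integral curves of smooth vector fields.
\<close>


section \<open>Finite-dimensional normed spaces\<close>

text \<open>Coefficients that are bounded by the norm of the combination turn a Cauchy sequence of
combinations into finitely many Cauchy sequences of reals, whose limits are the coefficients
of the limit.\<close>

lemma complete_span_coord_bound:
  fixes B :: "'a::real_normed_vector set"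
  assumes fin: "finite B"
    and K: "\<And>c b. b \<in> B \<Longrightarrow> \<bar>c b\<bar> \<le> K * norm (\<Sum>b\<in>B. c b *\<^sub>R b)"
  shows "complete (span B)"
  unfolding complete_def
proof safe
  fix f :: "nat \<Rightarrow> 'a"
  assume f: "\<forall>n. f n \<in> span B" and C: "Cauchy f"
  have "\<forall>n. \<exists>c. f n = (\<Sum>b\<in>B. c b *\<^sub>R b)"
    using f by (auto simp: span_finite[OF fin])
  then obtain c where c: "\<And>n. f n = (\<Sum>b\<in>B. c n b *\<^sub>R b)" by metis
  have conv: "convergent (\<lambda>n. c n b)" if "b \<in> B" for b
  proof -
    have bd: "dist (c m b) (c n b) \<le> K * dist (f m) (f n)" for m n
      using K[OF that, of "\<lambda>b. c m b - c n b"]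
      by (simp add: c dist_norm scaleR_diff_left sum_subtractf)
    have "Cauchy (\<lambda>n. c n b)"
    proof (rule metric_CauchyI)
      fix e :: real assume e: "e > 0"
      define K' where "K' = max K 1"
      have K': "K' > 0" "K \<le> K'" by (auto simp: K'_def)
      obtain N where N: "\<And>m n. m \<ge> N \<Longrightarrow> n \<ge> N \<Longrightarrow> dist (f m) (f n) < e / K'"
        using metric_CauchyD[OF C, of "e / K'"] e K' by auto
      have "dist (c m b) (c n b) < e" if "m \<ge> N" "n \<ge> N" for m n
      proof -
        have "dist (c m b) (c n b) \<le> K' * dist (f m) (f n)"
          using bd[of m n] mult_right_mono[OF K'(2), of "dist (f m) (f n)"] by simp
        also have "\<dots> < e" using N[OF that] K' by (simp add: field_simps)
        finally show ?thesis .
      qed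
      then show "\<exists>M. \<forall>m\<ge>M. \<forall>n\<ge>M. dist (c m b) (c n b) < e" by blast
    qed
    then show ?thesis by (simp add: Cauchy_convergent_iff)
  qed
  then have "\<forall>b\<in>B. \<exists>l. (\<lambda>n. c n b) \<longlonglongrightarrow> l" by (auto simp: convergent_def)
  then obtain l where l: "\<And>b. b \<in> B \<Longrightarrow> (\<lambda>n. c n b) \<longlonglongrightarrow> l b" by metis
  have "(\<lambda>n. \<Sum>b\<in>B. c n b *\<^sub>R b) \<longlonglongrightarrow> (\<Sum>b\<in>B. l b *\<^sub>R b)"
    by (intro tendsto_sum tendsto_scaleR l tendsto_const)
  then have "f \<longlonglongrightarrow> (\<Sum>b\<in>B. l b *\<^sub>R b)" using c by presburger
  moreover have "(\<Sum>b\<in>B. l b *\<^sub>R b) \<in> span B"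
    by (intro span_sum span_scale span_base)
  ultimately show "\<exists>l\<in>span B. f \<longlonglongrightarrow> l" by blast
qed

text \<open>By induction on the basis. The span of the old basis vectors is complete, hence closed, so a
new vector \<open>a\<close> outside it has positive distance \<open>d\<close> from it; its coefficient in a combination is then
at most the norm of the combination divided by \<open>d\<close>, and subtracting \<open>a\<close> reduces the remaining
coefficients to the induction hypothesis.\<close>

lemma independent_coord_bound:
  fixes B :: "'a::real_normed_vector set"
  assumes "finite B" "independent B"
  shows "\<exists>K. \<forall>c. \<forall>b\<in>B. \<bar>c b\<bar> \<le> K * norm (\<Sum>b\<in>B. c b *\<^sub>R b)"
  using assms
proof (induction B)
  case empty
  then show ?case by simp
next
  case (insert a B)
  have ind: "independent B" "a \<notin> span B"
    using insert.prems insert.hyps by (auto simp: independent_insert)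
  obtain K where K: "\<And>c b. b \<in> B \<Longrightarrow> \<bar>c b\<bar> \<le> K * norm (\<Sum>b\<in>B. c b *\<^sub>R b)"
    using insert.IH[OF ind(1)] by blast
  have cl: "closed (span B)"
    using complete_span_coord_bound[OF insert.hyps(1) K] by (rule complete_imp_closed)
  have "span B \<noteq> {}" using span_zero by blast
  then have d: "infdist a (span B) > 0"
    using infdist_pos_not_in_closed[OF cl] ind(2) by blast
  define d where "d = infdist a (span B)"
  have dpos: "d > 0" using d by (simp add: d_def)
  have ca: "\<bar>r\<bar> * d \<le> norm (r *\<^sub>R a + s)" if s: "s \<in> span B" for r s
  proof (cases "r = 0")
    case False
    have "- ((1/r) *\<^sub>R s) \<in> span B" using s by (intro span_neg span_scale)
    then have "d \<le> dist a (- ((1/r) *\<^sub>R s))" unfolding d_def by (rule infdist_le)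
    also have "\<dots> = norm (a + (1/r) *\<^sub>R s)" by (simp add: dist_norm)
    finally have "\<bar>r\<bar> * d \<le> \<bar>r\<bar> * norm (a + (1/r) *\<^sub>R s)" by (simp add: mult_left_mono)
    also have "\<dots> = norm (r *\<^sub>R a + s)"
      using False by (simp flip: norm_scaleR add: scaleR_add_right)
    finally show ?thesis .
  qed simp
  define K2 where "K2 = \<bar>K\<bar> * (1 + norm a / d) + 1 / d"
  have "\<bar>c b\<bar> \<le> K2 * norm (\<Sum>b\<in>insert a B. c b *\<^sub>R b)" if b: "b \<in> insert a B" for c b
  proof -
    define s where "s = (\<Sum>b\<in>B. c b *\<^sub>R b)"
    define N where "N = norm (c a *\<^sub>R a + s)"
    have s: "s \<in> span B" unfolding s_def by (intro span_sum span_scale span_base)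
    have sm: "(\<Sum>b\<in>insert a B. c b *\<^sub>R b) = c a *\<^sub>R a + s"
      using insert.hyps by (simp add: s_def)
    have N0: "N \<ge> 0" by (simp add: N_def)
    have a1: "\<bar>c a\<bar> \<le> N / d"
      using ca[OF s, of "c a"] dpos by (simp add: N_def field_simps)
    have "norm s \<le> N + \<bar>c a\<bar> * norm a"
      using norm_triangle_ineq4[of "c a *\<^sub>R a + s" "c a *\<^sub>R a"] by (simp add: N_def)
    also have "\<dots> \<le> N + N / d * norm a"
      using mult_right_mono[OF a1, of "norm a"] by simp
    finally have ns: "norm s \<le> N * (1 + norm a / d)" by (simp add: algebra_simps)
    show ?thesis
    proof (cases "b = a")
      case True
      have "\<bar>c a\<bar> \<le> (1 / d) * N" using a1 by simp
      also have "\<dots> \<le> K2 * N"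
        unfolding K2_def using N0 dpos by (intro mult_right_mono) auto
      finally show ?thesis using True sm by (simp add: N_def)
    next
      case False
      then have "\<bar>c b\<bar> \<le> K * norm s" using K[of b c] b by (simp add: s_def)
      also have "\<dots> \<le> \<bar>K\<bar> * norm s" by (simp add: mult_right_mono)
      also have "\<dots> \<le> \<bar>K\<bar> * (N * (1 + norm a / d))"
        using ns by (rule mult_left_mono) simp
      also have "\<dots> \<le> K2 * N"
        unfolding K2_def using N0 dpos by (simp add: algebra_simps)
      finally show ?thesis using sm by (simp add: N_def)
    qed
  qed
  then show ?case by blast
qed

definition std_basis :: "'a::finite_dim_normed set" where
  "std_basis = (SOME B. finite B \<and> independent B \<and> span B = UNIV)"

definition coord :: "'a \<Rightarrow> 'a::finite_dim_normed \<Rightarrow> real" where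
  "coord b x = representation std_basis x b"

lemma std_basis:
  shows finite_std_basis: "finite (std_basis :: 'a::finite_dim_normed set)"
    and independent_std_basis: "independent (std_basis :: 'a set)"
    and span_std_basis: "span (std_basis :: 'a set) = UNIV"
proof -
  obtain B :: "'a set" where B: "finite B" "\<And>x. \<exists>c. x = (\<Sum>b\<in>B. c b *\<^sub>R b)"
    using finite_spanning_set by blast
  have sB: "span B = UNIV"
    using B by (auto simp: span_finite[OF B(1)])
  obtain C where C: "C \<subseteq> B" "independent C" "B \<subseteq> span C"
    using maximal_independent_subset[of B] by blast
  have "span C = UNIV"
    using C(3) sB span_mono[OF C(3)] by (simp add: span_span top.extremum_uniqueI)
  then have "\<exists>B::'a set. finite B \<and> independent B \<and> span B = UNIV"
    using C B(1) finite_subset by blast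
  from someI_ex[OF this]
  show "finite (std_basis :: 'a set)" "independent (std_basis :: 'a set)"
    "span (std_basis :: 'a set) = UNIV"
    unfolding std_basis_def by auto
qed

lemma sum_coord: "(\<Sum>b\<in>std_basis. coord b x *\<^sub>R b) = x"
proof -
  have "(\<Sum>b\<in>std_basis. representation std_basis x b *\<^sub>R b) = x"
    by (rule sum_representation_eq)
      (simp_all add: independent_std_basis span_std_basis finite_std_basis)
  then show ?thesis by (simp add: coord_def)
qed

lemma linear_coord: "linear (coord b)"
proof -
  have "Vector_Spaces.linear (*\<^sub>R) (*) (\<lambda>x. representation std_basis x b)"
    by (rule linear_representation) (simp_all add: independent_std_basis span_std_basis)
  then have "Vector_Spaces.linear (*\<^sub>R) (*\<^sub>R) (\<lambda>x. representation std_basis x b)"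
    by (simp add: real_scaleR_def[abs_def])
  then show ?thesis by (simp add: linear_def coord_def[abs_def])
qed

lemma coord_add: "coord b (x + y) = coord b x + coord b y"
  by (rule linear_add[OF linear_coord])

lemma coord_scaleR: "coord b (r *\<^sub>R x) = r * coord b x"
  using linear_scale[OF linear_coord] by simp

lemma bounded_linear_coord:
  fixes b :: "'a::finite_dim_normed"
  assumes b: "b \<in> std_basis"
  shows "bounded_linear (coord b)"
proof -
  obtain K where K: "\<And>c b. b \<in> std_basis \<Longrightarrow> \<bar>c b\<bar> \<le> K * norm (\<Sum>b\<in>(std_basis :: 'a set). c b *\<^sub>R b)"
    using independent_coord_bound[OF finite_std_basis independent_std_basis] by blast
  have "norm (coord b x) \<le> norm x * K" for x
    using K[OF b, of "\<lambda>b. coord b x"] by (simp add: sum_coord mult.commute)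
  then show ?thesis
    by (intro bounded_linear_intro[where K=K])
      (simp_all add: coord_add coord_scaleR)
qed

lemma linear_sum_coord:
  assumes "linear f"
  shows "f x = (\<Sum>b\<in>std_basis. coord b x *\<^sub>R f b)"
proof -
  have "f x = f (\<Sum>b\<in>std_basis. coord b x *\<^sub>R b)" by (simp add: sum_coord)
  also have "\<dots> = (\<Sum>b\<in>std_basis. coord b x *\<^sub>R f b)"
    using assms by (simp add: linear_sum linear_scale)
  finally show ?thesis .
qed

lemma linear_imp_bounded_linear:
  fixes f :: "'a::finite_dim_normed \<Rightarrow> 'b::real_normed_vector"
  assumes "linear f"
  shows "bounded_linear f"
proof -
  have "bounded_linear (\<lambda>x. \<Sum>b\<in>std_basis. coord b x *\<^sub>R f b)"
    by (intro bounded_linear_sum bounded_linear_scaleR_const bounded_linear_coord)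
  moreover have "(\<lambda>x. \<Sum>b\<in>std_basis. coord b x *\<^sub>R f b) = f"
    by (rule ext) (rule linear_sum_coord[OF assms, symmetric])
  ultimately show ?thesis by simp
qed

text \<open>Completeness is what the contraction principle and the integral in the construction of integral
curves rest on.\<close>

instance finite_dim_normed \<subseteq> banach
proof
  fix X :: "nat \<Rightarrow> 'a" assume "Cauchy X"
  obtain K where K: "\<And>c b. b \<in> std_basis \<Longrightarrow> \<bar>c b\<bar> \<le> K * norm (\<Sum>b\<in>(std_basis :: 'a set). c b *\<^sub>R b)"
    using independent_coord_bound[OF finite_std_basis independent_std_basis] by blast
  have "complete (UNIV :: 'a set)"
    using complete_span_coord_bound[OF finite_std_basis K] by (simp add: span_std_basis)
  with \<open>Cauchy X\<close> show "convergent X"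
    by (auto simp: complete_def convergent_def)
qed

text \<open>In particular duals are finite-dimensional, so that linear maps defined on them are bounded.\<close>

instance blinfun :: (finite_dim_normed, finite_dim_normed) finite_dim_normed
proof
  define e :: "'a \<Rightarrow> 'b \<Rightarrow> 'a \<Rightarrow>\<^sub>L 'b" where "e a b = Blinfun (\<lambda>x. coord a x *\<^sub>R b)" for a b
  have e: "blinfun_apply (e a b) = (\<lambda>x. coord a x *\<^sub>R b)" if "a \<in> std_basis" for a b
    unfolding e_def
    by (intro bounded_linear_Blinfun_apply bounded_linear_scaleR_const bounded_linear_coord that)
  let ?S = "(\<lambda>(a, b). e a b) ` (std_basis \<times> std_basis)"
  have fin: "finite ?S" by (simp add: finite_std_basis)
  have "f \<in> span ?S" for f
  proof -
    have "f = (\<Sum>a\<in>std_basis. \<Sum>b\<in>std_basis. coord b (f a) *\<^sub>R e a b)"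
    proof (rule blinfun_eqI)
      fix x
      have "blinfun_apply f x = (\<Sum>a\<in>std_basis. coord a x *\<^sub>R blinfun_apply f a)"
        by (intro linear_sum_coord bounded_linear.linear blinfun.bounded_linear_right)
      also have "\<dots> = (\<Sum>a\<in>std_basis. coord a x *\<^sub>R (\<Sum>b\<in>std_basis. coord b (blinfun_apply f a) *\<^sub>R b))"
        by (simp add: sum_coord)
      also have "\<dots> = (\<Sum>a\<in>std_basis. \<Sum>b\<in>std_basis. coord b (blinfun_apply f a) *\<^sub>R blinfun_apply (e a b) x)"
        by (intro sum.cong refl) (simp add: e scaleR_sum_right mult.commute)
      also have "\<dots> = blinfun_apply (\<Sum>a\<in>std_basis. \<Sum>b\<in>std_basis. coord b (blinfun_apply f a) *\<^sub>R e a b) x"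
        by (simp add: blinfun.sum_left blinfun.scaleR_left)
      finally show "blinfun_apply f x = blinfun_apply (\<Sum>a\<in>std_basis. \<Sum>b\<in>std_basis. coord b (blinfun_apply f a) *\<^sub>R e a b) x" .
    qed
    moreover have "(\<Sum>a\<in>std_basis. \<Sum>b\<in>std_basis. coord b (f a) *\<^sub>R e a b) \<in> span ?S"
      by (intro span_sum span_scale span_base) auto
    ultimately show ?thesis by simp
  qed
  then have "\<forall>f. \<exists>c. f = (\<Sum>s\<in>?S. c s *\<^sub>R s)"
    unfolding span_finite[OF fin] by blast
  with fin show "\<exists>B::('a \<Rightarrow>\<^sub>L 'b) set. finite B \<and> (\<forall>x. \<exists>c. x = (\<Sum>b\<in>B. c b *\<^sub>R b))"
    by blast
qed

text \<open>The image of the subspace is a subspace of the same dimension inside it.\<close>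

lemma linear_inj_on_subspace_onto:
  fixes T :: "'a::finite_dim_normed \<Rightarrow> 'a"
  assumes lin: "linear T" and S: "subspace S" and into: "T ` S \<subseteq> S"
    and inj: "\<And>x. x \<in> S \<Longrightarrow> T x = 0 \<Longrightarrow> x = 0"
  shows "T ` S = S"
proof -
  interpret F: finite_dimensional_vector_space_pair "(*\<^sub>R) :: real \<Rightarrow> 'a \<Rightarrow> 'a" "std_basis :: 'a set"
      "(*\<^sub>R) :: real \<Rightarrow> 'a \<Rightarrow> 'a" "std_basis :: 'a set"
    by unfold_locales
      (simp_all add: finite_std_basis independent_std_basis[unfolded dependent_raw_def]
        span_std_basis[unfolded span_raw_def] scaleR_add_right scaleR_add_left)
  have injS: "inj_on T S"
  proof (rule inj_onI)
    fix x y assume xy: "x \<in> S" "y \<in> S" "T x = T y"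
    then have "T (x - y) = 0" using lin by (simp add: linear_diff)
    then show "x = y" using inj[of "x - y"] xy S by (simp add: subspace_diff)
  qed
  have d: "dim (T ` S) = dim S"
    using F.dim_image_eq[of T S] lin injS S span_eq_iff[of S]
    by (simp add: linear_def dim_raw_def span_raw_def)
  show ?thesis
    using F.vs1.subspace_dim_equal[of "T ` S" S] linear_subspace_image[OF lin S] S into d
    by (simp add: subspace_raw_def dim_raw_def)
qed

text \<open>The linear map that sends each basis vector to its perturbation differs from the identity by a map
of norm less than one, so its kernel is trivial and it is onto. This makes spanning an open condition.\<close>

lemma span_perturbed_basis:
  shows "\<exists>\<delta>>0. \<forall>S :: 'a::finite_dim_normed \<Rightarrow> 'a.
    (\<forall>b\<in>std_basis. norm (S b - b) < \<delta>) \<longrightarrow> span (S ` std_basis) = UNIV"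
proof -
  obtain K where K: "\<And>c b. b \<in> std_basis \<Longrightarrow> \<bar>c b\<bar> \<le> K * norm (\<Sum>b\<in>(std_basis :: 'a set). c b *\<^sub>R b)"
    using independent_coord_bound[OF finite_std_basis independent_std_basis] by blast
  define n where "n = card (std_basis :: 'a set)"
  \<comment> \<open>The perturbation moves \<open>x\<close> by at most \<open>n * \<bar>K\<bar> * \<delta> * norm x\<close>, since each coordinate is at most \<open>\<bar>K\<bar> * norm x\<close>.\<close>
  define \<delta> where "\<delta> = 1 / ((\<bar>K\<bar> + 1) * (n + 1))"
  have \<delta>: "\<delta> > 0" by (simp add: \<delta>_def zero_less_mult_iff)
  have "span (S ` std_basis) = UNIV" if S: "\<forall>b\<in>std_basis. norm (S b - b) < \<delta>" for S :: "'a \<Rightarrow> 'a"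
  proof -
    define T where "T x = (\<Sum>b\<in>std_basis. coord b x *\<^sub>R S b)" for x
    have lin: "linear T"
      unfolding T_def
      by (rule linearI)
        (simp_all add: coord_add coord_scaleR scaleR_add_left sum.distrib scaleR_sum_right)
    have bd: "norm (x - T x) \<le> norm x * (n * \<bar>K\<bar> * \<delta>)" for x
    proof -
      have "x - T x = (\<Sum>b\<in>std_basis. coord b x *\<^sub>R (b - S b))"
        by (simp add: T_def scaleR_diff_right sum_subtractf sum_coord)
      also have "norm \<dots> \<le> (\<Sum>b\<in>(std_basis::'a set). (\<bar>K\<bar> * norm x) * \<delta>)"
      proof (rule sum_norm_le)
        fix b :: 'a assume b: "b \<in> std_basis"
        have "\<bar>coord b x\<bar> \<le> K * norm x" using K[OF b, of "\<lambda>b. coord b x"] by (simp add: sum_coord)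
        also have "\<dots> \<le> \<bar>K\<bar> * norm x" by (simp add: mult_right_mono)
        finally show "norm (coord b x *\<^sub>R (b - S b)) \<le> \<bar>K\<bar> * norm x * \<delta>"
          using S b by (simp add: norm_minus_commute mult_mono less_imp_le)
      qed
      finally show ?thesis by (simp add: n_def mult.commute mult.left_commute)
    qed
    have "T ` UNIV = UNIV"
    proof (rule linear_inj_on_subspace_onto[OF lin])
      fix x assume "T x = 0"
      then have le: "norm x \<le> norm x * (n * \<bar>K\<bar> * \<delta>)" using bd[of x] by simp
      have "n * \<bar>K\<bar> < (\<bar>K\<bar> + 1) * (n + 1)" by (simp add: algebra_simps add_pos_nonneg)
      then have "n * \<bar>K\<bar> * \<delta> < 1"
        unfolding \<delta>_def by (simp add: field_simps add_pos_nonneg)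
      then show "x = 0"
        using le by (metis mult.right_neutral mult_less_cancel_left_pos norm_le_zero_iff not_le)
    qed auto
    moreover have "range T \<subseteq> span (S ` std_basis)"
      unfolding T_def by (intro image_subsetI span_sum span_scale span_base imageI)
    ultimately show ?thesis by auto
  qed
  with \<delta> show ?thesis by blast
qed

text \<open>Nondegeneracy makes \<open>b \<mapsto> (\<Sum>c\<in>C. \<beta> b c *\<^sub>R c)\<close>, for a basis \<open>C\<close> of \<open>Q\<close>, an injective endomorphism of \<open>Q\<close>.
It is therefore onto, and a preimage of \<open>\<Sum>c\<in>C. f c *\<^sub>R c\<close> represents \<open>f\<close>. Working with this
endomorphism avoids the dual space of \<open>Q\<close>.\<close>

lemma nondegenerate_represents:
  fixes \<beta> :: "'a::finite_dim_normed \<Rightarrow> 'a \<Rightarrow> real"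
  assumes lin1: "\<And>c. linear (\<lambda>b. \<beta> b c)" and lin2: "\<And>b. linear (\<beta> b)" and f: "linear f"
    and Q: "subspace Q"
    and nd: "\<And>b. b \<in> Q \<Longrightarrow> (\<And>c. c \<in> Q \<Longrightarrow> \<beta> b c = 0) \<Longrightarrow> b = 0"
  shows "\<exists>b\<in>Q. \<forall>c\<in>Q. \<beta> b c = f c"
proof -
  interpret F: finite_dimensional_vector_space "(*\<^sub>R) :: real \<Rightarrow> 'a \<Rightarrow> 'a" "std_basis :: 'a set"
    by unfold_locales
      (simp_all add: finite_std_basis independent_std_basis[unfolded dependent_raw_def]
        span_std_basis[unfolded span_raw_def] scaleR_add_right scaleR_add_left)
  obtain C where C: "C \<subseteq> Q" "independent C" "Q \<subseteq> span C"
    using maximal_independent_subset[of Q] by blast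
  have finC: "finite C"
    using F.finiteI_independent[of C] C(2) by (simp add: dependent_raw_def)
  have eqC: "g c = h c" if "linear g" "linear h" "\<And>c. c \<in> C \<Longrightarrow> g c = h c" "c \<in> Q"
    for g h :: "'a \<Rightarrow> real" and c
    using linear_eq_on[OF that(1,2), of c C] that C(3) by blast
  define T where "T b = (\<Sum>c\<in>C. \<beta> b c *\<^sub>R c)" for b
  have coef: "\<beta> b c = \<gamma> c" if "T b = (\<Sum>c\<in>C. \<gamma> c *\<^sub>R c)" "c \<in> C" for b \<gamma> c
  proof -
    have "(\<Sum>c\<in>C. (\<beta> b c - \<gamma> c) *\<^sub>R c) = 0"
      using that(1) by (simp add: T_def scaleR_diff_left sum_subtractf)
    then show ?thesis
      using C(2) that(2) finC unfolding dependent_finite[OF finC] by (metis eq_iff_diff_eq_0)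
  qed
  have "T ` Q = Q"
  proof (rule linear_inj_on_subspace_onto[OF _ Q])
    show "linear T"
      unfolding T_def
      by (rule linearI)
        (simp_all add: linear_add[OF lin1] linear_scale[OF lin1] scaleR_add_left
          sum.distrib scaleR_sum_right)
    show "T ` Q \<subseteq> Q"
      unfolding T_def using C(1) Q by (auto intro!: subspace_sum subspace_scale)
    show "b = 0" if b: "b \<in> Q" "T b = 0" for b
    proof (rule nd[OF b(1)])
      fix c assume "c \<in> Q"
      then show "\<beta> b c = 0"
        using eqC[of "\<beta> b" "\<lambda>_. 0" c] lin2 coef[of b "\<lambda>_. 0"] b(2) linear_zero by simp
    qed
  qed
  moreover have "(\<Sum>c\<in>C. f c *\<^sub>R c) \<in> Q"
    using C(1) Q by (auto intro!: subspace_sum subspace_scale)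
  ultimately obtain b where b: "b \<in> Q" "T b = (\<Sum>c\<in>C. f c *\<^sub>R c)" by force
  have "\<forall>c\<in>Q. \<beta> b c = f c"
    using eqC[OF lin2[of b] f] coef[OF b(2)] by simp
  with b(1) show ?thesis by blast
qed


section \<open>Maps of class $C^k$\<close>

lemma frechet_derivative_eqI: "(f has_derivative D) (at x) \<Longrightarrow> frechet_derivative f (at x) = D"
  by (rule frechet_derivative_at[symmetric])

lemma differentiable_has_derivative:
  "f differentiable (at x) \<Longrightarrow> (f has_derivative frechet_derivative f (at x)) (at x)"
  by (simp add: frechet_derivative_works[symmetric])

lemma has_derivative_cong_open:
  assumes "open S" "x \<in> S" "\<And>y. y \<in> S \<Longrightarrow> f y = g y"
  shows "(f has_derivative D) (at x) \<longleftrightarrow> (g has_derivative D) (at x)"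
  using has_derivative_transform_within_open[OF _ assms(1,2), of f D UNIV g]
    has_derivative_transform_within_open[OF _ assms(1,2), of g D UNIV f] assms(3) by auto

lemma frechet_derivative_cong_open:
  assumes "open S" "x \<in> S" "\<And>y. y \<in> S \<Longrightarrow> f y = g y"
  shows "frechet_derivative f (at x) = frechet_derivative g (at x)"
  unfolding frechet_derivative_def using has_derivative_cong_open[OF assms] by simp

lemma ck_on_subset: "ck_on k T f \<Longrightarrow> S \<subseteq> T \<Longrightarrow> ck_on k S f"
  by (induction k arbitrary: f) (auto intro: continuous_on_subset)

lemma ck_on_cong:
  assumes "open S"
  shows "ck_on k S f \<Longrightarrow> (\<And>x. x \<in> S \<Longrightarrow> f x = g x) \<Longrightarrow> ck_on k S g"
proof (induction k arbitrary: f g)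
  case 0
  then show ?case using continuous_on_cong[of S S f g] by simp
next
  case (Suc k)
  have "g differentiable (at x)" if "x \<in> S" for x
  proof -
    have "f differentiable (at x)" using Suc.prems(1) that by simp
    then show ?thesis
      using has_derivative_cong_open[OF assms that, of f g] Suc.prems(2)
      unfolding differentiable_def by auto
  qed
  moreover have "ck_on k S (\<lambda>x. frechet_derivative g (at x) v)" for v
  proof (rule Suc.IH)
    show "ck_on k S (\<lambda>x. frechet_derivative f (at x) v)" using Suc.prems(1) by simp
    show "frechet_derivative f (at x) v = frechet_derivative g (at x) v" if "x \<in> S" for x
      using frechet_derivative_cong_open[OF assms that, of f g] Suc.prems(2) by simp
  qed
  ultimately show ?case by simp
qed

lemma ck_on_local:
  assumes "\<And>x. x \<in> S \<Longrightarrow> \<exists>T. open T \<and> x \<in> T \<and> ck_on k T f"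
  shows "ck_on k S f"
  using assms
proof (induction k arbitrary: f)
  case 0
  show ?case
    unfolding ck_on.simps
  proof (rule continuous_at_imp_continuous_on, rule ballI)
    fix x assume "x \<in> S"
    with 0 obtain T where "open T" "x \<in> T" "continuous_on T f" by auto
    then show "isCont f x" by (simp add: continuous_on_eq_continuous_at)
  qed
next
  case (Suc k)
  have "f differentiable (at x)" if "x \<in> S" for x using Suc.prems[OF that] by auto
  moreover have "ck_on k S (\<lambda>x. frechet_derivative f (at x) v)" for v
  proof (rule Suc.IH)
    fix x assume "x \<in> S"
    from Suc.prems[OF this] show "\<exists>T. open T \<and> x \<in> T \<and> ck_on k T (\<lambda>x. frechet_derivative f (at x) v)"
      by auto
  qed
  ultimately show ?case by simp
qed

lemma ck_on_SucD: "ck_on (Suc k) S f \<Longrightarrow> ck_on k S f"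
proof (induction k arbitrary: f)
  case 0
  then show ?case
    by (auto intro!: continuous_at_imp_continuous_on differentiable_imp_continuous_within)
next
  case (Suc k)
  have "ck_on k S (\<lambda>x. frechet_derivative f (at x) v)" for v
    by (rule Suc.IH) (use Suc.prems in simp)
  then show ?case using Suc.prems by simp
qed

lemma ck_on_SucI:
  assumes D: "\<And>x. x \<in> S \<Longrightarrow> (f has_derivative D x) (at x)" and S: "open S"
    and ck: "\<And>v. ck_on k S (\<lambda>x. D x v)"
  shows "ck_on (Suc k) S f"
proof -
  have eq: "D x v = frechet_derivative f (at x) v" if "x \<in> S" for x v
    using frechet_derivative_eqI[OF D[OF that]] by simp
  have "ck_on k S (\<lambda>x. frechet_derivative f (at x) v)" for v
    by (rule ck_on_cong[OF S ck[of v]]) (rule eq)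
  then show ?thesis using D by (auto simp: differentiable_def)
qed

lemma ck_on_has_derivative:
  "ck_on (Suc k) S f \<Longrightarrow> x \<in> S \<Longrightarrow> (f has_derivative frechet_derivative f (at x)) (at x)"
  by (simp add: differentiable_has_derivative)

lemma ck_on_const: "ck_on k S (\<lambda>_. c)"
proof (induction k arbitrary: c)
  case (Suc k)
  then show ?case by simp
qed simp

lemma ck_on_bounded_linear:
  assumes "bounded_linear L"
  shows "ck_on k S L"
proof (cases k)
  case 0
  then show ?thesis using assms by (simp add: linear_continuous_on)
next
  case (Suc j)
  have "frechet_derivative L (at x) = L" for x
    by (rule frechet_derivative_eqI) (rule bounded_linear_imp_has_derivative[OF assms])
  then show ?thesis
    using Suc assms by (simp add: bounded_linear_imp_differentiable ck_on_const)
qed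

lemma ck_on_linear_compose:
  assumes L: "bounded_linear L" and S: "open S"
  shows "ck_on k S f \<Longrightarrow> ck_on k S (\<lambda>x. L (f x))"
proof (induction k arbitrary: f)
  case 0
  then show ?case using L by (simp add: bounded_linear.continuous_on)
next
  case (Suc k)
  show ?case
    by (rule ck_on_SucI[where D="\<lambda>x v. L (frechet_derivative f (at x) v)", OF _ S])
      (use Suc in \<open>auto intro!: bounded_linear.has_derivative[OF L] differentiable_has_derivative\<close>)
qed

lemma ck_on_compose_affine:
  assumes L: "bounded_linear L" and S: "open S"
  shows "ck_on k S f \<Longrightarrow> ck_on k ((\<lambda>x. L x + a) -` S) (\<lambda>x. f (L x + a))"
proof (induction k arbitrary: f)
  case 0
  have "continuous_on ((\<lambda>x. L x + a) -` S) (\<lambda>x. L x + a)"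
    using L by (intro continuous_intros linear_continuous_on)
  moreover have "continuous_on ((\<lambda>x. L x + a) ` ((\<lambda>x. L x + a) -` S)) f"
    using 0 by (auto intro: continuous_on_subset)
  ultimately show ?case
    using continuous_on_compose[of _ "\<lambda>x. L x + a" f] by (simp add: o_def)
next
  case (Suc k)
  have der: "((\<lambda>x. L x + a) has_derivative L) (at x)" for x
    using bounded_linear_imp_has_derivative[OF L] by (auto intro!: derivative_eq_intros)
  have op: "open ((\<lambda>x. L x + a) -` S)"
    using L S by (intro open_vimage continuous_intros linear_continuous_on)
  show ?case
  proof (rule ck_on_SucI[where D="\<lambda>x v. frechet_derivative f (at (L x + a)) (L v)", OF _ op])
    fix x assume "x \<in> (\<lambda>x. L x + a) -` S"
    then show "((\<lambda>x. f (L x + a)) has_derivative (\<lambda>v. frechet_derivative f (at (L x + a)) (L v))) (at x)"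
      using has_derivative_compose[OF der ck_on_has_derivative[OF Suc.prems]] by auto
  next
    fix v
    show "ck_on k ((\<lambda>x. L x + a) -` S) (\<lambda>x. frechet_derivative f (at (L x + a)) (L v))"
      by (rule Suc.IH) (use Suc.prems in simp)
  qed
qed

lemma ck_on_add:
  assumes S: "open S"
  shows "ck_on k S f \<Longrightarrow> ck_on k S g \<Longrightarrow> ck_on k S (\<lambda>x. f x + g x)"
proof (induction k arbitrary: f g)
  case 0
  then show ?case by (simp add: continuous_on_add)
next
  case (Suc k)
  show ?case
    by (rule ck_on_SucI[where D="\<lambda>x v. frechet_derivative f (at x) v + frechet_derivative g (at x) v", OF _ S])
      (use Suc in \<open>auto intro!: has_derivative_add differentiable_has_derivative\<close>)
qed

lemma ck_on_sum:
  assumes "open S" "finite B" "\<And>b. b \<in> B \<Longrightarrow> ck_on k S (f b)"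
  shows "ck_on k S (\<lambda>x. \<Sum>b\<in>B. f b x)"
  using assms(2,3)
  by (induction B rule: finite_induct) (auto simp: ck_on_const intro!: ck_on_add assms(1))

lemma ck_on_scaleR:
  fixes f :: "'a::real_normed_vector \<Rightarrow> real" and g :: "'a \<Rightarrow> 'b::real_normed_vector"
  assumes S: "open S"
  shows "ck_on k S f \<Longrightarrow> ck_on k S g \<Longrightarrow> ck_on k S (\<lambda>x. f x *\<^sub>R g x)"
proof (induction k arbitrary: f g)
  case 0
  then show ?case by (simp add: continuous_on_scaleR)
next
  case (Suc k)
  have f: "ck_on k S f" and g: "ck_on k S g" using Suc.prems ck_on_SucD by blast+
  show ?case
  proof (rule ck_on_SucI[where D="\<lambda>x v. f x *\<^sub>R frechet_derivative g (at x) v + frechet_derivative f (at x) v *\<^sub>R g x", OF _ S])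
    fix x assume "x \<in> S"
    then show "((\<lambda>x. f x *\<^sub>R g x) has_derivative
        (\<lambda>v. f x *\<^sub>R frechet_derivative g (at x) v + frechet_derivative f (at x) v *\<^sub>R g x)) (at x)"
      using Suc.prems by (intro has_derivative_scaleR differentiable_has_derivative) auto
  next
    fix v
    show "ck_on k S (\<lambda>x. f x *\<^sub>R frechet_derivative g (at x) v + frechet_derivative f (at x) v *\<^sub>R g x)"
      using Suc.prems f g by (intro ck_on_add S Suc.IH) auto
  qed
qed

text \<open>The derivative of the composition in direction \<open>v\<close> evaluates the derivative of \<open>f\<close> in a direction that
varies with the point. Expanding that direction in a basis gives a finite sum of products of a
coordinate of the derivative of \<open>g\<close> with a derivative of \<open>f\<close> in a fixed direction, to which the induction
hypothesis applies.\<close>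

lemma ck_on_compose:
  fixes g :: "'a::real_normed_vector \<Rightarrow> 'b::finite_dim_normed"
  assumes S: "open S" and T: "open T" and ST: "g ` S \<subseteq> T"
  shows "ck_on k S g \<Longrightarrow> ck_on k T f \<Longrightarrow> ck_on k S (\<lambda>x. f (g x))"
proof (induction k arbitrary: f)
  case 0
  then have "continuous_on (g ` S) f" using ST continuous_on_subset by auto
  then show ?case using 0 continuous_on_compose[of S g f] by (simp add: o_def)
next
  case (Suc k)
  have g: "ck_on k S g" using Suc.prems ck_on_SucD by blast
  let ?D = "\<lambda>x v. \<Sum>b\<in>std_basis. coord b (frechet_derivative g (at x) v) *\<^sub>R frechet_derivative f (at (g x)) b"
  show ?case
  proof (rule ck_on_SucI[where D="?D", OF _ S])
    fix x assume x: "x \<in> S"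
    then have df: "(f has_derivative frechet_derivative f (at (g x))) (at (g x))"
      using ST Suc.prems by (intro ck_on_has_derivative[OF Suc.prems(2)]) auto
    have "((\<lambda>x. f (g x)) has_derivative
        (\<lambda>v. frechet_derivative f (at (g x)) (frechet_derivative g (at x) v))) (at x)"
      by (rule has_derivative_compose[OF ck_on_has_derivative[OF Suc.prems(1) x] df])
    moreover have "(\<lambda>v. frechet_derivative f (at (g x)) (frechet_derivative g (at x) v)) = ?D x"
      by (rule ext) (rule linear_sum_coord[OF has_derivative_linear[OF df]])
    ultimately show "((\<lambda>x. f (g x)) has_derivative ?D x) (at x)" by simp
  next
    fix v
    show "ck_on k S (\<lambda>x. ?D x v)"
    proof (intro ck_on_sum ck_on_scaleR S finite_std_basis)
      fix b :: 'b assume b: "b \<in> std_basis"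
      show "ck_on k S (\<lambda>x. coord b (frechet_derivative g (at x) v))"
        by (rule ck_on_linear_compose[OF bounded_linear_coord[OF b] S]) (use Suc.prems in simp)
      show "ck_on k S (\<lambda>x. frechet_derivative f (at (g x)) b)"
        by (rule Suc.IH[OF g]) (use Suc.prems in simp)
    qed
  qed
qed

lemma smooth_on_subset: "smooth_on T f \<Longrightarrow> S \<subseteq> T \<Longrightarrow> smooth_on S f"
  unfolding smooth_on_def using ck_on_subset by blast

lemma smooth_on_cong: "smooth_on S f \<Longrightarrow> open S \<Longrightarrow> (\<And>x. x \<in> S \<Longrightarrow> f x = g x) \<Longrightarrow> smooth_on S g"
  unfolding smooth_on_def using ck_on_cong by blast

lemma smooth_on_local:
  assumes "\<And>x. x \<in> S \<Longrightarrow> \<exists>T. open T \<and> x \<in> T \<and> smooth_on T f"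
  shows "smooth_on S f"
  unfolding smooth_on_def
proof
  fix k
  show "ck_on k S f"
    by (rule ck_on_local) (use assms in \<open>unfold smooth_on_def, blast\<close>)
qed

lemma smooth_on_has_derivative:
  "smooth_on S f \<Longrightarrow> x \<in> S \<Longrightarrow> (f has_derivative frechet_derivative f (at x)) (at x)"
  unfolding smooth_on_def by (metis ck_on_has_derivative)

lemma smooth_on_derivative: "smooth_on S f \<Longrightarrow> smooth_on S (\<lambda>x. frechet_derivative f (at x) v)"
  unfolding smooth_on_def by (metis ck_on.simps(2))

lemma smooth_on_imp_continuous_on: "smooth_on S f \<Longrightarrow> continuous_on S f"
  unfolding smooth_on_def by (metis ck_on.simps(1))

lemma smooth_on_bounded_linear: "bounded_linear L \<Longrightarrow> smooth_on S L"
  by (simp add: smooth_on_def ck_on_bounded_linear)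

lemma smooth_on_compose_affine:
  "smooth_on S f \<Longrightarrow> bounded_linear L \<Longrightarrow> open S \<Longrightarrow>
    smooth_on ((\<lambda>x. L x + a) -` S) (\<lambda>x. f (L x + a))"
  by (simp add: smooth_on_def ck_on_compose_affine)

lemma smooth_on_compose:
  fixes g :: "'a::real_normed_vector \<Rightarrow> 'b::finite_dim_normed"
  assumes "smooth_on S g" "smooth_on T f" "open S" "open T" "g ` S \<subseteq> T"
  shows "smooth_on S (\<lambda>x. f (g x))"
  using assms ck_on_compose unfolding smooth_on_def by blast


section \<open>Smooth maps between manifolds\<close>

text \<open>The conditions of \<^const>\<open>smooth_manifold\<close> without its sort constraints, so that the model vector
spaces with \<^const>\<open>vec_atlas\<close> are covered by the same lemmas as the manifolds.\<close>

definition smooth_atlas :: "('m::topological_space, 'e::real_normed_vector) atlas \<Rightarrow> bool" where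
  "smooth_atlas A \<longleftrightarrow> (\<forall>c\<in>A. is_chart c) \<and> (\<Union>c\<in>A. fst c) = UNIV \<and>
     (\<forall>c\<in>A. \<forall>d\<in>A. smooth_on (snd c ` (fst c \<inter> fst d)) (snd d \<circ> chart_inv c))"

lemma smooth_manifold_atlas: "smooth_manifold A \<Longrightarrow> smooth_atlas A"
  by (simp add: smooth_manifold_def smooth_atlas_def)

lemma chart_inv_vec: "chart_inv (UNIV, id) = id"
  by (simp add: chart_inv_def fun_eq_iff)

lemma chart_at_vec: "chart_at vec_atlas x = (UNIV, id)"
  unfolding chart_at_def vec_atlas_def by (rule some_equality) auto

lemma smooth_atlas_vec: "smooth_atlas vec_atlas"
  by (auto simp: smooth_atlas_def vec_atlas_def is_chart_def chart_inv_vec homeomorphism_def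
      smooth_on_bounded_linear id_def[symmetric] simp flip: id_def
      intro!: smooth_on_bounded_linear[OF bounded_linear_ident, folded id_def])

lemma continuous_on_open_tendsto_nhds:
  assumes "continuous_on S f" "open S" "x \<in> S"
  shows "(f \<longlongrightarrow> f x) (nhds x)"
proof -
  have "(f \<longlongrightarrow> f x) (at x within S)" using assms(1,3) unfolding continuous_on_def by blast
  then have "(f \<longlongrightarrow> f x) (at x)" using at_within_open[OF assms(3,2)] by simp
  then show ?thesis using tendsto_at_iff_tendsto_nhds by blast
qed

context
  fixes c :: "('m::topological_space, 'e::real_normed_vector) chart"
  assumes c: "is_chart c"
begin

lemma chart_open: "open (fst c)" "open (snd c ` fst c)"
  using c by (auto simp: is_chart_def)

lemma chart_inv_left: "x \<in> fst c \<Longrightarrow> chart_inv c (snd c x) = x"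
  using c by (auto simp: is_chart_def homeomorphism_def)

lemma chart_inv_right: "y \<in> snd c ` fst c \<Longrightarrow> snd c (chart_inv c y) = y"
  using c by (auto simp: is_chart_def homeomorphism_def)

lemma chart_inv_mem: "y \<in> snd c ` fst c \<Longrightarrow> chart_inv c y \<in> fst c"
  using c by (auto simp: is_chart_def homeomorphism_def)

lemma chart_continuous: "continuous_on (fst c) (snd c)"
  and chart_inv_continuous: "continuous_on (snd c ` fst c) (chart_inv c)"
  using c by (auto simp: is_chart_def homeomorphism_def)

lemma chart_inv_tendsto:
  "y \<in> snd c ` fst c \<Longrightarrow> (chart_inv c \<longlongrightarrow> chart_inv c y) (nhds y)"
  by (rule continuous_on_open_tendsto_nhds[OF chart_inv_continuous chart_open(2)])

lemma chart_image_Int: "snd c ` (fst c \<inter> S) = snd c ` fst c \<inter> chart_inv c -` S"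
  using chart_inv_left by force

lemma chart_image_open:
  assumes "open S"
  shows "open (snd c ` (fst c \<inter> S))"
  unfolding chart_image_Int
  by (rule continuous_open_preimage[OF chart_inv_continuous chart_open(2) assms])

end

lemma smooth_atlas_chart: "smooth_atlas A \<Longrightarrow> c \<in> A \<Longrightarrow> is_chart c"
  by (simp add: smooth_atlas_def)

lemma chart_at_mem:
  assumes "smooth_atlas A"
  shows "chart_at A m \<in> A" "m \<in> fst (chart_at A m)"
proof -
  have "m \<in> (\<Union>c\<in>A. fst c)" using assms by (simp add: smooth_atlas_def)
  then have "\<exists>c. c \<in> A \<and> m \<in> fst c" by blast
  from someI_ex[OF this] show "chart_at A m \<in> A" "m \<in> fst (chart_at A m)"
    by (auto simp: chart_at_def)
qed

lemma is_chart_chart_at: "smooth_atlas A \<Longrightarrow> is_chart (chart_at A m)"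
  using chart_at_mem smooth_atlas_chart by blast

lemma rep_domain_open:
  assumes "is_chart c" "is_chart d" "open S" "continuous_on S f"
  shows "open (snd c ` (fst c \<inter> S \<inter> f -` fst d))"
proof -
  have "open (S \<inter> f -` fst d)"
    by (rule continuous_open_preimage[OF assms(4,3) chart_open(1)[OF assms(2)]])
  from chart_image_open[OF assms(1) this] show ?thesis by (simp add: Int_assoc)
qed


lemma smooth_map_subset:
  assumes "smooth_map A B S f" "open T" "T \<subseteq> S"
  shows "smooth_map A B T f"
  unfolding smooth_map_def
proof (intro conjI ballI)
  show "continuous_on T f" using assms continuous_on_subset by (auto simp: smooth_map_def)
  fix c d assume "c \<in> A" "d \<in> B"
  then have "smooth_on (snd c ` (fst c \<inter> S \<inter> f -` fst d)) (snd d \<circ> f \<circ> chart_inv c)"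
    using assms(1) by (simp add: smooth_map_def)
  then show "smooth_on (snd c ` (fst c \<inter> T \<inter> f -` fst d)) (snd d \<circ> f \<circ> chart_inv c)"
    by (rule smooth_on_subset) (use assms(3) in auto)
qed (use assms in auto)

lemma smooth_map_cong:
  assumes A: "smooth_atlas A" and B: "smooth_atlas B"
    and f: "smooth_map A B S f" and eq: "\<And>x. x \<in> S \<Longrightarrow> f x = g x"
  shows "smooth_map A B S g"
  unfolding smooth_map_def
proof (intro conjI ballI)
  show "open S" using f by (simp add: smooth_map_def)
  show g: "continuous_on S g"
    using f eq continuous_on_cong[of S S f g] by (simp add: smooth_map_def)
  fix c d assume cd: "c \<in> A" "d \<in> B"
  then have "smooth_on (snd c ` (fst c \<inter> S \<inter> f -` fst d)) (snd d \<circ> f \<circ> chart_inv c)"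
    using f by (simp add: smooth_map_def)
  moreover have "fst c \<inter> S \<inter> f -` fst d = fst c \<inter> S \<inter> g -` fst d" using eq by auto
  ultimately have "smooth_on (snd c ` (fst c \<inter> S \<inter> g -` fst d)) (snd d \<circ> f \<circ> chart_inv c)" by simp
  then show "smooth_on (snd c ` (fst c \<inter> S \<inter> g -` fst d)) (snd d \<circ> g \<circ> chart_inv c)"
  proof (rule smooth_on_cong)
    show "open (snd c ` (fst c \<inter> S \<inter> g -` fst d))"
      using rep_domain_open smooth_atlas_chart[OF A] smooth_atlas_chart[OF B] cd g \<open>open S\<close> by blast
    show "(snd d \<circ> f \<circ> chart_inv c) x = (snd d \<circ> g \<circ> chart_inv c) x"
      if "x \<in> snd c ` (fst c \<inter> S \<inter> g -` fst d)" for x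
      using that eq chart_inv_left[OF smooth_atlas_chart[OF A cd(1)]] by auto
  qed
qed

lemma smooth_map_local:
  assumes A: "smooth_atlas A" and B: "smooth_atlas B"
    and loc: "\<And>p. p \<in> S \<Longrightarrow> \<exists>N. p \<in> N \<and> N \<subseteq> S \<and> smooth_map A B N f"
  shows "smooth_map A B S f"
  unfolding smooth_map_def
proof (intro conjI ballI)
  show "open S"
    
  proof (subst open_subopen, rule ballI)
    fix p assume "p \<in> S"
    with loc obtain N where "p \<in> N" "N \<subseteq> S" "smooth_map A B N f" by blast
    then show "\<exists>T. open T \<and> p \<in> T \<and> T \<subseteq> S" by (auto simp: smooth_map_def)
  qed
  show "continuous_on S f"
    unfolding continuous_on_def
  proof
    fix p assume "p \<in> S"
    with loc obtain N where "p \<in> N" "smooth_map A B N f" by blast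
    then have "(f \<longlongrightarrow> f p) (nhds p)"
      by (intro continuous_on_open_tendsto_nhds[of N]) (auto simp: smooth_map_def)
    then show "(f \<longlongrightarrow> f p) (at p within S)" by (rule tendsto_mono[OF at_within_le_nhds])
  qed
  fix c d assume cd: "c \<in> A" "d \<in> B"
  show "smooth_on (snd c ` (fst c \<inter> S \<inter> f -` fst d)) (snd d \<circ> f \<circ> chart_inv c)"
  proof (rule smooth_on_local)
    fix x assume "x \<in> snd c ` (fst c \<inter> S \<inter> f -` fst d)"
    then obtain p where p: "x = snd c p" "p \<in> fst c" "p \<in> S" "f p \<in> fst d" by auto
    obtain N where N: "p \<in> N" "smooth_map A B N f" using loc p(3) by blast
    let ?T = "snd c ` (fst c \<inter> N \<inter> f -` fst d)"
    have "open ?T"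
      by (rule rep_domain_open[OF smooth_atlas_chart[OF A cd(1)] smooth_atlas_chart[OF B cd(2)]])
        (use N(2) in \<open>auto simp: smooth_map_def\<close>)
    moreover have "x \<in> ?T" using p N by auto
    moreover have "smooth_on ?T (snd d \<circ> f \<circ> chart_inv c)"
      using N(2) cd by (simp add: smooth_map_def)
    ultimately show "\<exists>T. open T \<and> x \<in> T \<and> smooth_on T (snd d \<circ> f \<circ> chart_inv c)" by blast
  qed
qed

text \<open>Smoothness can be checked near each point, where the chart expression of the composition factors
through a chart around the intermediate value.\<close>

lemma smooth_map_compose:
  fixes B :: "('n::topological_space, 'f::finite_dim_normed) atlas"
  assumes A: "smooth_atlas A" and B: "smooth_atlas B" and C: "smooth_atlas C"
    and f: "smooth_map A B S f" and g: "smooth_map B C T g" and ST: "f ` S \<subseteq> T"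
  shows "smooth_map A C S (g \<circ> f)"
  unfolding smooth_map_def
proof (intro conjI ballI)
  show oS: "open S" using f by (simp add: smooth_map_def)
  have cf: "continuous_on S f" and cg: "continuous_on T g" and oT: "open T"
    using f g by (auto simp: smooth_map_def)
  show cgf: "continuous_on S (g \<circ> f)"
    using cf cg ST continuous_on_subset by (intro continuous_on_compose) auto
  fix c e assume ce: "c \<in> A" "e \<in> C"
  note chc = smooth_atlas_chart[OF A ce(1)] and che = smooth_atlas_chart[OF C ce(2)]
  show "smooth_on (snd c ` (fst c \<inter> S \<inter> (g \<circ> f) -` fst e)) (snd e \<circ> (g \<circ> f) \<circ> chart_inv c)"
  proof (rule smooth_on_local)
    fix x assume "x \<in> snd c ` (fst c \<inter> S \<inter> (g \<circ> f) -` fst e)"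
    then obtain p where p: "x = snd c p" "p \<in> fst c" "p \<in> S" "g (f p) \<in> fst e" by auto
    define d where "d = chart_at B (f p)"
    have d: "d \<in> B" "f p \<in> fst d" using chart_at_mem[OF B] by (auto simp: d_def)
    note chd = smooth_atlas_chart[OF B d(1)]
    let ?U1 = "fst c \<inter> S \<inter> f -` fst d" and ?V = "snd d ` (fst d \<inter> T \<inter> g -` fst e)"
    let ?N = "?U1 \<inter> (g \<circ> f) -` fst e"
    have "open (S \<inter> f -` fst d)"
      by (rule continuous_open_preimage[OF cf oS chart_open(1)[OF chd]])
    moreover have "open (S \<inter> (g \<circ> f) -` fst e)"
      by (rule continuous_open_preimage[OF cgf oS chart_open(1)[OF che]])
    ultimately have "open ((S \<inter> f -` fst d) \<inter> (S \<inter> (g \<circ> f) -` fst e))" by blast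
    from chart_image_open[OF chc this]
    have op: "open (snd c ` ?N)"
      by (rule back_subst[where P="open"]) (rule arg_cong[where f="image (snd c)"], auto)
    have "smooth_on (snd c ` ?U1) (snd d \<circ> f \<circ> chart_inv c)"
      using f ce d by (simp add: smooth_map_def)
    then have s1: "smooth_on (snd c ` ?N) (snd d \<circ> f \<circ> chart_inv c)"
      by (rule smooth_on_subset) auto
    have s2: "smooth_on ?V (snd e \<circ> g \<circ> chart_inv d)"
      using g ce d by (simp add: smooth_map_def)
    have oV: "open ?V" by (rule rep_domain_open[OF chd che oT cg])
    have im: "(snd d \<circ> f \<circ> chart_inv c) ` snd c ` ?N \<subseteq> ?V"
      using chart_inv_left[OF chc] ST by auto
    have "smooth_on (snd c ` ?N) (\<lambda>x. (snd e \<circ> g \<circ> chart_inv d) ((snd d \<circ> f \<circ> chart_inv c) x))"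
      by (rule smooth_on_compose[OF s1 s2 op oV im])
    then have "smooth_on (snd c ` ?N) (snd e \<circ> (g \<circ> f) \<circ> chart_inv c)"
      by (rule smooth_on_cong[OF _ op])
        (use chart_inv_left[OF chc] chart_inv_left[OF chd] in auto)
    moreover have "x \<in> snd c ` ?N" using p d by auto
    ultimately show "\<exists>T. open T \<and> x \<in> T \<and> smooth_on T (snd e \<circ> (g \<circ> f) \<circ> chart_inv c)"
      using op by blast
  qed
qed

lemma smooth_map_vec_atlas:
  "smooth_map vec_atlas vec_atlas S f \<longleftrightarrow> open S \<and> smooth_on S f"
  by (auto simp: smooth_map_def vec_atlas_def chart_inv_vec smooth_on_imp_continuous_on)

lemma smooth_map_chart:
  assumes A: "smooth_atlas A" and c: "c \<in> A"
  shows "smooth_map A vec_atlas (fst c) (snd c)"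
  unfolding smooth_map_def
proof (intro conjI ballI)
  note ch = smooth_atlas_chart[OF A c]
  show "open (fst c)" "continuous_on (fst c) (snd c)"
    using chart_open[OF ch] chart_continuous[OF ch] by auto
  fix d e assume d: "d \<in> A" and "e \<in> (vec_atlas :: ('b, 'b) atlas)"
  then show "smooth_on (snd d ` (fst d \<inter> fst c \<inter> snd c -` fst e)) (snd e \<circ> snd c \<circ> chart_inv d)"
    using A c by (auto simp: smooth_atlas_def vec_atlas_def)
qed

lemma smooth_map_chart_inv:
  assumes A: "smooth_atlas A" and c: "c \<in> A"
  shows "smooth_map vec_atlas A (snd c ` fst c) (chart_inv c)"
  unfolding smooth_map_def
proof (intro conjI ballI)
  note ch = smooth_atlas_chart[OF A c]
  show "open (snd c ` fst c)" "continuous_on (snd c ` fst c) (chart_inv c)"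
    using chart_open[OF ch] chart_inv_continuous[OF ch] by auto
  fix e d assume d: "d \<in> A" and "e \<in> (vec_atlas :: ('b, 'b) atlas)"
  then have e: "e = (UNIV, id)" by (simp add: vec_atlas_def)
  have "snd e ` (fst e \<inter> snd c ` fst c \<inter> chart_inv c -` fst d) = snd c ` (fst c \<inter> fst d)"
    by (simp add: e chart_image_Int[OF ch])
  then show "smooth_on (snd e ` (fst e \<inter> snd c ` fst c \<inter> chart_inv c -` fst d)) (snd d \<circ> chart_inv c \<circ> chart_inv e)"
    using A c d by (simp add: smooth_atlas_def e chart_inv_vec)
qed


section \<open>Smooth maps on products\<close>

lemma chart_inv_prod:
  assumes c: "is_chart c" and d: "is_chart d" and x: "x \<in> snd c ` fst c" and y: "y \<in> snd d ` fst d"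
  shows "chart_inv (fst c \<times> fst d, map_prod (snd c) (snd d)) (x, y) = (chart_inv c x, chart_inv d y)"
proof -
  have inj: "inj_on (map_prod (snd c) (snd d)) (fst c \<times> fst d)"
    by (intro map_prod_inj_on)
      (rule inj_on_inverseI, erule chart_inv_left[OF c], rule inj_on_inverseI, erule chart_inv_left[OF d])
  have "inv_into (fst c \<times> fst d) (map_prod (snd c) (snd d)) (x, y) = (chart_inv c x, chart_inv d y)"
    by (rule inv_into_f_eq[OF inj])
      (simp_all add: chart_inv_mem[OF c x] chart_inv_mem[OF d y] chart_inv_right[OF c x] chart_inv_right[OF d y])
  then show ?thesis by (simp add: chart_inv_def)
qed

text \<open>The chart expression of a map on a product, written with the charts of the two factors instead of a
chart of \<^const>\<open>prod_atlas\<close>, so that either factor can be fixed.\<close>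

definition prod_rep_domain where
  "prod_rep_domain c d e f = {p. fst p \<in> snd c ` fst c \<and> snd p \<in> snd d ` fst d \<and>
     f (chart_inv c (fst p), chart_inv d (snd p)) \<in> fst e}"

definition prod_rep where
  "prod_rep c d e f p = snd e (f (chart_inv c (fst p), chart_inv d (snd p)))"

lemma smooth_prod_rep:
  assumes A: "smooth_atlas A" and B: "smooth_atlas B" and C: "smooth_atlas C"
    and f: "smooth_map (prod_atlas A B) C UNIV f" and c: "c \<in> A" and d: "d \<in> B" and e: "e \<in> C"
  shows "open (prod_rep_domain c d e f)" "smooth_on (prod_rep_domain c d e f) (prod_rep c d e f)"
proof -
  note chc = smooth_atlas_chart[OF A c] and chd = smooth_atlas_chart[OF B d]
    and che = smooth_atlas_chart[OF C e]
  let ?p = "(fst c \<times> fst d, map_prod (snd c) (snd d))"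
  have "continuous_on (snd c ` fst c \<times> snd d ` fst d) (\<lambda>p. f (chart_inv c (fst p), chart_inv d (snd p)))"
  proof (rule continuous_on_compose2[of UNIV f])
    show "continuous_on UNIV f" using f by (simp add: smooth_map_def)
    show "continuous_on (snd c ` fst c \<times> snd d ` fst d) (\<lambda>p. (chart_inv c (fst p), chart_inv d (snd p)))"
      by (intro continuous_on_Pair continuous_on_compose2[OF chart_inv_continuous[OF chc]]
          continuous_on_compose2[OF chart_inv_continuous[OF chd]] continuous_intros) auto
  qed auto
  from continuous_open_preimage[OF this open_Times[OF chart_open(2)[OF chc] chart_open(2)[OF chd]] chart_open(1)[OF che]]
  show op: "open (prod_rep_domain c d e f)"
    by (rule back_subst[where P="open"]) (auto simp: prod_rep_domain_def)
  have im: "snd ?p ` (fst ?p \<inter> UNIV \<inter> f -` fst e) = prod_rep_domain c d e f"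
  proof (intro equalityI subsetI)
    fix p assume "p \<in> snd ?p ` (fst ?p \<inter> UNIV \<inter> f -` fst e)"
    then show "p \<in> prod_rep_domain c d e f"
      by (auto simp: prod_rep_domain_def chart_inv_left[OF chc] chart_inv_left[OF chd])
  next
    fix p assume p: "p \<in> prod_rep_domain c d e f"
    then have "(chart_inv c (fst p), chart_inv d (snd p)) \<in> fst ?p \<inter> UNIV \<inter> f -` fst e"
      "p = snd ?p (chart_inv c (fst p), chart_inv d (snd p))"
      by (auto simp: prod_rep_domain_def chart_inv_mem[OF chc] chart_inv_mem[OF chd]
          chart_inv_right[OF chc] chart_inv_right[OF chd] prod_eq_iff)
    then show "p \<in> snd ?p ` (fst ?p \<inter> UNIV \<inter> f -` fst e)" by blast
  qed
  have "?p \<in> prod_atlas A B" using c d unfolding prod_atlas_def by blast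
  then have "smooth_on (snd ?p ` (fst ?p \<inter> UNIV \<inter> f -` fst e)) (snd e \<circ> f \<circ> chart_inv ?p)"
    using f e unfolding smooth_map_def by blast
  then have "smooth_on (prod_rep_domain c d e f) (snd e \<circ> f \<circ> chart_inv ?p)" by (simp only: im)
  then show "smooth_on (prod_rep_domain c d e f) (prod_rep c d e f)"
    by (rule smooth_on_cong[OF _ op])
      (auto simp: prod_rep_domain_def prod_rep_def chart_inv_prod[OF chc chd])
qed

text \<open>Fixing one argument precomposes the chart expression with an affine map. A product has no tangent
space tied to those of its factors, because \<^const>\<open>chart_at\<close> may choose any product chart; the
partial maps of a group multiplication or action are therefore treated as maps of one variable.\<close>

lemma smooth_map_slice_right:
  assumes A: "smooth_atlas A" and B: "smooth_atlas B" and C: "smooth_atlas C"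
    and f: "smooth_map (prod_atlas A B) C UNIV f"
  shows "smooth_map B C UNIV (\<lambda>y. f (a, y))"
  unfolding smooth_map_def
proof (intro conjI ballI)
  show "continuous_on UNIV (\<lambda>y. f (a, y))"
    by (rule continuous_on_compose2[of UNIV f])
      (use f in \<open>auto simp: smooth_map_def intro!: continuous_on_Pair continuous_on_const continuous_on_id\<close>)
  fix d e assume d: "d \<in> B" and e: "e \<in> C"
  define c where "c = chart_at A a"
  have c: "c \<in> A" "a \<in> fst c" using chart_at_mem[OF A] by (auto simp: c_def)
  note chc = smooth_atlas_chart[OF A c(1)] and chd = smooth_atlas_chart[OF B d]
  let ?L = "\<lambda>y. (0, y) + (snd c a, 0)"
  note sm = smooth_prod_rep[OF A B C f c(1) d e]
  have "smooth_on (?L -` prod_rep_domain c d e f) (\<lambda>y. prod_rep c d e f (?L y))"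
    by (rule smooth_on_compose_affine[OF sm(2) _ sm(1)]) (intro bounded_linear_Pair bounded_linear_zero bounded_linear_ident)
  moreover have "snd d ` (fst d \<inter> UNIV \<inter> (\<lambda>y. f (a, y)) -` fst e) \<subseteq> ?L -` prod_rep_domain c d e f"
    using c by (auto simp: prod_rep_domain_def chart_inv_left[OF chc] chart_inv_left[OF chd])
  ultimately have "smooth_on (snd d ` (fst d \<inter> UNIV \<inter> (\<lambda>y. f (a, y)) -` fst e)) (\<lambda>y. prod_rep c d e f (?L y))"
    by (rule smooth_on_subset)
  moreover have "(\<lambda>y. prod_rep c d e f (?L y)) = snd e \<circ> (\<lambda>y. f (a, y)) \<circ> chart_inv d"
    using c(2) by (simp add: prod_rep_def fun_eq_iff chart_inv_left[OF chc])
  ultimately show "smooth_on (snd d ` (fst d \<inter> UNIV \<inter> (\<lambda>y. f (a, y)) -` fst e)) (snd e \<circ> (\<lambda>y. f (a, y)) \<circ> chart_inv d)"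
    by simp
qed simp

lemma smooth_map_slice_left:
  assumes A: "smooth_atlas A" and B: "smooth_atlas B" and C: "smooth_atlas C"
    and f: "smooth_map (prod_atlas A B) C UNIV f"
  shows "smooth_map A C UNIV (\<lambda>x. f (x, b))"
  unfolding smooth_map_def
proof (intro conjI ballI)
  show "continuous_on UNIV (\<lambda>x. f (x, b))"
    by (rule continuous_on_compose2[of UNIV f])
      (use f in \<open>auto simp: smooth_map_def intro!: continuous_on_Pair continuous_on_const continuous_on_id\<close>)
  fix c e assume c: "c \<in> A" and e: "e \<in> C"
  define d where "d = chart_at B b"
  have d: "d \<in> B" "b \<in> fst d" using chart_at_mem[OF B] by (auto simp: d_def)
  note chc = smooth_atlas_chart[OF A c] and chd = smooth_atlas_chart[OF B d(1)]
  let ?L = "\<lambda>x. (x, 0) + (0, snd d b)"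
  note sm = smooth_prod_rep[OF A B C f c d(1) e]
  have "smooth_on (?L -` prod_rep_domain c d e f) (\<lambda>x. prod_rep c d e f (?L x))"
    by (rule smooth_on_compose_affine[OF sm(2) _ sm(1)]) (intro bounded_linear_Pair bounded_linear_zero bounded_linear_ident)
  moreover have "snd c ` (fst c \<inter> UNIV \<inter> (\<lambda>x. f (x, b)) -` fst e) \<subseteq> ?L -` prod_rep_domain c d e f"
    using d by (auto simp: prod_rep_domain_def chart_inv_left[OF chc] chart_inv_left[OF chd])
  ultimately have "smooth_on (snd c ` (fst c \<inter> UNIV \<inter> (\<lambda>x. f (x, b)) -` fst e)) (\<lambda>x. prod_rep c d e f (?L x))"
    by (rule smooth_on_subset)
  moreover have "(\<lambda>x. prod_rep c d e f (?L x)) = snd e \<circ> (\<lambda>x. f (x, b)) \<circ> chart_inv c"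
    using d(2) by (simp add: prod_rep_def fun_eq_iff chart_inv_left[OF chd])
  ultimately show "smooth_on (snd c ` (fst c \<inter> UNIV \<inter> (\<lambda>x. f (x, b)) -` fst e)) (snd e \<circ> (\<lambda>x. f (x, b)) \<circ> chart_inv c)"
    by simp
qed simp


section \<open>Tangent maps\<close>

text \<open>The relational form of \<^const>\<open>tangent_map\<close>. Continuity at the point is included because without it the
coordinates of nearby values in the chart at \<open>f m\<close> say nothing about the values.\<close>

definition has_tangent ::
    "('m::topological_space, 'e::real_normed_vector) atlas \<Rightarrow>
     ('n::topological_space, 'f::real_normed_vector) atlas \<Rightarrow> ('m \<Rightarrow> 'n) \<Rightarrow> 'm \<Rightarrow> ('e \<Rightarrow> 'f) \<Rightarrow> bool" where
  "has_tangent A B f m D \<longleftrightarrow> (f \<longlongrightarrow> f m) (nhds m) \<and>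
     ((snd (chart_at B (f m)) \<circ> f \<circ> chart_inv (chart_at A m)) has_derivative D)
       (at (snd (chart_at A m) m))"

lemma tangent_map_eqI: "has_tangent A B f m D \<Longrightarrow> tangent_map A B f m = D"
  unfolding has_tangent_def tangent_map_def by (blast intro: frechet_derivative_eqI)

lemma has_tangent_unique: "has_tangent A B f m D \<Longrightarrow> has_tangent A B f m D' \<Longrightarrow> D = D'"
  using tangent_map_eqI by blast

lemma has_tangent_linear: "has_tangent A B f m D \<Longrightarrow> linear D"
  by (auto simp: has_tangent_def intro: has_derivative_linear)

lemma has_tangent_compose:
  assumes A: "smooth_atlas A" and B: "smooth_atlas B"
    and f: "has_tangent A B f m D" and g: "has_tangent B C g (f m) E"
  shows "has_tangent A C (\<lambda>x. g (f x)) m (\<lambda>v. E (D v))"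
proof -
  define a where "a = chart_at A m"
  define b where "b = chart_at B (f m)"
  define c where "c = chart_at C (g (f m))"
  note cha = is_chart_chart_at[OF A, of m, folded a_def]
    and chb = is_chart_chart_at[OF B, of "f m", folded b_def]
  have am: "m \<in> fst a" and bm: "f m \<in> fst b" using chart_at_mem A B by (auto simp: a_def b_def)
  have tf: "(f \<longlongrightarrow> f m) (nhds m)" and df: "((snd b \<circ> f \<circ> chart_inv a) has_derivative D) (at (snd a m))"
    using f by (auto simp: has_tangent_def a_def b_def)
  have tg: "(g \<longlongrightarrow> g (f m)) (nhds (f m))"
    and dg: "((snd c \<circ> g \<circ> chart_inv b) has_derivative E) (at (snd b (f m)))"
    using g by (auto simp: has_tangent_def b_def c_def)
  have t: "((\<lambda>x. g (f x)) \<longlongrightarrow> g (f m)) (nhds m)"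
    by (rule filterlim_compose[OF tg tf])
  have x: "chart_inv a (snd a m) = m" by (rule chart_inv_left[OF cha am])
  have d: "((\<lambda>y. (snd c \<circ> g \<circ> chart_inv b) ((snd b \<circ> f \<circ> chart_inv a) y)) has_derivative (\<lambda>v. E (D v))) (at (snd a m))"
    by (rule has_derivative_compose[OF df]) (use dg x in \<open>simp add: comp_def\<close>)
  have "(chart_inv a \<longlongrightarrow> m) (nhds (snd a m))"
    using chart_inv_tendsto[OF cha imageI[OF am]] x by simp
  then have "((\<lambda>y. f (chart_inv a y)) \<longlongrightarrow> f m) (nhds (snd a m))"
    by (rule filterlim_compose[OF tf])
  then have "\<forall>\<^sub>F y in nhds (snd a m). f (chart_inv a y) \<in> fst b"
    using chart_open(1)[OF chb] bm topological_tendstoD by blast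
  then obtain T where T: "open T" "snd a m \<in> T" "\<And>y. y \<in> T \<Longrightarrow> f (chart_inv a y) \<in> fst b"
    by (auto simp: eventually_nhds)
  have "((snd c \<circ> (\<lambda>x. g (f x)) \<circ> chart_inv a) has_derivative (\<lambda>v. E (D v))) (at (snd a m))"
    by (rule has_derivative_transform_within_open[OF d T(1,2)])
      (use T(3) chart_inv_left[OF chb] in simp)
  with t show ?thesis by (simp add: has_tangent_def a_def b_def c_def)
qed

lemma has_tangent_cong:
  assumes A: "smooth_atlas A" and S: "open S" "m \<in> S" and eq: "\<And>x. x \<in> S \<Longrightarrow> f x = g x"
    and f: "has_tangent A B f m D"
  shows "has_tangent A B g m D"
proof -
  define a where "a = chart_at A m"
  note cha = is_chart_chart_at[OF A, of m, folded a_def]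
  have am: "m \<in> fst a" using chart_at_mem A by (auto simp: a_def)
  have x: "chart_inv a (snd a m) = m" by (rule chart_inv_left[OF cha am])
  have fg: "f m = g m" using eq S by blast
  have "\<forall>\<^sub>F x in nhds m. f x = g x" using S eq by (auto simp: eventually_nhds)
  then have t: "(g \<longlongrightarrow> g m) (nhds m)"
    using f fg tendsto_cong[of f g "nhds m"] by (simp add: has_tangent_def)
  have T: "open (snd a ` (fst a \<inter> S))" by (rule chart_image_open[OF cha S(1)])
  have "((snd (chart_at B (g m)) \<circ> g \<circ> chart_inv a) has_derivative D) (at (snd a m))"
    by (rule has_derivative_transform_within_open[OF _ T, of "snd (chart_at B (f m)) \<circ> f \<circ> chart_inv a"])
      (use f fg am S eq chart_inv_left[OF cha] in \<open>auto simp: has_tangent_def a_def\<close>)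
  with t show ?thesis by (simp add: has_tangent_def a_def)
qed

lemma smooth_map_has_tangent:
  assumes A: "smooth_atlas A" and B: "smooth_atlas B" and f: "smooth_map A B S f" and m: "m \<in> S"
  shows "has_tangent A B f m (tangent_map A B f m)"
proof -
  define a where "a = chart_at A m"
  define b where "b = chart_at B (f m)"
  have ab: "a \<in> A" "b \<in> B" "m \<in> fst a" "f m \<in> fst b"
    using chart_at_mem A B by (auto simp: a_def b_def)
  have "(f \<longlongrightarrow> f m) (nhds m)"
    using f m by (intro continuous_on_open_tendsto_nhds[of S]) (auto simp: smooth_map_def)
  moreover have "smooth_on (snd a ` (fst a \<inter> S \<inter> f -` fst b)) (snd b \<circ> f \<circ> chart_inv a)"
    using f ab by (simp add: smooth_map_def)
  from smooth_on_has_derivative[OF this, of "snd a m"]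
  have "((snd b \<circ> f \<circ> chart_inv a) has_derivative tangent_map A B f m) (at (snd a m))"
    using ab m by (simp add: tangent_map_def a_def b_def)
  ultimately show ?thesis
    unfolding has_tangent_def a_def b_def by simp
qed

lemma has_tangent_vec:
  "has_tangent vec_atlas vec_atlas f x D \<longleftrightarrow> (f has_derivative D) (at x)"
  using has_derivative_continuous[of f D x UNIV]
  by (auto simp: has_tangent_def chart_at_vec chart_inv_vec tendsto_at_iff_tendsto_nhds continuous_within)

lemma has_tangent_const: "has_tangent A B (\<lambda>_. k) m (\<lambda>_. 0)"
  by (simp add: has_tangent_def o_def)

lemma has_tangent_id:
  assumes A: "smooth_atlas A"
  shows "has_tangent A A (\<lambda>x. x) m (\<lambda>v. v)"
proof -
  define a where "a = chart_at A m"
  note cha = is_chart_chart_at[OF A, of m, folded a_def]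
  have am: "m \<in> fst a" using chart_at_mem A by (auto simp: a_def)
  have "((snd a \<circ> (\<lambda>x. x) \<circ> chart_inv a) has_derivative (\<lambda>v. v)) (at (snd a m))"
    by (rule has_derivative_transform_within_open[OF has_derivative_ident chart_open(2)[OF cha]])
      (use am chart_inv_right[OF cha] in auto)
  then show ?thesis by (simp add: has_tangent_def a_def filterlim_ident)
qed

text \<open>The two compositions of a chart with its inverse are locally identities. So the tangent map of
any chart is an isomorphism, and conditions on tangent vectors at varying points can be compared in
one fixed chart, although \<^const>\<open>chart_at\<close> changes from point to point.\<close>

lemma chart_tangent_inverse:
  assumes A: "smooth_atlas A" and c: "c \<in> A" and m: "m \<in> fst c"
  shows "tangent_map vec_atlas A (chart_inv c) (snd c m) (tangent_map A vec_atlas (snd c) m v) = v"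
    and "tangent_map A vec_atlas (snd c) m (tangent_map vec_atlas A (chart_inv c) (snd c m) u) = u"
proof -
  note ch = smooth_atlas_chart[OF A c]
  let ?K = "tangent_map A vec_atlas (snd c) m"
    and ?L = "tangent_map vec_atlas A (chart_inv c) (snd c m)"
  have K: "has_tangent A vec_atlas (snd c) m ?K"
    by (rule smooth_map_has_tangent[OF A smooth_atlas_vec smooth_map_chart[OF A c] m])
  have L: "has_tangent vec_atlas A (chart_inv c) (snd c m) ?L"
    by (rule smooth_map_has_tangent[OF smooth_atlas_vec A smooth_map_chart_inv[OF A c]]) (use m in simp)
  have inv: "chart_inv c (snd c m) = m" by (rule chart_inv_left[OF ch m])
  have "has_tangent A A (\<lambda>x. chart_inv c (snd c x)) m (\<lambda>v. ?L (?K v))"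
    by (rule has_tangent_compose[OF A smooth_atlas_vec K L])
  then have "has_tangent A A (\<lambda>x. x) m (\<lambda>v. ?L (?K v))"
    by (rule has_tangent_cong[OF A chart_open(1)[OF ch] m, rotated]) (rule chart_inv_left[OF ch])
  from has_tangent_unique[OF this has_tangent_id[OF A]] show "?L (?K v) = v" by metis
  have "has_tangent vec_atlas vec_atlas (\<lambda>x. snd c (chart_inv c x)) (snd c m) (\<lambda>v. ?K (?L v))"
    by (rule has_tangent_compose[OF smooth_atlas_vec A L]) (simp add: inv K)
  then have "has_tangent vec_atlas vec_atlas (\<lambda>x. x) (snd c m) (\<lambda>v. ?K (?L v))"
    by (rule has_tangent_cong[OF smooth_atlas_vec chart_open(2)[OF ch], rotated 2])
      (use m chart_inv_right[OF ch] in auto)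
  from has_tangent_unique[OF this has_tangent_id[OF smooth_atlas_vec]] show "?K (?L u) = u" by metis
qed


section \<open>Integral curves\<close>

text \<open>The partial derivatives are continuous, so near the point they are bounded, and with them the
operator norm of the derivative; the mean value inequality on a ball does the rest.\<close>

lemma smooth_on_locally_lipschitz:
  fixes X :: "'a::finite_dim_normed \<Rightarrow> 'b::real_normed_vector"
  assumes X: "smooth_on R X" and R: "open R" "x0 \<in> R"
  obtains r L where "r > 0" "L \<ge> 0" "cball x0 r \<subseteq> R"
    "\<And>x y. x \<in> cball x0 r \<Longrightarrow> y \<in> cball x0 r \<Longrightarrow> norm (X x - X y) \<le> L * norm (x - y)"
proof -
  define D where "D x = frechet_derivative X (at x)" for x
  have D: "(X has_derivative D x) (at x)" if "x \<in> R" for x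
    unfolding D_def by (rule smooth_on_has_derivative[OF X that])
  have "\<forall>\<^sub>F x in nhds x0. norm (D x b) < norm (D x0 b) + 1" for b
  proof -
    have "continuous_on R (\<lambda>x. D x b)"
      unfolding D_def by (rule smooth_on_imp_continuous_on[OF smooth_on_derivative[OF X]])
    then have "((\<lambda>x. D x b) \<longlongrightarrow> D x0 b) (nhds x0)"
      by (rule continuous_on_open_tendsto_nhds) (use R in auto)
    then have "((\<lambda>x. norm (D x b)) \<longlongrightarrow> norm (D x0 b)) (nhds x0)" by (rule tendsto_norm)
    then show ?thesis by (rule order_tendstoD) simp
  qed
  then have "\<forall>\<^sub>F x in nhds x0. \<forall>b\<in>(std_basis::'a set). norm (D x b) < norm (D x0 b) + 1"
    by (intro eventually_ball_finite finite_std_basis) auto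
  moreover have "\<forall>\<^sub>F x in nhds x0. x \<in> R" using R by (auto simp: eventually_nhds)
  ultimately have "\<forall>\<^sub>F x in nhds x0. x \<in> R \<and> (\<forall>b\<in>(std_basis::'a set). norm (D x b) < norm (D x0 b) + 1)"
    by eventually_elim auto
  then obtain e where e: "e > 0"
      "\<And>x. dist x x0 < e \<Longrightarrow> x \<in> R \<and> (\<forall>b\<in>(std_basis::'a set). norm (D x b) < norm (D x0 b) + 1)"
    by (auto simp: eventually_nhds_metric)
  define L where "L = (\<Sum>b\<in>(std_basis::'a set). onorm (coord b) * (norm (D x0 b) + 1))"
  have pos: "onorm (coord b) * (norm (D x0 b) + 1) \<ge> 0" if "b \<in> std_basis" for b :: 'a
    by (intro mult_nonneg_nonneg onorm_pos_le[OF bounded_linear_coord[OF that]]) simp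
  have L: "L \<ge> 0" unfolding L_def by (intro sum_nonneg pos)
  have in_R: "x \<in> R" "\<And>b. b \<in> std_basis \<Longrightarrow> norm (D x b) \<le> norm (D x0 b) + 1"
    if "x \<in> cball x0 (e/2)" for x
    using e(2)[of x] that e(1) by (auto simp: dist_commute less_imp_le)
  have on: "onorm (D x) \<le> L" if x: "x \<in> cball x0 (e/2)" for x
  proof (rule onorm_bound[OF L])
    fix v
    have "norm (D x v) = norm (\<Sum>b\<in>std_basis. coord b v *\<^sub>R D x b)"
      using linear_sum_coord[OF has_derivative_linear[OF D[OF in_R(1)[OF x]]], of v] by simp
    also have "\<dots> \<le> (\<Sum>b\<in>std_basis. onorm (coord b) * (norm (D x0 b) + 1) * norm v)"
    proof (rule sum_norm_le)
      fix b :: 'a assume b: "b \<in> std_basis"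
      have "\<bar>coord b v\<bar> \<le> onorm (coord b) * norm v"
        using onorm[OF bounded_linear_coord[OF b]] by simp
      then have "\<bar>coord b v\<bar> * norm (D x b) \<le> (onorm (coord b) * norm v) * (norm (D x0 b) + 1)"
        using in_R(2)[OF x b]
        by (intro mult_mono) (auto intro!: mult_nonneg_nonneg onorm_pos_le[OF bounded_linear_coord[OF b]])
      then show "norm (coord b v *\<^sub>R D x b) \<le> onorm (coord b) * (norm (D x0 b) + 1) * norm v"
        by (simp add: mult_ac)
    qed
    finally show "norm (D x v) \<le> L * norm v" by (simp add: L_def sum_distrib_right)
  qed
  have "norm (X x - X y) \<le> L * norm (x - y)" if "x \<in> cball x0 (e/2)" "y \<in> cball x0 (e/2)" for x y
    by (rule differentiable_bound[OF convex_cball _ on that])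
      (use D in_R(1) has_derivative_at_withinI in blast)+
  moreover have "cball x0 (e/2) \<subseteq> R" using in_R by blast
  ultimately show thesis using that[of "e/2" L] e(1) L by auto
qed

lemma vector_derivative_bound:
  fixes f :: "real \<Rightarrow> 'a::real_normed_vector"
  assumes "convex S" "\<And>t. t \<in> S \<Longrightarrow> (f has_vector_derivative f' t) (at t within S)"
    and "\<And>t. t \<in> S \<Longrightarrow> norm (f' t) \<le> M" and "s \<in> S" "t \<in> S"
  shows "norm (f t - f s) \<le> M * \<bar>t - s\<bar>"
proof -
  have on: "onorm (\<lambda>h. h *\<^sub>R f' t) \<le> M" if "t \<in> S" for t
    by (rule onorm_le) (use mult_right_mono[OF assms(3)[OF that] abs_ge_zero] in \<open>simp add: mult.commute\<close>)
  have "(f has_derivative (\<lambda>h. h *\<^sub>R f' u)) (at u within S)" if "u \<in> S" for u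
    using assms(2)[OF that] by (simp add: has_vector_derivative_def)
  from differentiable_bound[OF assms(1) this on assms(5,4)] show ?thesis by simp
qed

text \<open>Integral curves are the fixed points of \<open>f \<mapsto> x0 + \<integral>\<^sub>0\<^sup>t X (f s) ds\<close>, which is a contraction on curves in the
ball if the time interval is short. The curves are continued constantly beyond the interval, so that
they are bounded continuous functions on the whole line.\<close>

lemma picard:
  fixes X :: "'b::banach \<Rightarrow> 'b"
  assumes r: "r > 0" and L: "L \<ge> 0"
    and lip: "\<And>x y. x \<in> cball x0 r \<Longrightarrow> y \<in> cball x0 r \<Longrightarrow> norm (X x - X y) \<le> L * norm (x - y)"
  obtains \<epsilon> x where "\<epsilon> > 0" "L * \<epsilon> \<le> 1 / 2" "x 0 = x0" "\<And>t. x t \<in> cball x0 r"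
    "\<And>t. \<bar>t\<bar> < \<epsilon> \<Longrightarrow> (x has_vector_derivative X (x t)) (at t)"
proof -
  define M where "M = norm (X x0) + L * r"
  have M: "norm (X x) \<le> M" if "x \<in> cball x0 r" for x
  proof -
    have "norm (X x) \<le> norm (X x0) + norm (X x - X x0)"
      using norm_triangle_ineq[of "X x0" "X x - X x0"] by simp
    also have "norm (X x - X x0) \<le> L * norm (x - x0)" using lip that r by simp
    also have "\<dots> \<le> L * r" using that L by (intro mult_left_mono) (auto simp: dist_norm norm_minus_commute)
    finally show ?thesis by (simp add: M_def)
  qed
  have M0: "M \<ge> 0" using L r by (simp add: M_def)
  \<comment> \<open>The first bound keeps the curves in the ball; the second makes the contraction factor \<open>1 / 2\<close>.\<close>
  define \<epsilon> where "\<epsilon> = min (r / (M + 1)) (1 / (2 * (L + 1)))"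
  have \<epsilon>: "\<epsilon> > 0" using r M0 L by (simp add: \<epsilon>_def)
  have "\<epsilon> * (M + 1) \<le> r / (M + 1) * (M + 1)"
    using M0 by (intro mult_right_mono) (auto simp: \<epsilon>_def)
  then have "\<epsilon> * (M + 1) \<le> r" using M0 by simp
  then have M\<epsilon>: "M * \<epsilon> \<le> r" using \<epsilon> by (simp add: algebra_simps)
  have "\<epsilon> * (L + 1) \<le> 1 / (2 * (L + 1)) * (L + 1)"
    using L by (intro mult_right_mono) (auto simp: \<epsilon>_def)
  also have "1 / (2 * (L + 1)) * (L + 1) = 1 / 2" using L by (simp add: field_simps)
  finally have "\<epsilon> * (L + 1) \<le> 1 / 2" .
  then have L\<epsilon>: "L * \<epsilon> \<le> 1 / 2" using \<epsilon> by (simp add: algebra_simps)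
  define J where "J = {-\<epsilon>..\<epsilon>}"
  have J: "convex J" "0 \<in> J" using \<epsilon> by (auto simp: J_def)
  have Jabs: "\<bar>t\<bar> \<le> \<epsilon>" if "t \<in> J" for t using that by (auto simp: J_def)
  define cl where "cl t = max (-\<epsilon>) (min \<epsilon> t)" for t
  have cl: "cl t \<in> J" "t \<in> J \<Longrightarrow> cl t = t" for t using \<epsilon> by (auto simp: cl_def J_def)
  have cl_cont: "continuous_on UNIV cl" unfolding cl_def by (intro continuous_intros)
  define S where "S = PiC (UNIV :: real set) (\<lambda>_. cball x0 r)"
  have S: "f \<in> S \<longleftrightarrow> (\<forall>t. apply_bcontfun f t \<in> cball x0 r)" for f
    by (auto simp: S_def mem_PiC_iff Pi_def)
  have cS: "complete S" unfolding S_def by (intro closed_PiC[THEN complete_eq_closed[THEN iffD2]]) simp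
  have Xc: "continuous_on (cball x0 r) X"
    by (rule lipschitz_on_continuous_on[of L], rule lipschitz_onI)
      (use lip L in \<open>auto simp: dist_norm\<close>)
  \<comment> \<open>The oriented integral from \<open>0\<close> to \<open>t\<close>, for both signs of \<open>t\<close>.\<close>
  define I where "I f t = integral {-\<epsilon>..t} (\<lambda>s. X (apply_bcontfun f s)) - integral {-\<epsilon>..0} (\<lambda>s. X (apply_bcontfun f s))" for f t
  have I': "(I f has_vector_derivative X (apply_bcontfun f t)) (at t within J)" if "f \<in> S" "t \<in> J" for f t
  proof -
    have "continuous_on J (\<lambda>s. X (apply_bcontfun f s))"
      by (rule continuous_on_compose2[OF Xc continuous_on_apply_bcontfun]) (use S that in auto)
    then have "((\<lambda>u. integral {-\<epsilon>..u} (\<lambda>s. X (apply_bcontfun f s))) has_vector_derivative X (apply_bcontfun f t)) (at t within {-\<epsilon>..\<epsilon>})"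
      by (intro integral_has_vector_derivative) (use that in \<open>auto simp: J_def\<close>)
    then show ?thesis unfolding I_def J_def
      by (auto intro!: derivative_eq_intros)
  qed
  have I0: "I f 0 = 0" for f by (simp add: I_def)
  have I_bound: "norm (I f t) \<le> r" if "f \<in> S" "t \<in> J" for f t
  proof -
    have "norm (I f t - I f 0) \<le> M * \<bar>t - 0\<bar>"
      by (rule vector_derivative_bound[OF J(1) I'[OF that(1)] _ J(2) that(2)]) (use M S that in auto)
    also have "\<dots> \<le> M * \<epsilon>" using Jabs[OF that(2)] M0 by (simp add: mult_left_mono)
    finally show ?thesis using M\<epsilon> by (simp add: I0)
  qed
  have I_cont: "continuous_on J (I f)" if "f \<in> S" for f
    unfolding continuous_on_eq_continuous_within
    by (intro ballI has_vector_derivative_continuous[OF I'[OF that]])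
  have I_lip: "norm (I f t - I g t) \<le> 1 / 2 * dist f g" if "f \<in> S" "g \<in> S" "t \<in> J" for f g t
  proof -
    have d: "((\<lambda>t. I f t - I g t) has_vector_derivative X (apply_bcontfun f t) - X (apply_bcontfun g t)) (at t within J)"
      if "t \<in> J" for t
      by (intro has_vector_derivative_diff I' that \<open>f \<in> S\<close> \<open>g \<in> S\<close>)
    have "norm (X (apply_bcontfun f t) - X (apply_bcontfun g t)) \<le> L * dist f g" if "t \<in> J" for t
    proof -
      have "norm (X (apply_bcontfun f t) - X (apply_bcontfun g t)) \<le> L * norm (apply_bcontfun f t - apply_bcontfun g t)"
        by (rule lip) (use \<open>f \<in> S\<close> \<open>g \<in> S\<close> S in auto)
      also have "\<dots> \<le> L * dist f g"
        using dist_bounded[of f t g] L by (intro mult_left_mono) (auto simp: dist_norm)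
      finally show ?thesis .
    qed
    from vector_derivative_bound[OF J(1) d this J(2) that(3)]
    have "norm (I f t - I g t) \<le> L * dist f g * \<bar>t\<bar>" by (simp add: I0)
    also have "\<dots> \<le> L * dist f g * \<epsilon>" using Jabs[OF that(3)] L by (simp add: mult_left_mono)
    also have "\<dots> = (L * \<epsilon>) * dist f g" by simp
    also have "\<dots> \<le> 1 / 2 * dist f g" using L\<epsilon> by (intro mult_right_mono) auto
    finally show ?thesis .
  qed
  define P where "P f = Bcontfun (\<lambda>t. x0 + I f (cl t))" for f
  have P: "apply_bcontfun (P f) t = x0 + I f (cl t)" if "f \<in> S" for f t
  proof -
    have "(\<lambda>t. x0 + I f (cl t)) \<in> bcontfun"
    proof (rule bcontfun_normI)
      show "continuous_on UNIV (\<lambda>t. x0 + I f (cl t))"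
        by (intro continuous_on_add continuous_on_const
            continuous_on_compose2[OF I_cont[OF that] cl_cont]) (use cl in auto)
      show "norm (x0 + I f (cl t)) \<le> norm x0 + r" for t
        using norm_triangle_ineq[of x0 "I f (cl t)"] I_bound[OF that cl(1)[of t]] by simp
    qed
    then show ?thesis by (simp add: P_def Bcontfun_inverse)
  qed
  have "\<exists>!f\<in>S. P f = f"
  proof (rule Banach_fix[OF cS])
    have "const_bcontfun x0 \<in> S" using r by (simp add: S const_bcontfun.rep_eq)
    then show "S \<noteq> {}" by blast
    show "P ` S \<subseteq> S" using I_bound cl by (auto simp: S P dist_norm)
    show "dist (P f) (P g) \<le> 1 / 2 * dist f g" if "f \<in> S" "g \<in> S" for f g
      by (rule dist_bound) (use I_lip that cl in \<open>auto simp: P dist_norm\<close>)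
  qed auto
  then obtain f where f: "f \<in> S" "P f = f" by blast
  have fx: "apply_bcontfun f t = x0 + I f (cl t)" for t using P[OF f(1), of t] f(2) by simp
  have "(apply_bcontfun f has_vector_derivative X (apply_bcontfun f t)) (at t)" if t: "\<bar>t\<bar> < \<epsilon>" for t
  proof -
    have tJ: "t \<in> J" "t \<in> interior J" using t by (auto simp: J_def interior_atLeastAtMost_real)
    have "((\<lambda>t. x0 + I f t) has_vector_derivative X (apply_bcontfun f t)) (at t within J)"
      using I'[OF f(1) tJ(1)] by (auto intro!: derivative_eq_intros)
    then have "((\<lambda>t. x0 + I f t) has_vector_derivative X (apply_bcontfun f t)) (at t)"
      by (simp add: at_within_interior[OF tJ(2)])
    then show ?thesis
      by (rule has_vector_derivative_transform_within_open[of _ _ _ "{-\<epsilon><..<\<epsilon>}"])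
        (use t cl(2) fx in \<open>auto simp: J_def\<close>)
  qed
  moreover have "apply_bcontfun f 0 = x0" using fx[of 0] cl(2)[OF J(2)] I0 by simp
  ultimately show thesis
    using that[of \<epsilon> "apply_bcontfun f"] \<epsilon> L\<epsilon> f(1) S by auto
qed

text \<open>If the distance of the curves has the maximum \<open>M\<close> on a closed subinterval, then their velocities differ by at most \<open>L * M\<close>, so the distance is at most \<open>L * \<epsilon> * M \<le> M / 2\<close>.\<close>

lemma integral_curve_unique:
  fixes X :: "'b::real_normed_vector \<Rightarrow> 'b"
  assumes L: "L \<ge> 0" "L * \<epsilon> \<le> 1 / 2"
    and lip: "\<And>x y. x \<in> B \<Longrightarrow> y \<in> B \<Longrightarrow> norm (X x - X y) \<le> L * norm (x - y)"
    and f: "\<And>t. \<bar>t\<bar> < \<epsilon> \<Longrightarrow> (f has_vector_derivative X (f t)) (at t)" "\<And>t. \<bar>t\<bar> < \<epsilon> \<Longrightarrow> f t \<in> B"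
    and g: "\<And>t. \<bar>t\<bar> < \<epsilon> \<Longrightarrow> (g has_vector_derivative X (g t)) (at t)" "\<And>t. \<bar>t\<bar> < \<epsilon> \<Longrightarrow> g t \<in> B"
    and eq: "f 0 = g 0" and t: "\<bar>t\<bar> < \<epsilon>"
  shows "f t = g t"
proof -
  define J where "J = {-\<bar>t\<bar>..\<bar>t\<bar>}"
  have J: "convex J" "0 \<in> J" "t \<in> J" "compact J" "\<And>s. s \<in> J \<Longrightarrow> \<bar>s\<bar> < \<epsilon>"
    using t by (auto simp: J_def)
  have d: "((\<lambda>t. f t - g t) has_vector_derivative X (f s) - X (g s)) (at s within J)" if "s \<in> J" for s
    by (rule has_vector_derivative_diff;
        rule has_vector_derivative_at_within, rule f(1) g(1), rule J(5)[OF that])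
  have "continuous_on J (\<lambda>t. norm (f t - g t))"
    by (intro continuous_on_norm, unfold continuous_on_eq_continuous_within)
      (intro ballI has_vector_derivative_continuous[OF d])
  then obtain s where s: "s \<in> J" "\<And>u. u \<in> J \<Longrightarrow> norm (f u - g u) \<le> norm (f s - g s)"
    using continuous_attains_sup[OF J(4)] J(2) by blast
  let ?M = "norm (f s - g s)"
  have "norm (X (f u) - X (g u)) \<le> L * ?M" if "u \<in> J" for u
  proof -
    have "norm (X (f u) - X (g u)) \<le> L * norm (f u - g u)"
      using lip f(2) g(2) J(5)[OF that] by blast
    also have "\<dots> \<le> L * ?M" using s(2)[OF that] L(1) by (rule mult_left_mono)
    finally show ?thesis .
  qed
  from vector_derivative_bound[OF J(1) d this J(2) s(1)]
  have "?M \<le> L * ?M * \<bar>s\<bar>" by (simp add: eq)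
  also have "\<dots> \<le> L * ?M * \<epsilon>" using J(5)[OF s(1)] L(1) by (intro mult_left_mono) auto
  also have "\<dots> = (L * \<epsilon>) * ?M" by simp
  also have "\<dots> \<le> 1 / 2 * ?M" using L(2) by (rule mult_right_mono) simp
  finally have "?M = 0" by simp
  then show ?thesis using s(2)[OF J(3)] by simp
qed

text \<open>Bootstrapping: if the curve is of class $C^k$, then so is its velocity, which is the value of the
smooth vector field along the curve.\<close>

lemma integral_curve_smooth:
  fixes X :: "'b::finite_dim_normed \<Rightarrow> 'b"
  assumes X: "smooth_on R X" "open R" and S: "open S"
    and x: "\<And>t. t \<in> S \<Longrightarrow> (x has_vector_derivative X (x t)) (at t)" "\<And>t. t \<in> S \<Longrightarrow> x t \<in> R"
  shows "smooth_on S x"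
  unfolding smooth_on_def
proof
  fix k show "ck_on k S x"
  proof (induction k)
    case 0
    then show ?case
      using x(1) by (auto intro!: continuous_at_imp_continuous_on has_vector_derivative_continuous)
  next
    case (Suc k)
    show ?case
    proof (rule ck_on_SucI[where D="\<lambda>t v. v *\<^sub>R X (x t)", OF _ S])
      show "(x has_derivative (\<lambda>v. v *\<^sub>R X (x t))) (at t)" if "t \<in> S" for t
        using x(1)[OF that] by (simp add: has_vector_derivative_def)
      show "ck_on k S (\<lambda>t. v *\<^sub>R X (x t))" for v
        by (rule ck_on_linear_compose[OF bounded_linear_scaleR_right S],
            rule ck_on_compose[OF S X(2) _ Suc.IH])
          (use x(2) X(1) in \<open>auto simp: smooth_on_def\<close>)
    qed
  qed
qed

text \<open>Here \<open>F\<close> is a multiplication defined near the unit \<open>x0\<close>, and the curve is the integral curve through \<open>x0\<close> of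
the left-invariant vector field \<open>X a = D\<^sub>2 F (a, x0) \<zeta>\<close>. Associativity says that left translations
preserve \<open>X\<close>; so \<open>t \<mapsto> F (x s, x t)\<close> and \<open>t \<mapsto> x (s + t)\<close> are integral curves through \<open>x s\<close> and agree.\<close>

lemma local_one_parameter_subgroup:
  fixes F :: "'g::finite_dim_normed \<times> 'g \<Rightarrow> 'g"
  assumes D: "open D" and F: "smooth_on D F" and R: "open R" "x0 \<in> R"
    and unit_r: "\<And>a. a \<in> R \<Longrightarrow> (a, x0) \<in> D" "\<And>a. a \<in> R \<Longrightarrow> F (a, x0) = a"
    and unit_l: "\<And>a. a \<in> R \<Longrightarrow> F (x0, a) = a"
    and DR: "\<And>a b. (a, b) \<in> D \<Longrightarrow> b \<in> R" "\<And>a b. (a, b) \<in> D \<Longrightarrow> F (a, b) \<in> R"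
    and assoc: "\<And>a b z. (a, b) \<in> D \<Longrightarrow> (b, z) \<in> D \<Longrightarrow> (F (a, b), z) \<in> D \<Longrightarrow> (a, F (b, z)) \<in> D \<Longrightarrow>
      F (a, F (b, z)) = F (F (a, b), z)"
  obtains \<epsilon> x where "\<epsilon> > 0" "x 0 = x0" "\<And>t. \<bar>t\<bar> < \<epsilon> \<Longrightarrow> x t \<in> R" "smooth_on {-\<epsilon><..<\<epsilon>} x"
    "(x has_vector_derivative \<zeta>) (at 0)"
    "\<And>s t. \<bar>s\<bar> < \<epsilon> \<Longrightarrow> \<bar>t\<bar> < \<epsilon> \<Longrightarrow> (x s, x t) \<in> D"
    "\<And>s t. \<bar>s\<bar> < \<epsilon> \<Longrightarrow> \<bar>t\<bar> < \<epsilon> \<Longrightarrow> F (x s, x t) = x (s + t)"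
proof -
  define D2 where "D2 a b v = frechet_derivative F (at (a, b)) (0, v)" for a b v
  have D2: "((\<lambda>z. F (a, z)) has_derivative D2 a b) (at b)" if "(a, b) \<in> D" for a b
  proof -
    have "((\<lambda>z. (a, z)) has_derivative (\<lambda>v. (0, v))) (at b)"
      by (auto intro!: derivative_eq_intros)
    from has_derivative_compose[OF this smooth_on_has_derivative[OF F that]]
    show ?thesis by (simp add: D2_def[abs_def])
  qed
  define X where "X a = D2 a x0 \<zeta>" for a
  have X: "smooth_on R X"
  proof -
    have "smooth_on ((\<lambda>a. (a, 0) + (0, x0)) -` D) (\<lambda>a. frechet_derivative F (at ((a, 0) + (0, x0))) (0, \<zeta>))"
      by (rule smooth_on_compose_affine[OF smooth_on_derivative[OF F] _ D])
        (intro bounded_linear_Pair bounded_linear_zero bounded_linear_ident)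
    then have "smooth_on R (\<lambda>a. frechet_derivative F (at ((a, 0) + (0, x0))) (0, \<zeta>))"
      by (rule smooth_on_subset) (use unit_r in auto)
    then show ?thesis by (simp add: X_def[abs_def] D2_def)
  qed
  have D0: "(x0, x0) \<in> D" using unit_r R by blast
  have X0: "X x0 = \<zeta>"
  proof -
    have "((\<lambda>z. F (x0, z)) has_derivative (\<lambda>v. v)) (at x0)"
      by (rule has_derivative_transform_within_open[OF has_derivative_ident R])
        (simp add: unit_l)
    from has_derivative_unique[OF this D2[OF D0]] show ?thesis by (simp add: X_def fun_eq_iff)
  qed
  \<comment> \<open>Left invariance: differentiate \<open>F (a, F (b, z)) = F (F (a, b), z)\<close> in \<open>z\<close> at \<open>x0\<close>.\<close>
  have key: "D2 a b (X b) = X (F (a, b))" if ab: "(a, b) \<in> D" for a b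
  proof -
    have b: "b \<in> R" "F (a, b) \<in> R" using DR ab by auto
    have ob: "open {z. (c, z) \<in> D}" for c
      using open_vimage[OF D, of "\<lambda>z. (c, z)"] by (simp add: vimage_def continuous_on_Pair)
    have "continuous_on {z. (b, z) \<in> D} (\<lambda>z. (a, F (b, z)))"
      by (intro continuous_on_Pair continuous_on_const
          continuous_on_compose2[OF smooth_on_imp_continuous_on[OF F]] continuous_on_id) auto
    from continuous_open_preimage[OF this ob D]
    have oT: "open ({z. (b, z) \<in> D} \<inter> (\<lambda>z. (a, F (b, z))) -` D \<inter> {z. (F (a, b), z) \<in> D})" (is "open ?T")
      using ob by (rule open_Int)
    have x0T: "x0 \<in> ?T" using unit_r b ab by simp
    have "((\<lambda>z. F (a, F (b, z))) has_derivative (\<lambda>v. D2 a b (D2 b x0 v))) (at x0)"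
      by (rule has_derivative_compose[OF D2[OF unit_r(1)[OF b(1)]]])
        (use D2[OF ab] unit_r(2)[OF b(1)] in simp)
    then have "((\<lambda>z. F (F (a, b), z)) has_derivative (\<lambda>v. D2 a b (D2 b x0 v))) (at x0)"
      by (rule has_derivative_transform_within_open[OF _ oT x0T]) (use assoc ab in auto)
    from has_derivative_unique[OF this D2[OF unit_r(1)[OF b(2)]]]
    show ?thesis by (simp add: X_def fun_eq_iff)
  qed
  obtain r L where rL: "r > 0" "L \<ge> 0" "cball x0 r \<subseteq> R"
      "\<And>x y. x \<in> cball x0 r \<Longrightarrow> y \<in> cball x0 r \<Longrightarrow> norm (X x - X y) \<le> L * norm (x - y)"
    using smooth_on_locally_lipschitz[OF X R] by metis
  obtain \<epsilon> x where x: "\<epsilon> > 0" "L * \<epsilon> \<le> 1 / 2" "x 0 = x0" "\<And>t. x t \<in> cball x0 r"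
      "\<And>t. \<bar>t\<bar> < \<epsilon> \<Longrightarrow> (x has_vector_derivative X (x t)) (at t)"
    using picard[OF rL(1,2,4)] by metis
  have xR: "x t \<in> R" for t using x(4) rL(3) by blast
  have "open (D \<inter> F -` ball x0 r)"
    by (rule continuous_open_preimage[OF smooth_on_imp_continuous_on[OF F] D open_ball])
  moreover have "(x0, x0) \<in> D \<inter> F -` ball x0 r" using D0 unit_l[OF R(2)] rL(1) by simp
  ultimately obtain A B where AB: "open A" "open B" "x0 \<in> A" "x0 \<in> B" "A \<times> B \<subseteq> D \<inter> F -` ball x0 r"
    by (auto elim!: open_prod_elim)
  have "isCont x 0" using x(5)[of 0] x(1) has_vector_derivative_continuous by simp
  then have "(x \<longlongrightarrow> x 0) (nhds 0)" by (simp add: isCont_def tendsto_at_iff_tendsto_nhds)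
  then have "\<forall>\<^sub>F t in nhds 0. x t \<in> A \<inter> B"
    by (rule topological_tendstoD) (use AB x(3) in auto)
  then obtain \<delta>0 where \<delta>0: "\<delta>0 > 0" "\<And>t. \<bar>t\<bar> < \<delta>0 \<Longrightarrow> x t \<in> A \<inter> B"
    by (auto simp: eventually_nhds_metric dist_real_def)
  define \<delta> where "\<delta> = min \<delta>0 (\<epsilon> / 2)"
  have \<delta>: "\<delta> > 0" "\<delta> \<le> \<delta>0" "2 * \<delta> \<le> \<epsilon>" using \<delta>0 x(1) by (auto simp: \<delta>_def)
  have inD: "(x s, x t) \<in> D" "F (x s, x t) \<in> cball x0 r" if "\<bar>s\<bar> < \<delta>" "\<bar>t\<bar> < \<delta>" for s t
  proof -
    have "x s \<in> A" "x t \<in> B" using \<delta>0(2)[of s] \<delta>0(2)[of t] \<delta> that by auto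
    then have "(x s, x t) \<in> D \<inter> F -` ball x0 r" using AB(5) by blast
    then show "(x s, x t) \<in> D" "F (x s, x t) \<in> cball x0 r" by auto
  qed
  have hom: "F (x s, x t) = x (s + t)" if s: "\<bar>s\<bar> < \<delta>" and t: "\<bar>t\<bar> < \<delta>" for s t
  proof (rule integral_curve_unique[OF rL(2) _ rL(4), where f="\<lambda>t. F (x s, x t)" and g="\<lambda>t. x (s + t)" and \<epsilon>=\<delta>])
    show "L * \<delta> \<le> 1 / 2"
      using mult_left_mono[of \<delta> \<epsilon> L] \<delta> rL(2) x(2) by simp
    show "((\<lambda>t. F (x s, x t)) has_vector_derivative X (F (x s, x u))) (at u)" if u: "\<bar>u\<bar> < \<delta>" for u
    proof -
      have "(x has_derivative (\<lambda>h. h *\<^sub>R X (x u))) (at u)"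
        using x(5)[of u] u \<delta> by (simp add: has_vector_derivative_def)
      from has_derivative_compose[OF this D2[OF inD(1)[OF s u]]]
      have "((\<lambda>t. F (x s, x t)) has_derivative (\<lambda>h. D2 (x s) (x u) (h *\<^sub>R X (x u)))) (at u)" .
      moreover have "D2 (x s) (x u) (h *\<^sub>R X (x u)) = h *\<^sub>R X (F (x s, x u))" for h
        using linear_scale[OF has_derivative_linear[OF D2[OF inD(1)[OF s u]]]] key[OF inD(1)[OF s u]] by simp
      ultimately show ?thesis by (simp add: has_vector_derivative_def)
    qed
    show "F (x s, x u) \<in> cball x0 r" if "\<bar>u\<bar> < \<delta>" for u using inD s that by blast
    show "((\<lambda>t. x (s + t)) has_vector_derivative X (x (s + u))) (at u)" if u: "\<bar>u\<bar> < \<delta>" for u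
    proof -
      have "(x has_derivative (\<lambda>h. h *\<^sub>R X (x (s + u)))) (at (s + u))"
        using x(5)[of "s + u"] s u \<delta> by (simp add: has_vector_derivative_def)
      moreover have "((\<lambda>t. s + t) has_derivative (\<lambda>h. h)) (at u)" by (auto intro!: derivative_eq_intros)
      ultimately show ?thesis
        using has_derivative_compose[of "\<lambda>t. s + t" "\<lambda>h. h" u UNIV x] by (simp add: has_vector_derivative_def)
    qed
    show "x (s + u) \<in> cball x0 r" for u using x(4) .
    show "F (x s, x 0) = x (s + 0)" using unit_r(2)[OF xR[of s]] x(3) by simp
  qed (use t in auto)
  have "smooth_on {-\<delta><..<\<delta>} x"
    by (rule integral_curve_smooth[OF X R(1)]) (use x(5) \<delta> xR in auto)
  then show thesis
    using that[of \<delta> x] \<delta> x(3) xR inD hom x(5)[of 0] x(1) X0 by simp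
qed


section \<open>One-parameter subgroups\<close>

text \<open>Set \<open>C t = \<gamma> (t / n) ^ n\<close> for any \<open>n\<close> with \<open>\<bar>t\<bar> / n < \<epsilon>\<close>. Two choices of \<open>n\<close> give the same value by
comparison with their product. The homomorphism property holds because \<open>\<gamma> (s / n)\<close> and
\<open>\<gamma> (t / n)\<close> commute.\<close>

lemma local_hom_extends:
  fixes G :: "'a monoid" and \<gamma> :: "real \<Rightarrow> 'a"
  assumes G: "group G" "carrier G = UNIV" and \<epsilon>: "\<epsilon> > 0"
    and hom: "\<And>s t. \<bar>s\<bar> < \<epsilon> \<Longrightarrow> \<bar>t\<bar> < \<epsilon> \<Longrightarrow> \<gamma> s \<otimes>\<^bsub>G\<^esub> \<gamma> t = \<gamma> (s + t)"
  obtains C where "\<And>s t. C (s + t) = C s \<otimes>\<^bsub>G\<^esub> C t" "\<And>t. \<bar>t\<bar> < \<epsilon> \<Longrightarrow> C t = \<gamma> t"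
proof -
  interpret group G by (rule G(1))
  have mem [simp]: "g \<in> carrier G" for g using G(2) by simp
  have "\<gamma> 0 \<otimes>\<^bsub>G\<^esub> \<gamma> 0 = \<gamma> 0" using hom[of 0 0] \<epsilon> by simp
  then have \<gamma>0: "\<gamma> 0 = \<one>\<^bsub>G\<^esub>" by (metis mem r_cancel_one)
  have pow: "\<gamma> u [^]\<^bsub>G\<^esub> k = \<gamma> (real k * u)" if "\<bar>real k * u\<bar> < \<epsilon>" for k :: nat and u
    using that
  proof (induction k)
    case 0
    then show ?case by (simp add: \<gamma>0)
  next
    case (Suc k)
    have *: "\<bar>real k * u\<bar> \<le> \<bar>real (Suc k) * u\<bar>" "\<bar>u\<bar> \<le> \<bar>real (Suc k) * u\<bar>"
      by (auto simp: abs_mult intro!: mult_right_mono mult_left_le_one_le)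
         (simp add: mult_le_cancel_right1)
    with Suc have "\<gamma> u [^]\<^bsub>G\<^esub> k = \<gamma> (real k * u)" by linarith
    then have "\<gamma> u [^]\<^bsub>G\<^esub> Suc k = \<gamma> (real k * u) \<otimes>\<^bsub>G\<^esub> \<gamma> u" by simp
    also have "\<dots> = \<gamma> (real k * u + u)" using * Suc.prems by (intro hom) linarith+
    finally show ?case by (simp add: algebra_simps)
  qed
  define P where "P n t = \<gamma> (t / real n) [^]\<^bsub>G\<^esub> n" for n :: nat and t
  have small: "\<bar>t / real n\<bar> < \<epsilon>" if "n \<ge> 1" "\<bar>t\<bar> < real n * \<epsilon>" for n t
    using that by (simp add: field_simps)
  have refine: "P (m * n) t = P n t" if "m \<ge> 1" "n \<ge> 1" "\<bar>t\<bar> < real n * \<epsilon>" for m n t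
  proof -
    have e: "real m * (t / real (m * n)) = t / real n" using that by simp
    have "\<gamma> (t / real n) = \<gamma> (t / real (m * n)) [^]\<^bsub>G\<^esub> m"
      using pow[of m "t / real (m * n)"] small[OF that(2,3)] unfolding e by simp
    then show ?thesis by (simp add: P_def nat_pow_pow)
  qed
  have indep: "P n t = P m t"
    if "m \<ge> 1" "n \<ge> 1" "\<bar>t\<bar> < real n * \<epsilon>" "\<bar>t\<bar> < real m * \<epsilon>" for m n t
    using refine[of m n t] refine[of n m t] that by (simp add: mult.commute)
  have ex: "\<exists>n::nat. n \<ge> 1 \<and> r < real n * \<epsilon>" for r
  proof -
    obtain n :: nat where "r / \<epsilon> < real n" using reals_Archimedean2 by blast
    then have "r < real n * \<epsilon>" using \<epsilon> by (simp add: field_simps)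
    also have "\<dots> \<le> real (Suc n) * \<epsilon>" using \<epsilon> by (intro mult_right_mono) auto
    finally show ?thesis by (intro exI[of _ "Suc n"]) simp
  qed
  define N where "N t = (SOME n::nat. n \<ge> 1 \<and> \<bar>t\<bar> < real n * \<epsilon>)" for t
  have N: "N t \<ge> 1" "\<bar>t\<bar> < real (N t) * \<epsilon>" for t
    using someI_ex[OF ex[of "\<bar>t\<bar>"]] by (auto simp: N_def)
  define C where "C t = P (N t) t" for t
  have C: "C t = P n t" if "n \<ge> 1" "\<bar>t\<bar> < real n * \<epsilon>" for n t
    unfolding C_def using indep[of n "N t" t] N that by blast
  have "C (s + t) = C s \<otimes>\<^bsub>G\<^esub> C t" for s t
  proof -
    obtain n :: nat where n: "n \<ge> 1" "\<bar>s\<bar> + \<bar>t\<bar> < real n * \<epsilon>" using ex by blast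
    then have st: "\<bar>s\<bar> < real n * \<epsilon>" "\<bar>t\<bar> < real n * \<epsilon>" "\<bar>s + t\<bar> < real n * \<epsilon>" by linarith+
    note sm = small[OF n(1) st(1)] small[OF n(1) st(2)]
    have comm: "\<gamma> (s / n) \<otimes>\<^bsub>G\<^esub> \<gamma> (t / n) = \<gamma> (t / n) \<otimes>\<^bsub>G\<^esub> \<gamma> (s / n)"
      using hom[OF sm] hom[OF sm(2,1)] by (simp add: add.commute)
    have "P n (s + t) = (\<gamma> (s / n) \<otimes>\<^bsub>G\<^esub> \<gamma> (t / n)) [^]\<^bsub>G\<^esub> n"
      unfolding P_def hom[OF sm] by (simp add: add_divide_distrib)
    also have "\<dots> = P n s \<otimes>\<^bsub>G\<^esub> P n t"
      unfolding P_def by (rule pow_mult_distrib[OF comm]) simp_all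
    finally show ?thesis using C n(1) st by simp
  qed
  moreover have "C t = \<gamma> t" if "\<bar>t\<bar> < \<epsilon>" for t
    using C[of 1 t] that by (simp add: P_def)
  ultimately show thesis using that by blast
qed

lemma lie_group_atlas: "lie_group G AG \<Longrightarrow> smooth_atlas AG"
  by (simp add: lie_group_def smooth_manifold_atlas)

lemma lie_group_mult:
  "lie_group G AG \<Longrightarrow> smooth_map (prod_atlas AG AG) AG UNIV (\<lambda>p. fst p \<otimes>\<^bsub>G\<^esub> snd p)"
  by (simp add: lie_group_def case_prod_unfold)

text \<open>The exponential map of a Lie group. In a chart around the unit the multiplication becomes a local
multiplication on the Lie algebra, whose local one-parameter subgroup extends to the line; near a
time \<open>t0\<close> the extension is a left translate of the local one, hence smooth.\<close>

theorem one_param_subgroup_exists: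
  fixes G :: "'a::{t2_space, second_countable_topology} monoid"
    and AG :: "('a, 'g::finite_dim_normed) atlas"
  assumes LG: "lie_group G AG"
  shows "\<exists>C. one_param_subgroup G AG C \<and> velocity AG C = \<zeta>"
proof -
  note atl = lie_group_atlas[OF LG] and mul = lie_group_mult[OF LG]
  have grp: "group G" and car: "carrier G = UNIV" using LG by (auto simp: lie_group_def)
  interpret group G by (rule grp)
  have mem [simp]: "g \<in> carrier G" for g using car by simp
  define c where "c = chart_at AG \<one>\<^bsub>G\<^esub>"
  have c: "c \<in> AG" "\<one>\<^bsub>G\<^esub> \<in> fst c" using chart_at_mem[OF atl] by (auto simp: c_def)
  note ch = smooth_atlas_chart[OF atl c(1)]
  define m where "m p = fst p \<otimes>\<^bsub>G\<^esub> snd p" for p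
  define F where "F = prod_rep c c c m"
  define D where "D = prod_rep_domain c c c m"
  define R where "R = snd c ` fst c"
  define x0 where "x0 = snd c \<one>\<^bsub>G\<^esub>"
  note sm = smooth_prod_rep[OF atl atl atl mul[folded m_def[abs_def]] c(1) c(1) c(1), folded F_def D_def]
  have R: "open R" "x0 \<in> R" using chart_open[OF ch] c(2) by (auto simp: R_def x0_def)
  have e: "chart_inv c x0 = \<one>\<^bsub>G\<^esub>" using chart_inv_left[OF ch c(2)] by (simp add: x0_def)
  have D: "(a, b) \<in> D \<longleftrightarrow> a \<in> R \<and> b \<in> R \<and> chart_inv c a \<otimes>\<^bsub>G\<^esub> chart_inv c b \<in> fst c" for a b
    by (simp add: D_def prod_rep_domain_def R_def m_def)
  have F: "F (a, b) = snd c (chart_inv c a \<otimes>\<^bsub>G\<^esub> chart_inv c b)" for a b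
    by (simp add: F_def prod_rep_def m_def)
  have cF: "chart_inv c (F (a, b)) = chart_inv c a \<otimes>\<^bsub>G\<^esub> chart_inv c b" if "(a, b) \<in> D" for a b
    using that by (simp add: F D chart_inv_left[OF ch])
  have inv_mem: "chart_inv c a \<in> fst c" "snd c (chart_inv c a) = a" if "a \<in> R" for a
    using that chart_inv_mem[OF ch] chart_inv_right[OF ch] by (auto simp: R_def)
  obtain \<epsilon> x where x: "\<epsilon> > 0" "x 0 = x0" "\<And>t. \<bar>t\<bar> < \<epsilon> \<Longrightarrow> x t \<in> R" "smooth_on {-\<epsilon><..<\<epsilon>} x"
    "(x has_vector_derivative \<zeta>) (at 0)"
    "\<And>s t. \<bar>s\<bar> < \<epsilon> \<Longrightarrow> \<bar>t\<bar> < \<epsilon> \<Longrightarrow> (x s, x t) \<in> D"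
    "\<And>s t. \<bar>s\<bar> < \<epsilon> \<Longrightarrow> \<bar>t\<bar> < \<epsilon> \<Longrightarrow> F (x s, x t) = x (s + t)"
  proof (rule local_one_parameter_subgroup[OF sm R, of \<zeta>])
    show "(a, x0) \<in> D" "F (a, x0) = a" "F (x0, a) = a" if "a \<in> R" for a
      using inv_mem[OF that] that R(2) by (auto simp: D F e)
    show "b \<in> R" "F (a, b) \<in> R" if "(a, b) \<in> D" for a b
      using that by (auto simp: D F R_def)
    show "F (a, F (b, z)) = F (F (a, b), z)"
      if "(a, b) \<in> D" "(b, z) \<in> D" "(F (a, b), z) \<in> D" "(a, F (b, z)) \<in> D" for a b z
      using cF[OF that(1)] cF[OF that(2)] by (simp add: F[of a "F (b, z)"] F[of "F (a, b)" z] m_assoc)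
  qed blast
  define \<gamma> where "\<gamma> t = chart_inv c (x t)" for t
  have "\<gamma> s \<otimes>\<^bsub>G\<^esub> \<gamma> t = \<gamma> (s + t)" if "\<bar>s\<bar> < \<epsilon>" "\<bar>t\<bar> < \<epsilon>" for s t
    using cF[OF x(6)[OF that]] x(7)[OF that] by (simp add: \<gamma>_def)
  then obtain C where C: "\<And>s t. C (s + t) = C s \<otimes>\<^bsub>G\<^esub> C t" "\<And>t. \<bar>t\<bar> < \<epsilon> \<Longrightarrow> C t = \<gamma> t"
    using local_hom_extends[OF grp car x(1), of \<gamma>] by metis
  have xC: "snd c (C t) = x t" if "\<bar>t\<bar> < \<epsilon>" for t
    using inv_mem(2)[OF x(3)[OF that]] C(2)[OF that] by (simp add: \<gamma>_def)
  have C0: "C 0 = \<one>\<^bsub>G\<^esub>" using C(2)[of 0] x(1,2) e by (simp add: \<gamma>_def)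
  have smooth: "smooth_map vec_atlas AG UNIV C"
  proof (rule smooth_map_local[OF smooth_atlas_vec atl])
    fix t0 :: real
    let ?I = "{-\<epsilon><..<\<epsilon>}" and ?N = "(\<lambda>t. 1 * t + - t0) -` {-\<epsilon><..<\<epsilon>}"
    have "smooth_on ?N (\<lambda>t. x (1 * t + - t0))"
      by (rule smooth_on_compose_affine[OF x(4) _ open_greaterThanLessThan]) (simp add: bounded_linear_ident)
    moreover have oN: "open ?N" by (intro open_vimage open_greaterThanLessThan continuous_intros)
    ultimately have s1: "smooth_map vec_atlas vec_atlas ?N (\<lambda>t. x (1 * t + - t0))"
      by (simp add: smooth_map_vec_atlas)
    have s2: "smooth_map vec_atlas AG ?N (chart_inv c \<circ> (\<lambda>t. x (1 * t + - t0)))"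
      by (rule smooth_map_compose[OF smooth_atlas_vec smooth_atlas_vec atl s1 smooth_map_chart_inv[OF atl c(1)]])
        (use x(3) in \<open>auto simp: R_def abs_less_iff\<close>)
    have "smooth_map vec_atlas AG ?N ((\<lambda>g. C t0 \<otimes>\<^bsub>G\<^esub> g) \<circ> (chart_inv c \<circ> (\<lambda>t. x (1 * t + - t0))))"
      by (rule smooth_map_compose[OF smooth_atlas_vec atl atl s2, of UNIV])
        (use smooth_map_slice_right[OF atl atl atl mul, of "C t0"] in auto)
    moreover have "((\<lambda>g. C t0 \<otimes>\<^bsub>G\<^esub> g) \<circ> (chart_inv c \<circ> (\<lambda>t. x (1 * t + - t0)))) t = C t" if "t \<in> ?N" for t
      using C(1)[of t0 "t - t0"] C(2)[of "t - t0"] that by (auto simp: \<gamma>_def abs_less_iff)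
    ultimately have "smooth_map vec_atlas AG ?N C"
      by (rule smooth_map_cong[OF smooth_atlas_vec atl])
    then show "\<exists>N. t0 \<in> N \<and> N \<subseteq> UNIV \<and> smooth_map vec_atlas AG N C"
      using x(1) by (intro exI[of _ ?N]) auto
  qed
  have "((\<lambda>t. snd c (C t)) has_derivative (\<lambda>h. h *\<^sub>R \<zeta>)) (at 0)"
    by (rule has_derivative_transform_within_open[of x _ _ _ "{-\<epsilon><..<\<epsilon>}"])
      (use x(1,5) xC in \<open>auto simp: has_vector_derivative_def abs_less_iff\<close>)
  from frechet_derivative_eqI[OF this]
  have "velocity AG C = \<zeta>"
    by (simp add: velocity_def tangent_map_def chart_at_vec chart_inv_vec C0 flip: c_def add: comp_def)
  with smooth C(1) show ?thesis by (auto simp: one_param_subgroup_def)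
qed


section \<open>Isotropy algebras\<close>

text \<open>In a chart around any of its points the curve has derivative zero, so it is locally constant.\<close>

lemma zero_tangent_constant:
  fixes A :: "('m::topological_space, 'e::real_normed_vector) atlas" and y :: "real \<Rightarrow> 'm"
  assumes A: "smooth_atlas A" and y: "\<And>t. has_tangent vec_atlas A y t (\<lambda>_. 0)"
  shows "y t = y 0"
proof -
  have "\<exists>T. openin (top_of_set UNIV) T \<and> a \<in> T \<and> (\<forall>u\<in>T. y u = y a)" for a
  proof -
    define d where "d = chart_at A (y a)"
    have d: "d \<in> A" "y a \<in> fst d" using chart_at_mem[OF A] by (auto simp: d_def)
    note ch = smooth_atlas_chart[OF A d(1)]
    have "(y \<longlongrightarrow> y a) (nhds a)" using y[of a] by (simp add: has_tangent_def)
    then have "\<forall>\<^sub>F u in nhds a. y u \<in> fst d" by (rule topological_tendstoD[OF _ chart_open(1)[OF ch] d(2)])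
    then obtain e where e: "e > 0" "\<And>u. dist u a < e \<Longrightarrow> y u \<in> fst d"
      by (auto simp: eventually_nhds_metric)
    have der: "((\<lambda>u. snd d (y u)) has_derivative (\<lambda>_. 0)) (at u within ball a e)" if "u \<in> ball a e" for u
    proof -
      have u: "y u \<in> fst d" using e(2) that by (simp add: dist_commute)
      have "has_tangent vec_atlas vec_atlas (\<lambda>u. snd d (y u)) u (\<lambda>v. tangent_map A vec_atlas (snd d) (y u) 0)"
        by (rule has_tangent_compose[OF smooth_atlas_vec A y])
          (rule smooth_map_has_tangent[OF A smooth_atlas_vec smooth_map_chart[OF A d(1)] u])
      moreover have "tangent_map A vec_atlas (snd d) (y u) 0 = 0"
        by (rule linear_0[OF has_tangent_linear[OF
          smooth_map_has_tangent[OF A smooth_atlas_vec smooth_map_chart[OF A d(1)] u]]])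
      ultimately show ?thesis
        by (simp add: has_tangent_vec has_derivative_at_withinI)
    qed
    obtain k where k: "\<And>u. u \<in> ball a e \<Longrightarrow> snd d (y u) = k"
      using has_derivative_zero_constant[OF convex_ball der] by blast
    have "y u = y a" if u: "u \<in> ball a e" for u
    proof -
      have eq: "snd d (y u) = snd d (y a)" using k[OF u] k[of a] e(1) by simp
      have "y u \<in> fst d" using e(2)[of u] u by (simp add: dist_commute)
      then have "y u = chart_inv d (snd d (y u))" by (simp add: chart_inv_left[OF ch])
      also have "\<dots> = y a" unfolding eq by (rule chart_inv_left[OF ch d(2)])
      finally show ?thesis .
    qed
    moreover have "openin (top_of_set UNIV) (ball a e)" "a \<in> ball a e" using e(1) by simp_all
    ultimately show ?thesis by blast
  qed
  then have "y constant_on UNIV" by (intro locally_constant_imp_constant) auto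
  then show ?thesis unfolding constant_on_def by (metis UNIV_I)
qed

text \<open>The hypothesis on \<open>f\<close> carries the vanishing velocity at time \<open>0\<close> to every other time. It is applied to orbits of
one-parameter subgroups, where \<open>f s\<close> is the action of the group element at time \<open>s\<close>.\<close>

lemma homogeneous_curve_constant:
  fixes A :: "('m::topological_space, 'e::real_normed_vector) atlas" and y :: "real \<Rightarrow> 'm"
  assumes A: "smooth_atlas A" and y0: "has_tangent vec_atlas A y 0 (\<lambda>_. 0)"
    and f: "\<And>t. has_tangent A A (f t) (y 0) (E t)" and y: "\<And>s t. y (s + t) = f s (y t)"
  shows "y t = y 0"
proof (rule zero_tangent_constant[OF A])
  fix t :: real
  have "((\<lambda>u. u - t) has_derivative (\<lambda>h. h)) (at t)" by (auto intro!: derivative_eq_intros)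
  then have sh: "has_tangent vec_atlas vec_atlas (\<lambda>u. u - t) t (\<lambda>h. h)" by (simp add: has_tangent_vec)
  have "has_tangent vec_atlas A (\<lambda>u. y (u - t)) t (\<lambda>_. 0)"
    using has_tangent_compose[OF smooth_atlas_vec smooth_atlas_vec sh, of A y "\<lambda>_. 0"] y0 by simp
  from has_tangent_compose[OF smooth_atlas_vec A this, of A "f t" "E t"]
  have "has_tangent vec_atlas A (\<lambda>u. f t (y (u - t))) t (\<lambda>_. E t 0)" using f by simp
  moreover have "(\<lambda>u. f t (y (u - t))) = y" using y[of t] by (simp add: fun_eq_iff flip: y)
  moreover have "E t 0 = 0" by (rule linear_0[OF has_tangent_linear[OF f]])
  ultimately show "has_tangent vec_atlas A y t (\<lambda>_. 0)" by simp
qed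


context
  fixes G :: "'a::{t2_space, second_countable_topology} monoid"
    and AG :: "('a, 'g::finite_dim_normed) atlas"
    and AM :: "('m::topological_space, 'e::finite_dim_normed) atlas"
    and \<phi> :: "'a \<Rightarrow> 'm \<Rightarrow> 'm"
  assumes LG: "lie_group G AG" and act: "smooth_action G AG AM \<phi>" and AM: "smooth_atlas AM"
begin

lemma action_mult: "\<phi> (g \<otimes>\<^bsub>G\<^esub> h) m = \<phi> g (\<phi> h m)"
proof -
  interpret group_action G UNIV \<phi> using act by (simp add: smooth_action_def)
  show ?thesis using LG by (intro composition_rule) (auto simp: lie_group_def)
qed

lemma action_one: "\<phi> \<one>\<^bsub>G\<^esub> m = m"
proof -
  interpret group_action G UNIV \<phi> using act by (simp add: smooth_action_def)
  show ?thesis using id_eq_one by (metis UNIV_I restrict_apply)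
qed

lemma action_smooth: "smooth_map (prod_atlas AG AM) AM UNIV (\<lambda>p. \<phi> (fst p) (snd p))"
  using act by (simp add: smooth_action_def case_prod_unfold)

lemma orbit_map_tangent:
  "has_tangent AG AM (\<lambda>g. \<phi> g m) \<one>\<^bsub>G\<^esub> (\<lambda>\<zeta>. inf_generator G AG AM \<phi> \<zeta> m)"
  using smooth_map_has_tangent[OF lie_group_atlas[OF LG] AM
      smooth_map_slice_left[OF lie_group_atlas[OF LG] AM AM action_smooth, of m], of "\<one>\<^bsub>G\<^esub>"]
  by (simp add: inf_generator_def)

lemma linear_inf_generator: "linear (\<lambda>\<zeta>. inf_generator G AG AM \<phi> \<zeta> m)"
  by (rule has_tangent_linear[OF orbit_map_tangent])

lemma action_tangent:
  "has_tangent AM AM (\<phi> g) m (tangent_map AM AM (\<phi> g) m)"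
  using smooth_map_has_tangent[OF AM AM
      smooth_map_slice_right[OF lie_group_atlas[OF LG] AM AM action_smooth, of g], of m] by simp

lemma one_param_subgroup_0:
  assumes "one_param_subgroup G AG C"
  shows "C 0 = \<one>\<^bsub>G\<^esub>"
proof -
  interpret group G using LG by (simp add: lie_group_def)
  have "C 0 \<otimes>\<^bsub>G\<^esub> C 0 = C 0" using assms by (metis one_param_subgroup_def add_0)
  then show ?thesis using LG by (metis UNIV_I lie_group_def r_cancel_one)
qed

lemma orbit_curve_tangent:
  assumes C: "one_param_subgroup G AG C"
  shows "has_tangent vec_atlas AM (\<lambda>t. \<phi> (C t) m) 0 (\<lambda>h. h *\<^sub>R inf_generator G AG AM \<phi> (velocity AG C) m)"
proof -
  note AG = lie_group_atlas[OF LG]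
  have t: "has_tangent vec_atlas AG C 0 (tangent_map vec_atlas AG C 0)"
    by (rule smooth_map_has_tangent[OF smooth_atlas_vec AG]) (use C in \<open>auto simp: one_param_subgroup_def\<close>)
  have "has_tangent vec_atlas AM (\<lambda>t. \<phi> (C t) m) 0
      (\<lambda>h. inf_generator G AG AM \<phi> (tangent_map vec_atlas AG C 0 h) m)"
    by (rule has_tangent_compose[OF smooth_atlas_vec AG t])
      (simp add: one_param_subgroup_0[OF C] orbit_map_tangent)
  moreover have "inf_generator G AG AM \<phi> (tangent_map vec_atlas AG C 0 h) m
      = h *\<^sub>R inf_generator G AG AM \<phi> (velocity AG C) m" for h
    using linear_scale[OF has_tangent_linear[OF t], of h 1] linear_scale[OF linear_inf_generator]
    by (simp add: velocity_def)
  ultimately show ?thesis by simp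
qed

text \<open>If the generator of \<open>\<zeta>\<close> vanishes at \<open>m\<close>, then the one-parameter subgroup with velocity \<open>\<zeta>\<close> moves \<open>m\<close>
with initial velocity zero and therefore fixes it. This inclusion needs a one-parameter subgroup
for every Lie algebra element. In particular the isotropy algebra is the kernel of a linear map, hence
a subspace, which its definition by one-parameter subgroups does not show.\<close>

lemma lie_algebra_stabilizer:
  "lie_algebra_of G AG (stabilizer G \<phi> m) = {\<zeta>. inf_generator G AG AM \<phi> \<zeta> m = 0}"
proof (intro equalityI subsetI)
  fix \<zeta> assume "\<zeta> \<in> lie_algebra_of G AG (stabilizer G \<phi> m)"
  then obtain C where C: "one_param_subgroup G AG C" "velocity AG C = \<zeta>" "\<And>t. \<phi> (C t) m = m"
    by (auto simp: lie_algebra_of_def stabilizer_def)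
  have "has_tangent vec_atlas AM (\<lambda>t. m) (0::real) (\<lambda>h. h *\<^sub>R inf_generator G AG AM \<phi> \<zeta> m)"
    using orbit_curve_tangent[OF C(1), of m] C(2,3) by simp
  from has_tangent_unique[OF this has_tangent_const]
  have "1 *\<^sub>R inf_generator G AG AM \<phi> \<zeta> m = 0" by metis
  then show "\<zeta> \<in> {\<zeta>. inf_generator G AG AM \<phi> \<zeta> m = 0}" by simp
next
  fix \<zeta> assume z: "\<zeta> \<in> {\<zeta>. inf_generator G AG AM \<phi> \<zeta> m = 0}"
  obtain C where C: "one_param_subgroup G AG C" "velocity AG C = \<zeta>"
    using one_param_subgroup_exists[OF LG] by blast
  have "\<phi> (C t) m = \<phi> (C 0) m" for t
  proof (rule homogeneous_curve_constant[OF AM, where f="\<lambda>t. \<phi> (C t)"])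
    show "has_tangent vec_atlas AM (\<lambda>t. \<phi> (C t) m) 0 (\<lambda>_. 0)"
      using orbit_curve_tangent[OF C(1), of m] C(2) z by simp
    show "has_tangent AM AM (\<phi> (C t)) (\<phi> (C 0) m) (tangent_map AM AM (\<phi> (C t)) (\<phi> (C 0) m))" for t
      by (rule action_tangent)
    show "\<phi> (C (s + t)) m = \<phi> (C s) (\<phi> (C t) m)" for s t
      using C(1) action_mult by (simp add: one_param_subgroup_def)
  qed
  then have "\<phi> (C t) m = m" for t by (simp add: one_param_subgroup_0[OF C(1)] action_one)
  moreover have "carrier G = UNIV" using LG by (simp add: lie_group_def)
  ultimately show "\<zeta> \<in> lie_algebra_of G AG (stabilizer G \<phi> m)"
    using C by (auto simp: lie_algebra_of_def stabilizer_def)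
qed

text \<open>By equivariance the coadjoint orbit of \<open>J m\<close> along a one-parameter subgroup is the image under \<open>J\<close> of
the orbit of \<open>m\<close>, so its initial velocity is the derivative of \<open>J\<close> applied to the generator.\<close>

lemma lie_algebra_coadjoint_stabilizer:
  assumes J: "smooth_map AM vec_atlas UNIV J" and eq: "equivariant_map G AG \<phi> J"
  shows "lie_algebra_of G AG (stabilizer G (coadjoint G AG) (J m)) =
    {\<zeta>. tangent_map AM vec_atlas J m (inf_generator G AG AM \<phi> \<zeta> m) = 0}"
proof -
  have J': "has_tangent AM vec_atlas J m (tangent_map AM vec_atlas J m)"
    by (rule smooth_map_has_tangent[OF AM smooth_atlas_vec J]) simp
  have a: "has_tangent vec_atlas vec_atlas (\<lambda>t. J (\<phi> (C t) m)) 0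
      (\<lambda>h. h *\<^sub>R tangent_map AM vec_atlas J m (inf_generator G AG AM \<phi> (velocity AG C) m))"
    if C: "one_param_subgroup G AG C" for C
    using has_tangent_compose[OF smooth_atlas_vec AM orbit_curve_tangent[OF C, of m], of vec_atlas J
        "tangent_map AM vec_atlas J m"] J' linear_scale[OF has_tangent_linear[OF J']]
    by (simp add: one_param_subgroup_0[OF C] action_one)
  have eqv: "J (\<phi> g m) = coadjoint G AG g (J m)" for g m using eq by (simp add: equivariant_map_def)
  show ?thesis
  proof (intro equalityI subsetI)
    fix \<zeta> assume "\<zeta> \<in> lie_algebra_of G AG (stabilizer G (coadjoint G AG) (J m))"
    then obtain C where C: "one_param_subgroup G AG C" "velocity AG C = \<zeta>" "\<And>t. J (\<phi> (C t) m) = J m"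
      by (auto simp: lie_algebra_of_def stabilizer_def eqv)
    have "has_tangent vec_atlas vec_atlas (\<lambda>t. J m) (0::real)
        (\<lambda>h. h *\<^sub>R tangent_map AM vec_atlas J m (inf_generator G AG AM \<phi> \<zeta> m))"
      using a[OF C(1)] C(2,3) by simp
    from has_tangent_unique[OF this has_tangent_const]
    have "1 *\<^sub>R tangent_map AM vec_atlas J m (inf_generator G AG AM \<phi> \<zeta> m) = 0" by metis
    then show "\<zeta> \<in> {\<zeta>. tangent_map AM vec_atlas J m (inf_generator G AG AM \<phi> \<zeta> m) = 0}" by simp
  next
    fix \<zeta> assume z: "\<zeta> \<in> {\<zeta>. tangent_map AM vec_atlas J m (inf_generator G AG AM \<phi> \<zeta> m) = 0}"
    obtain C where C: "one_param_subgroup G AG C" "velocity AG C = \<zeta>"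
      using one_param_subgroup_exists[OF LG] by blast
    have "J (\<phi> (C t) m) = J (\<phi> (C 0) m)" for t
    proof (rule homogeneous_curve_constant[OF smooth_atlas_vec, where f="\<lambda>t. coadjoint G AG (C t)"])
      show "has_tangent vec_atlas vec_atlas (\<lambda>t. J (\<phi> (C t) m)) 0 (\<lambda>_. 0)"
        using a[OF C(1)] C(2) z by simp
      show "has_tangent vec_atlas vec_atlas (coadjoint G AG (C t)) (J (\<phi> (C 0) m)) (coadjoint G AG (C t))" for t
        unfolding has_tangent_vec coadjoint_def dual_map_def[abs_def]
        by (intro bounded_linear_imp_has_derivative bounded_linear_intros)
      show "J (\<phi> (C (s + t)) m) = coadjoint G AG (C s) (J (\<phi> (C t) m))" for s t
        using C(1) by (simp add: one_param_subgroup_def action_mult eqv)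
    qed
    then have "coadjoint G AG (C t) (J m) = J m" for t
      by (simp add: one_param_subgroup_0[OF C(1)] action_one flip: eqv)
    moreover have "carrier G = UNIV" using LG by (simp add: lie_group_def)
    ultimately show "\<zeta> \<in> lie_algebra_of G AG (stabilizer G (coadjoint G AG) (J m))"
      using C by (auto simp: lie_algebra_of_def stabilizer_def)
  qed
qed

end


section \<open>The splitting of the Lie algebra and its dual\<close>

lemma complement_in_0: "complement_in K S T \<Longrightarrow> x \<in> S \<Longrightarrow> x \<in> T \<Longrightarrow> x = 0"
  unfolding complement_in_def by blast

lemma complement_in_plus: "complement_in K S T \<Longrightarrow> x \<in> K \<Longrightarrow> \<exists>a\<in>S. \<exists>b\<in>T. x = a + b"
  unfolding complement_in_def set_plus_def by blast

lemma dual_map_apply: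
  fixes f :: "'a::finite_dim_normed \<Rightarrow> 'b::real_normed_vector"
  assumes "linear f"
  shows "blinfun_apply (dual_map f \<alpha>) x = blinfun_apply \<alpha> (f x)"
  using linear_imp_bounded_linear[OF assms]
  by (simp add: dual_map_def bounded_linear_Blinfun_apply)

lemma linear_dual_map: "linear (dual_map f)"
  unfolding dual_map_def[abs_def]
  by (intro bounded_linear.linear bounded_linear_intros)

context
  fixes gm gmu q :: "'g::finite_dim_normed set" and im :: "'k::finite_dim_normed \<Rightarrow> 'g"
  assumes gm: "subspace gm" and gmu: "subspace gmu" and im: "linear im" "inj im"
    and c1: "complement_in gmu gm (range im)" and c2: "complement_in UNIV gmu q"
begin

text \<open>With \<open>splitting_exists\<close> below, this says that \<open>gm \<oplus> range im \<oplus> q\<close> is a direct sum decomposition, which makes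
the description in \<^const>\<open>splitting_proj\<close> well defined.\<close>

lemma splitting_unique:
  assumes "a \<in> gm" "b \<in> q" "a' \<in> gm" "b' \<in> q" "a + im k + b = a' + im k' + b'"
  shows "k = k'"
proof -
  have q: "subspace q" using c2 by (simp add: complement_in_def)
  have gmu_eq: "gmu = gm + range im" using c1 by (simp add: complement_in_def)
  have d: "(a - a') + im (k - k') = b' - b"
    using assms(5) im(1) by (simp add: linear_diff algebra_simps)
  have "(a - a') + im (k - k') \<in> gmu"
    unfolding gmu_eq using assms gm by (intro set_plus_intro) (auto simp: subspace_diff)
  moreover have "b' - b \<in> q" using assms q by (simp add: subspace_diff)
  ultimately have "(a - a') + im (k - k') = 0" using complement_in_0[OF c2] d by metis
  then have "im (k - k') = a' - a" by (simp add: algebra_simps eq_neg_iff_add_eq_0)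
  moreover have "a' - a \<in> gm" using assms gm by (simp add: subspace_diff)
  ultimately have "im (k - k') = 0" using complement_in_0[OF c1] by (metis rangeI)
  then show ?thesis using im by (metis eq_iff_diff_eq_0 injD linear_0)
qed

lemma splitting_proj_eq:
  assumes "a \<in> gm" "b \<in> q"
  shows "splitting_proj gm im q (a + im k + b) = k"
  unfolding splitting_proj_def
proof (rule the_equality)
  show "\<exists>a'\<in>gm. \<exists>b'\<in>q. a + im k + b = a' + im k + b'" using assms by blast
  show "k' = k" if "\<exists>a'\<in>gm. \<exists>b'\<in>q. a + im k + b = a' + im k' + b'" for k'
    using that splitting_unique[OF assms] by metis
qed

lemma splitting_exists: "\<exists>a\<in>gm. \<exists>k. \<exists>b\<in>q. \<zeta> = a + im k + b"
proof -
  obtain x b where "x \<in> gmu" "b \<in> q" "\<zeta> = x + b" using complement_in_plus[OF c2] by blast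
  moreover obtain a k where "a \<in> gm" "x = a + im k" using complement_in_plus[OF c1 \<open>x \<in> gmu\<close>] by blast
  ultimately show ?thesis by blast
qed

lemma linear_splitting_proj: "linear (splitting_proj gm im q)"
proof (rule linearI)
  have q: "subspace q" using c2 by (simp add: complement_in_def)
  fix x y
  obtain a k b where x: "a \<in> gm" "b \<in> q" "x = a + im k + b" using splitting_exists by metis
  obtain a' k' b' where y: "a' \<in> gm" "b' \<in> q" "y = a' + im k' + b'" using splitting_exists by metis
  have "x + y = (a + a') + im (k + k') + (b + b')"
    by (simp add: x(3) y(3) linear_add[OF im(1)])
  then have "splitting_proj gm im q (x + y) = k + k'"
    using splitting_proj_eq[of "a + a'" "b + b'" "k + k'"] x(1,2) y(1,2) gm q
    by (simp add: subspace_add)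
  moreover have "splitting_proj gm im q x = k" "splitting_proj gm im q y = k'"
    using splitting_proj_eq x y by auto
  ultimately show "splitting_proj gm im q (x + y) = splitting_proj gm im q x + splitting_proj gm im q y"
    by simp
next
  have q: "subspace q" using c2 by (simp add: complement_in_def)
  fix r x
  obtain a k b where x: "a \<in> gm" "b \<in> q" "x = a + im k + b" using splitting_exists by metis
  have "r *\<^sub>R x = r *\<^sub>R a + im (r *\<^sub>R k) + r *\<^sub>R b"
    by (simp add: x(3) linear_scale[OF im(1)] scaleR_add_right)
  then have "splitting_proj gm im q (r *\<^sub>R x) = r *\<^sub>R k"
    using splitting_proj_eq[of "r *\<^sub>R a" "r *\<^sub>R b" "r *\<^sub>R k"] x(1,2) gm q
    by (simp add: subspace_scale)
  then show "splitting_proj gm im q (r *\<^sub>R x) = r *\<^sub>R splitting_proj gm im q x"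
    using splitting_proj_eq[OF x(1,2), of k] x(3) by simp
qed

text \<open>The next three lemmas say that the duals of \<open>im\<close> and of the projection are mutually inverse
isomorphisms between the annihilator of \<open>gm \<oplus> q\<close> and the dual of the middle summand.\<close>

lemma dual_splitting_proj_annihilates:
  "dual_map (splitting_proj gm im q) \<eta> \<in> annihilator (gm + q)"
proof -
  have "splitting_proj gm im q \<zeta> = 0" if \<zeta>: "\<zeta> \<in> gm + q" for \<zeta>
  proof -
    obtain a b where "a \<in> gm" "b \<in> q" "\<zeta> = a + b" using \<zeta> by (auto simp: set_plus_def)
    then show ?thesis
      using splitting_proj_eq[of a b 0] im by (simp add: linear_0)
  qed
  then show ?thesis
    by (simp add: annihilator_def dual_map_apply[OF linear_splitting_proj])
qed

lemma dual_im_dual_proj: "dual_map im (dual_map (splitting_proj gm im q) \<eta>) = \<eta>"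
proof (rule blinfun_eqI)
  fix k
  have "0 \<in> gm" "0 \<in> q" using gm c2 by (auto simp: complement_in_def subspace_0)
  then have "splitting_proj gm im q (im k) = k"
    using splitting_proj_eq[of 0 0 k] by simp
  then show "blinfun_apply (dual_map im (dual_map (splitting_proj gm im q) \<eta>)) k = blinfun_apply \<eta> k"
    by (simp add: dual_map_apply im linear_splitting_proj)
qed

lemma dual_proj_dual_im:
  assumes "\<alpha> \<in> annihilator (gm + q)"
  shows "dual_map (splitting_proj gm im q) (dual_map im \<alpha>) = \<alpha>"
proof (rule blinfun_eqI)
  fix \<zeta>
  have "0 \<in> gm" "0 \<in> q" using gm c2 by (auto simp: complement_in_def subspace_0)
  obtain a k b where x: "a \<in> gm" "b \<in> q" "\<zeta> = a + im k + b"
    using splitting_exists by metis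
  have "a \<in> gm + q" "b \<in> gm + q"
    using set_plus_intro[OF x(1) \<open>0 \<in> q\<close>] set_plus_intro[OF \<open>0 \<in> gm\<close> x(2)] by simp_all
  then have "blinfun_apply \<alpha> \<zeta> = blinfun_apply \<alpha> (im k)"
    using assms by (simp add: x annihilator_def blinfun.add_right)
  then show "blinfun_apply (dual_map (splitting_proj gm im q) (dual_map im \<alpha>)) \<zeta> = blinfun_apply \<alpha> \<zeta>"
    using splitting_proj_eq[OF x(1,2), of k]
    by (simp add: dual_map_apply im linear_splitting_proj flip: x(3))
qed

end

lemma linear_inv_into_comp:
  assumes A: "linear A" and W: "subspace W" and bij: "bij_betw A W R"
    and h: "linear h" "\<And>\<eta>. h \<eta> \<in> R"
  shows "linear (\<lambda>\<eta>. inv_into W A (h \<eta>))"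
proof -
  have inj: "inj_on A W" using bij by (simp add: bij_betw_def)
  have mem: "inv_into W A (h \<eta>) \<in> W" "A (inv_into W A (h \<eta>)) = h \<eta>" for \<eta>
    using inv_into_into[of "h \<eta>" A W] f_inv_into_f[of "h \<eta>" A W] h(2)[of \<eta>] bij
    by (simp_all add: bij_betw_def)
  show ?thesis
  proof (rule linearI)
    fix x y
    have "A (inv_into W A (h x) + inv_into W A (h y)) = h (x + y)"
      by (simp only: linear_add[OF A] mem(2) linear_add[OF h(1)])
    then show "inv_into W A (h (x + y)) = inv_into W A (h x) + inv_into W A (h y)"
      by (intro inv_into_f_eq[OF inj] subspace_add[OF W] mem(1))
  next
    fix r x
    have "A (r *\<^sub>R inv_into W A (h x)) = h (r *\<^sub>R x)"
      by (simp only: linear_scale[OF A] mem(2) linear_scale[OF h(1)])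
    then show "inv_into W A (h (r *\<^sub>R x)) = r *\<^sub>R inv_into W A (h x)"
      by (intro inv_into_f_eq[OF inj] subspace_scale[OF W] mem(1))
  qed
qed


section \<open>Embeddings composed with linear maps\<close>

lemma smooth_map_on_open:
  assumes A: "smooth_atlas A" and B: "smooth_atlas B" and S: "open S" and f: "smooth_map_on A B S f"
  shows "smooth_map A B S f"
proof (rule smooth_map_local[OF A B])
  fix p assume p: "p \<in> S"
  then obtain N F where N: "p \<in> N" "smooth_map A B N F" "\<And>x. x \<in> N \<inter> S \<Longrightarrow> F x = f x"
    using f unfolding smooth_map_on_def by metis
  have "open (N \<inter> S)" using N(2) S by (auto simp: smooth_map_def)
  then have "smooth_map A B (N \<inter> S) F" using smooth_map_subset[OF N(2)] by blast
  from smooth_map_cong[OF A B this N(3)] show "\<exists>N. p \<in> N \<and> N \<subseteq> S \<and> smooth_map A B N f"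
    by (intro exI[of _ "N \<inter> S"]) (simp add: N(1) p)
qed

lemma smooth_map_vec_bounded_linear: "bounded_linear L \<Longrightarrow> open S \<Longrightarrow> smooth_map vec_atlas vec_atlas S L"
  by (simp add: smooth_map_vec_atlas smooth_on_bounded_linear)

text \<open>For a map on a subset of a subspace, smoothness of the map and of its inverse refers to extensions to
open sets. Linear maps \<open>L\<close> and \<open>M\<close> defined everywhere provide both: the extensions of \<open>\<psi>\<close> are composed
with \<open>L\<close>, and those of its inverse with \<open>M\<close>.\<close>

lemma diffeo_onto_image_compose_linear:
  fixes \<psi> :: "'x::finite_dim_normed \<Rightarrow> 'm::topological_space"
    and AM :: "('m, 'e::real_normed_vector) atlas"
    and L :: "'p::real_normed_vector \<Rightarrow> 'x"
  assumes AM: "smooth_atlas AM" and \<psi>: "diffeo_onto_image vec_atlas AM U \<psi>"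
    and L: "bounded_linear L" and M: "bounded_linear M"
    and LS: "L ` S \<subseteq> U" and left_inv: "\<And>p. p \<in> S \<Longrightarrow> M (L p) = p"
  shows "diffeo_onto_image vec_atlas AM S (\<lambda>p. \<psi> (L p))"
proof -
  have \<psi>': "smooth_map_on vec_atlas AM U \<psi>" "inj_on \<psi> U" "smooth_map_on AM vec_atlas (\<psi> ` U) (inv_into U \<psi>)"
    using \<psi> by (auto simp: diffeo_onto_image_def)
  have inj: "inj_on (\<lambda>p. \<psi> (L p)) S"
  proof (rule inj_onI)
    fix p p' assume p: "p \<in> S" "p' \<in> S" "\<psi> (L p) = \<psi> (L p')"
    then have "L p = L p'" using \<psi>'(2) LS by (auto dest: inj_onD)
    then show "p = p'" using left_inv p by metis
  qed
  have "smooth_map_on vec_atlas AM S (\<lambda>p. \<psi> (L p))"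
    unfolding smooth_map_on_def
  proof
    fix p assume p: "p \<in> S"
    then have "L p \<in> U" using LS by blast
    then obtain N F where N: "L p \<in> N" "smooth_map vec_atlas AM N F" "\<And>x. x \<in> N \<inter> U \<Longrightarrow> F x = \<psi> x"
      using \<psi>'(1) unfolding smooth_map_on_def by metis
    have o: "open (L -` N)"
      using N(2) L by (intro open_vimage linear_continuous_on) (simp_all add: smooth_map_def)
    have "smooth_map vec_atlas AM (L -` N) (F \<circ> L)"
      by (rule smooth_map_compose[OF smooth_atlas_vec smooth_atlas_vec AM smooth_map_vec_bounded_linear[OF L o] N(2)])
        auto
    moreover have "\<forall>x\<in>L -` N \<inter> S. (F \<circ> L) x = \<psi> (L x)" using N(3) LS by auto
    ultimately show "\<exists>N F. p \<in> N \<and> smooth_map vec_atlas AM N F \<and> (\<forall>x\<in>N \<inter> S. F x = \<psi> (L x))"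
      using N(1) by blast
  qed
  moreover have "smooth_map_on AM vec_atlas ((\<lambda>p. \<psi> (L p)) ` S) (inv_into S (\<lambda>p. \<psi> (L p)))"
    unfolding smooth_map_on_def
  proof
    fix y assume "y \<in> (\<lambda>p. \<psi> (L p)) ` S"
    then have "y \<in> \<psi> ` U" using LS by auto
    then obtain N F where N: "y \<in> N" "smooth_map AM vec_atlas N F" "\<And>x. x \<in> N \<inter> \<psi> ` U \<Longrightarrow> F x = inv_into U \<psi> x"
      using \<psi>'(3) unfolding smooth_map_on_def by metis
    have "smooth_map AM vec_atlas N (M \<circ> F)"
      by (rule smooth_map_compose[OF AM smooth_atlas_vec smooth_atlas_vec N(2) smooth_map_vec_bounded_linear[OF M open_UNIV]])
        simp
    moreover have "(M \<circ> F) x = inv_into S (\<lambda>p. \<psi> (L p)) x" if x: "x \<in> N \<inter> (\<lambda>p. \<psi> (L p)) ` S" for x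
    proof -
      obtain p where p: "p \<in> S" "x = \<psi> (L p)" using x by blast
      have Lp: "L p \<in> U" using p LS by blast
      have "F x = L p" using N(3)[of x] x p Lp by (simp add: inv_into_f_f[OF \<psi>'(2)])
      moreover have "inv_into S (\<lambda>p. \<psi> (L p)) x = p"
        unfolding p(2) by (rule inv_into_f_f[OF inj p(1)])
      ultimately show ?thesis using left_inv[OF p(1)] by simp
    qed
    ultimately show "\<exists>N F. y \<in> N \<and> smooth_map AM vec_atlas N F \<and>
        (\<forall>x\<in>N \<inter> (\<lambda>p. \<psi> (L p)) ` S. F x = inv_into S (\<lambda>p. \<psi> (L p)) x)"
      using N(1) by blast
  qed
  ultimately show ?thesis using inj by (simp add: diffeo_onto_image_def)
qed

lemma tangent_along_compose_linear:
  assumes A: "smooth_atlas A" and f: "has_tangent vec_atlas A f (L p) D" and L: "linear L"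
  shows "tangent_along A (\<lambda>x. f (L x)) p u = D (L u)"
proof -
  have eq: "(\<lambda>t. f (L (p + t *\<^sub>R u))) = (\<lambda>t. f (L p + t *\<^sub>R L u))"
    by (simp add: linear_add[OF L] linear_scale[OF L])
  have "((\<lambda>t. L p + t *\<^sub>R L u) has_derivative (\<lambda>h. h *\<^sub>R L u)) (at 0)"
    by (auto intro!: derivative_eq_intros)
  then have 1: "has_tangent vec_atlas vec_atlas (\<lambda>t. L p + t *\<^sub>R L u) 0 (\<lambda>h. h *\<^sub>R L u)"
    by (simp add: has_tangent_vec)
  have "has_tangent vec_atlas A (\<lambda>t. f (L p + t *\<^sub>R L u)) 0 (\<lambda>h. D (h *\<^sub>R L u))"
    by (rule has_tangent_compose[OF smooth_atlas_vec smooth_atlas_vec 1]) (simp add: f)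
  from tangent_map_eqI[OF this] show ?thesis
    by (simp add: tangent_along_def velocity_def eq)
qed


section \<open>Transversality to group orbits\<close>

context
  fixes G :: "'a::{t2_space, second_countable_topology} monoid"
    and AG :: "('a, 'g::finite_dim_normed) atlas"
    and AM :: "('m::topological_space, 'e::finite_dim_normed) atlas"
    and \<phi> :: "'a \<Rightarrow> 'm \<Rightarrow> 'm"
  assumes LG: "lie_group G AG" and act: "smooth_action G AG AM \<phi>" and AM: "smooth_atlas AM"
begin

text \<open>The pairing \<open>(b, c) \<mapsto> \<omega> (c_M, b_M)\<close> at \<open>m\<close> is nondegenerate on \<open>q\<close>. Indeed, if \<open>b \<in> q\<close> is in its
kernel, then the derivative of \<open>J\<close> along \<open>b_M\<close> vanishes on \<open>q\<close>; by antisymmetry it also vanishes on \<open>gmu\<close>, whose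
generators are killed by the derivative of \<open>J\<close>. Hence \<open>b\<close> lies in \<open>gmu\<close>, which meets \<open>q\<close> only in zero.
So some \<open>b \<in> q\<close> corrects the derivative of \<open>J\<close> along \<open>u\<close> on \<open>q\<close>; on \<open>gm\<close> it vanishes
anyway, because the generators of \<open>gm\<close> vanish at \<open>m\<close>.\<close>

lemma momentum_residual_annihilates:
  assumes symp: "symplectic_form AM \<omega>" and mom: "momentum_map G AG AM \<omega> \<phi> J"
    and gm: "gm = {\<zeta>. inf_generator G AG AM \<phi> \<zeta> m = 0}"
    and gmu: "gmu = {\<zeta>. tangent_map AM vec_atlas J m (inf_generator G AG AM \<phi> \<zeta> m) = 0}"
    and q: "complement_in UNIV gmu q"
  shows "\<exists>b\<in>q. tangent_map AM vec_atlas J m (u - inf_generator G AG AM \<phi> b m) \<in> annihilator (gm + q)"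
proof -
  define \<xi> where "\<xi> \<zeta> = inf_generator G AG AM \<phi> \<zeta> m" for \<zeta>
  define DJ where "DJ = tangent_map AM vec_atlas J m"
  have lin_\<xi>: "linear \<xi>" unfolding \<xi>_def by (rule linear_inf_generator[OF LG act AM])
  have J: "smooth_map AM vec_atlas UNIV J" and DJ: "blinfun_apply (DJ v) \<zeta> = \<omega> m (\<xi> \<zeta>) v" for v \<zeta>
    using mom by (auto simp: momentum_map_def DJ_def \<xi>_def)
  have lin_DJ: "linear DJ"
    unfolding DJ_def by (rule has_tangent_linear[OF smooth_map_has_tangent[OF AM smooth_atlas_vec J]]) simp
  have "\<forall>m u. linear (\<omega> m u)"
    using symp unfolding symplectic_form_def by (elim conjE)
  moreover have "\<forall>m u v. \<omega> m u v = - \<omega> m v u"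
    using symp unfolding symplectic_form_def by (elim conjE)
  ultimately have anti: "\<omega> m u v = - \<omega> m v u" and lin_\<omega>: "linear (\<omega> m u)" for u v
    by blast+
  have sq: "subspace q" using q by (simp add: complement_in_def)
  have lin1: "linear (\<lambda>b. blinfun_apply (DJ (\<xi> b)) c)" for c
    by (rule linearI) (simp_all add: linear_add[OF lin_\<xi>] linear_add[OF lin_DJ] linear_scale[OF lin_\<xi>]
        linear_scale[OF lin_DJ] blinfun.add_left blinfun.scaleR_left)
  have lin2: "linear (blinfun_apply \<alpha>)" for \<alpha> :: "'g \<Rightarrow>\<^sub>L real"
    by (rule bounded_linear.linear[OF blinfun.bounded_linear_right])
  have nd: "b = 0" if b: "b \<in> q" and 0: "\<And>c. c \<in> q \<Longrightarrow> blinfun_apply (DJ (\<xi> b)) c = 0" for b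
  proof -
    have "DJ (\<xi> b) = 0"
    proof (rule blinfun_eqI)
      fix \<zeta>
      obtain c d where cd: "c \<in> gmu" "d \<in> q" "\<zeta> = c + d" using complement_in_plus[OF q] by blast
      have "blinfun_apply (DJ (\<xi> b)) c = - blinfun_apply (DJ (\<xi> c)) b"
        unfolding DJ by (rule anti)
      also have "\<dots> = 0" using cd(1) by (simp add: gmu DJ_def \<xi>_def)
      finally show "blinfun_apply (DJ (\<xi> b)) \<zeta> = blinfun_apply 0 \<zeta>"
        using 0[OF cd(2)] by (simp add: cd(3) blinfun.add_right)
    qed
    then have "b \<in> gmu" by (simp add: gmu DJ_def \<xi>_def)
    then show ?thesis using complement_in_0[OF q] b by blast
  qed
  obtain b where b: "b \<in> q" "\<And>c. c \<in> q \<Longrightarrow> blinfun_apply (DJ (\<xi> b)) c = blinfun_apply (DJ u) c"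
    using nondegenerate_represents[OF lin1 lin2 lin2 sq nd, of "DJ u"] by blast
  have "DJ (u - \<xi> b) \<in> annihilator (gm + q)"
    unfolding annihilator_def
  proof (intro CollectI ballI)
    fix \<zeta> assume "\<zeta> \<in> gm + q"
    then obtain a c where ac: "a \<in> gm" "c \<in> q" "\<zeta> = a + c" by (auto simp: set_plus_def)
    have "\<xi> a = 0" using ac(1) by (simp add: gm \<xi>_def)
    then have "blinfun_apply (DJ (u - \<xi> b)) a = 0"
      using anti[of 0 "u - \<xi> b"] linear_0[OF lin_\<omega>] by (simp add: DJ)
    moreover have "blinfun_apply (DJ (u - \<xi> b)) c = 0"
      using b(2)[OF ac(2)] by (simp add: linear_diff[OF lin_DJ] blinfun.diff_left)
    ultimately show "blinfun_apply (DJ (u - \<xi> b)) \<zeta> = 0" by (simp add: ac(3) blinfun.add_right)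
  qed
  then show ?thesis using b(1) unfolding DJ_def \<xi>_def by blast
qed

text \<open>At \<open>x0\<close> the vectors of a basis are attained by fixed choices of \<open>\<zeta>\<close> and \<open>y\<close>. In one chart around \<open>\<psi> x0\<close> the
vectors that the same choices produce at \<open>x\<close> depend continuously on \<open>x\<close>, so near \<open>x0\<close> they still
span. Since the tangent map of the chart is an isomorphism at each point, this gives the
claim in the tangent spaces at \<open>\<psi> x\<close>.\<close>

lemma transversality_open:
  fixes \<psi> :: "'x::finite_dim_normed \<Rightarrow> 'm"
  assumes \<psi>: "smooth_map vec_atlas AM U \<psi>" and x0: "x0 \<in> U"
    and Z: "subspace Z" and Y: "subspace Y"
    and trans: "\<And>u. \<exists>\<zeta>\<in>Z. \<exists>y\<in>Y. u = inf_generator G AG AM \<phi> \<zeta> (\<psi> x0) + tangent_map vec_atlas AM \<psi> x0 y"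
  shows "\<exists>N. open N \<and> x0 \<in> N \<and> N \<subseteq> U \<and> (\<forall>x\<in>N. \<forall>u. \<exists>\<zeta>\<in>Z. \<exists>y\<in>Y.
    u = inf_generator G AG AM \<phi> \<zeta> (\<psi> x) + tangent_map vec_atlas AM \<psi> x y)"
proof -
  note AG = lie_group_atlas[OF LG]
  define me where "me = \<psi> x0"
  define c where "c = chart_at AM me"
  have c: "c \<in> AM" "me \<in> fst c" using chart_at_mem[OF AM] by (auto simp: c_def)
  note chc = smooth_atlas_chart[OF AM c(1)]
  define h where "h = chart_at AG \<one>\<^bsub>G\<^esub>"
  have h: "h \<in> AG" "\<one>\<^bsub>G\<^esub> \<in> fst h" using chart_at_mem[OF AG] by (auto simp: h_def)
  note chh = smooth_atlas_chart[OF AG h(1)]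
  define h0 where "h0 = snd h \<one>\<^bsub>G\<^esub>"
  define \<Phi> where "\<Phi> = prod_rep h c c (\<lambda>p. \<phi> (fst p) (snd p))"
  define D where "D = prod_rep_domain h c c (\<lambda>p. \<phi> (fst p) (snd p))"
  note sm = smooth_prod_rep[OF AG AM AM action_smooth[OF LG act AM] h(1) c(1) c(1), folded \<Phi>_def D_def]
  have inD: "(h0, snd c m) \<in> D" if "m \<in> fst c" for m
    using h(2) that
    by (simp add: D_def prod_rep_domain_def h0_def chart_inv_left[OF chh] chart_inv_left[OF chc] action_one[OF LG act AM])
  define K where "K m = tangent_map AM vec_atlas (snd c) m" for m
  have K: "has_tangent AM vec_atlas (snd c) m (K m)" if "m \<in> fst c" for m
    unfolding K_def by (rule smooth_map_has_tangent[OF AM smooth_atlas_vec smooth_map_chart[OF AM c(1)] that])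
  define T where "T x = tangent_map vec_atlas AM \<psi> x" for x
  have T: "has_tangent vec_atlas AM \<psi> x (T x)" if "x \<in> U" for x
    unfolding T_def by (rule smooth_map_has_tangent[OF smooth_atlas_vec AM \<psi> that])
  define \<xi> where "\<xi> m \<zeta> = inf_generator G AG AM \<phi> \<zeta> m" for m \<zeta>
  have lin_\<xi>: "linear (\<xi> m)" for m unfolding \<xi>_def by (rule linear_inf_generator[OF LG act AM])
  have K\<xi>: "K m (\<xi> m \<zeta>) = frechet_derivative \<Phi> (at (h0, snd c m)) (\<zeta>, 0)" if m: "m \<in> fst c" for m \<zeta>
  proof -
    have "has_tangent AG vec_atlas (\<lambda>g. snd c (\<phi> g m)) \<one>\<^bsub>G\<^esub> (\<lambda>\<zeta>. K m (\<xi> m \<zeta>))"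
      by (rule has_tangent_compose[OF AG AM orbit_map_tangent[OF LG act AM, of m, folded \<xi>_def]])
        (simp add: action_one[OF LG act AM] K[OF m])
    then have "((\<lambda>x. snd c (\<phi> (chart_inv h x) m)) has_derivative (\<lambda>\<zeta>. K m (\<xi> m \<zeta>))) (at h0)"
      by (simp add: has_tangent_def chart_at_vec comp_def flip: h_def h0_def)
    moreover have "(\<lambda>x. snd c (\<phi> (chart_inv h x) m)) = (\<lambda>x. \<Phi> (x, snd c m))"
      by (simp add: \<Phi>_def prod_rep_def chart_inv_left[OF chc m])
    ultimately have d1: "((\<lambda>x. \<Phi> (x, snd c m)) has_derivative (\<lambda>\<zeta>. K m (\<xi> m \<zeta>))) (at h0)" by simp
    have "((\<lambda>x. (x, snd c m)) has_derivative (\<lambda>v. (v, 0))) (at h0)"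
      by (auto intro!: derivative_eq_intros)
    from has_derivative_compose[OF this smooth_on_has_derivative[OF sm(2) inD[OF m]]]
    have "((\<lambda>x. \<Phi> (x, snd c m)) has_derivative (\<lambda>v. frechet_derivative \<Phi> (at (h0, snd c m)) (v, 0))) (at h0)" .
    from has_derivative_unique[OF d1 this] show ?thesis by (simp add: fun_eq_iff)
  qed
  have KT: "K (\<psi> x) (T x y) = frechet_derivative (\<lambda>x. snd c (\<psi> x)) (at x) y" if x: "x \<in> U" "\<psi> x \<in> fst c" for x y
  proof -
    have "has_tangent vec_atlas vec_atlas (\<lambda>x. snd c (\<psi> x)) x (\<lambda>y. K (\<psi> x) (T x y))"
      by (rule has_tangent_compose[OF smooth_atlas_vec AM T[OF x(1)] K[OF x(2)]])
    then have "((\<lambda>x. snd c (\<psi> x)) has_derivative (\<lambda>y. K (\<psi> x) (T x y))) (at x)"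
      by (simp add: has_tangent_vec)
    from frechet_derivative_eqI[OF this] show ?thesis by simp
  qed
  have Kinv: "K m u = K m v \<Longrightarrow> u = v" if "m \<in> fst c" for m u v
    unfolding K_def using chart_tangent_inverse(1)[OF AM c(1) that] by metis
  define N1 where "N1 = U \<inter> \<psi> -` fst c"
  have U: "open U" "continuous_on U \<psi>" using \<psi> by (auto simp: smooth_map_def)
  have N1: "open N1" "x0 \<in> N1" "continuous_on N1 \<psi>"
    unfolding N1_def using continuous_open_preimage[OF U(2,1) chart_open(1)[OF chc]] x0 c(2) U(2)
    by (auto simp: me_def intro: continuous_on_subset)
  have s\<psi>: "smooth_on N1 (\<lambda>x. snd c (\<psi> x))"
    using \<psi> c(1) by (auto simp: smooth_map_def vec_atlas_def chart_inv_vec N1_def comp_def)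
  have "\<exists>\<zeta> y. \<zeta> \<in> Z \<and> y \<in> Y \<and> K me (\<xi> me \<zeta> + T x0 y) = b" for b
  proof -
    define u where "u = tangent_map vec_atlas AM (chart_inv c) (snd c me) b"
    have "K me u = b" unfolding K_def u_def by (rule chart_tangent_inverse(2)[OF AM c])
    then show ?thesis using trans[of u] by (auto simp: \<xi>_def T_def me_def)
  qed
  then obtain \<zeta> y where zy: "\<And>b. \<zeta> b \<in> Z" "\<And>b. y b \<in> Y" "\<And>b. K me (\<xi> me (\<zeta> b) + T x0 (y b)) = b"
    by metis
  \<comment> \<open>The vector at \<open>\<psi> x\<close> produced by the choices for \<open>b\<close>, in the coordinates of the chart \<open>c\<close>.\<close>
  define S where "S x b = K (\<psi> x) (\<xi> (\<psi> x) (\<zeta> b) + T x (y b))" for x b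
  have S: "S x b = frechet_derivative \<Phi> (at (h0, snd c (\<psi> x))) (\<zeta> b, 0) + frechet_derivative (\<lambda>x. snd c (\<psi> x)) (at x) (y b)"
    if "x \<in> N1" for x b
    using that by (simp add: S_def N1_def linear_add[OF has_tangent_linear[OF K]] K\<xi> KT)
  have cont: "continuous_on N1 (\<lambda>x. S x b)" for b
  proof -
    have "continuous_on N1 (\<lambda>x. frechet_derivative \<Phi> (at (h0, snd c (\<psi> x))) (\<zeta> b, 0))"
      by (rule continuous_on_compose2[OF smooth_on_imp_continuous_on[OF smooth_on_derivative[OF sm(2)]]])
        (use inD in \<open>auto simp: N1_def intro!: continuous_on_Pair smooth_on_imp_continuous_on[OF s\<psi>, unfolded N1_def]\<close>)
    moreover have "continuous_on N1 (\<lambda>x. frechet_derivative (\<lambda>x. snd c (\<psi> x)) (at x) (y b))"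
      by (rule smooth_on_imp_continuous_on[OF smooth_on_derivative[OF s\<psi>]])
    ultimately have "continuous_on N1 (\<lambda>x. frechet_derivative \<Phi> (at (h0, snd c (\<psi> x))) (\<zeta> b, 0) +
        frechet_derivative (\<lambda>x. snd c (\<psi> x)) (at x) (y b))"
      by (rule continuous_on_add)
    then show ?thesis by (rule continuous_on_eq) (simp add: S)
  qed
  obtain \<delta> where \<delta>: "\<delta> > 0" "\<And>S :: 'e \<Rightarrow> 'e. (\<And>b. b \<in> std_basis \<Longrightarrow> norm (S b - b) < \<delta>) \<Longrightarrow> span (S ` std_basis) = UNIV"
    using span_perturbed_basis by metis
  have "\<forall>\<^sub>F x in nhds x0. norm (S x b - b) < \<delta>" for b
  proof -
    have "((\<lambda>x. S x b) \<longlongrightarrow> S x0 b) (nhds x0)"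
      by (rule continuous_on_open_tendsto_nhds[OF cont N1(1,2)])
    moreover have "S x0 b = b" using zy(3) by (simp add: S_def me_def)
    ultimately show ?thesis using \<delta>(1) tendstoD[of "\<lambda>x. S x b" b "nhds x0" \<delta>] by (simp add: dist_norm)
  qed
  then have "\<forall>\<^sub>F x in nhds x0. \<forall>b\<in>(std_basis::'e set). norm (S x b - b) < \<delta>"
    by (intro eventually_ball_finite finite_std_basis) auto
  moreover have "\<forall>\<^sub>F x in nhds x0. x \<in> N1" using N1 by (auto simp: eventually_nhds)
  ultimately have "\<forall>\<^sub>F x in nhds x0. x \<in> N1 \<and> (\<forall>b\<in>(std_basis::'e set). norm (S x b - b) < \<delta>)"
    by eventually_elim auto
  then obtain N where N: "open N" "x0 \<in> N"
      "\<And>x. x \<in> N \<Longrightarrow> x \<in> N1 \<and> (\<forall>b\<in>(std_basis::'e set). norm (S x b - b) < \<delta>)"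
    unfolding eventually_nhds by blast
  have "\<exists>\<zeta>\<in>Z. \<exists>y\<in>Y. u = \<xi> (\<psi> x) \<zeta> + T x y" if x: "x \<in> N" for x u
  proof -
    have xU: "x \<in> U" "\<psi> x \<in> fst c" using N(3)[OF x] by (auto simp: N1_def)
    let ?Q = "{a + b |a b. a \<in> \<xi> (\<psi> x) ` Z \<and> b \<in> T x ` Y}"
    have "subspace ?Q"
      by (intro subspace_sums linear_subspace_image lin_\<xi> has_tangent_linear[OF T[OF xU(1)]] Z Y)
    then have KQ: "subspace (K (\<psi> x) ` ?Q)"
      by (rule linear_subspace_image[OF has_tangent_linear[OF K[OF xU(2)]]])
    have "S x ` std_basis \<subseteq> K (\<psi> x) ` ?Q"
      unfolding S_def using zy(1,2) by (intro image_subsetI imageI CollectI) blast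
    from span_minimal[OF this KQ] have "K (\<psi> x) u \<in> K (\<psi> x) ` ?Q"
      using \<delta>(2)[of "S x"] N(3)[OF x] by auto
    then obtain w where w: "w \<in> ?Q" "K (\<psi> x) u = K (\<psi> x) w" by blast
    then have "u = w" using Kinv[OF xU(2)] by blast
    then show ?thesis using w(1) by blast
  qed
  moreover have "N \<subseteq> U" using N(3) by (auto simp: N1_def)
  ultimately show ?thesis using N(1,2) unfolding \<xi>_def T_def by blast
qed

end


section \<open>The slice mapping\<close>

lemma subspace_set_plus:
  assumes "subspace S" "subspace T"
  shows "subspace (S + T)"
proof -
  have "S + T = {x + y |x y. x \<in> S \<and> y \<in> T}" by (auto simp: set_plus_def)
  then show ?thesis using subspace_sums[OF assms] by simp
qed

lemma nbhd_of_0_in_ball: "nbhd_of_0_in V N \<Longrightarrow> e > 0 \<Longrightarrow> nbhd_of_0_in V (N \<inter> ball 0 e)"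
  by (simp add: nbhd_of_0_in_def openin_Int_open)

text \<open>All clauses of the slice condition except (SM2) hold as soon as the sum of the two neighborhoods lies in
\<open>U\<close>, whereas (SM2) is derived near the origin from the origin itself, by openness.\<close>

theorem proposition2p2:
  fixes G :: "'a::{t2_space, second_countable_topology} monoid"
    and AG :: "('a, 'g::finite_dim_normed) atlas"
    and AM :: "('m::{t2_space, second_countable_topology}, 'e::finite_dim_normed) atlas"
    and \<omega> :: "'m \<Rightarrow> 'e \<Rightarrow> 'e \<Rightarrow> real"
    and \<phi> :: "'a \<Rightarrow> 'm \<Rightarrow> 'm"
    and J :: "'m \<Rightarrow> 'g \<Rightarrow>\<^sub>L real"
    and me :: 'm and \<mu> :: "'g \<Rightarrow>\<^sub>L real"
    and gm gmu q :: "'g set"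
    and im :: "'k::finite_dim_normed \<Rightarrow> 'g"
    and \<psi> :: "'x::finite_dim_normed \<Rightarrow> 'm"
    and U V W V' W' :: "'x set"
    and A :: "'x \<Rightarrow> 'g \<Rightarrow>\<^sub>L real"
    and \<Psi> :: "('k \<Rightarrow>\<^sub>L real) \<times> 'x \<Rightarrow> 'm"
  assumes "smooth_manifold AM" and "symplectic_form AM \<omega>"
    and "lie_group G AG" and "smooth_action G AG AM \<phi>" and "canonical_action AM \<omega> \<phi>"
    and "momentum_map G AG AM \<omega> \<phi> J" and "equivariant_map G AG \<phi> J"
    and "\<mu> = J me"
    and "gm = lie_algebra_of G AG (stabilizer G \<phi> me)"
    and "gmu = lie_algebra_of G AG (stabilizer G (coadjoint G AG) \<mu>)"
    and "linear im" and "inj im" and "complement_in gmu gm (range im)"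
    and "complement_in UNIV gmu q"
    and "open U" and "0 \<in> U" and "open (\<psi> ` U)" and "diffeo_onto_image vec_atlas AM U \<psi>"
    and "subspace V" and "subspace W"
    and "\<psi> 0 = me"
    and "complement_in {u. tangent_map AM vec_atlas J me u = 0}
           (orbit_directions G AG AM \<phi> (range im) me) (tangent_map vec_atlas AM \<psi> 0 ` V)"
    and "A = (\<lambda>w. tangent_map AM vec_atlas J me (tangent_map vec_atlas AM \<psi> 0 w))"
    and "bij_betw A W (annihilator (gm + q))"
    and "nbhd_of_0_in V V'" and "nbhd_of_0_in W W'" and "V' + W' \<subseteq> U"
    and "\<Psi> = (\<lambda>(\<eta>, v). \<psi> (v + inv_into W A (dual_map (splitting_proj gm im q) \<eta>)))"
  shows "(openin (top_of_set (UNIV \<times> V)) ((dual_map im \<circ> A) ` W' \<times> V') \<and>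
          (0, 0) \<in> (dual_map im \<circ> A) ` W' \<times> V' \<and>
          diffeo_onto_image vec_atlas AM ((dual_map im \<circ> A) ` W' \<times> V') \<Psi> \<and>
          SM1 me \<Psi> \<and> SM3 J gm im q V \<Psi>) \<and>
         (\<exists>V\<^sub>0 W\<^sub>0. nbhd_of_0_in V V\<^sub>0 \<and> nbhd_of_0_in W W\<^sub>0 \<and> V\<^sub>0 \<subseteq> V' \<and> W\<^sub>0 \<subseteq> W' \<and>
            (\<forall>V'' W''. nbhd_of_0_in V V'' \<and> nbhd_of_0_in W W'' \<and> V'' \<subseteq> V\<^sub>0 \<and> W'' \<subseteq> W\<^sub>0 \<longrightarrow>
               slice_mapping G AG AM \<phi> J me im q V ((dual_map im \<circ> A) ` W'' \<times> V'') \<Psi>))"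
proof -
  note AM = smooth_manifold_atlas[OF assms(1)]
  note LG = assms(3) and act = assms(4)
  have J: "smooth_map AM vec_atlas UNIV J" using assms(6) by (simp add: momentum_map_def)
  define \<xi> where "\<xi> m \<zeta> = inf_generator G AG AM \<phi> \<zeta> m" for m \<zeta>
  define DJ where "DJ = tangent_map AM vec_atlas J me"
  define T where "T x = tangent_map vec_atlas AM \<psi> x" for x
  have gm_eq: "gm = {\<zeta>. inf_generator G AG AM \<phi> \<zeta> me = 0}"
    using lie_algebra_stabilizer[OF LG act AM] assms(9) by simp
  have gmu_eq: "gmu = {\<zeta>. tangent_map AM vec_atlas J me (inf_generator G AG AM \<phi> \<zeta> me) = 0}"
    using lie_algebra_coadjoint_stabilizer[OF LG act AM J assms(7), of me] assms(8,10) by simp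
  have lin_\<xi>: "linear (\<xi> m)" for m unfolding \<xi>_def by (rule linear_inf_generator[OF LG act AM])
  have J': "has_tangent AM vec_atlas J me DJ"
    unfolding DJ_def by (rule smooth_map_has_tangent[OF AM smooth_atlas_vec J]) simp
  note lin_DJ = has_tangent_linear[OF J']
  have sgm: "subspace gm"
    unfolding gm_eq using lin_\<xi>[of me] by (intro linear_subspace_kernel) (simp add: \<xi>_def[abs_def])
  have sgmu: "subspace gmu"
    unfolding gmu_eq using linear_compose[OF lin_\<xi>[of me] lin_DJ]
    by (intro linear_subspace_kernel) (simp add: \<xi>_def[abs_def] DJ_def comp_def)
  note sp = sgm sgmu assms(11,12,13,14)
  have sq: "subspace q" and sV: "subspace V" and sW: "subspace W"
    using assms(14,19,20) by (auto simp: complement_in_def)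
  define P where "P = dual_map (splitting_proj gm im q)"
  have lin_P: "linear P" unfolding P_def by (rule linear_dual_map)
  have P_ann: "P \<eta> \<in> annihilator (gm + q)" for \<eta>
    unfolding P_def by (rule dual_splitting_proj_annihilates[OF sp])
  have imP: "dual_map im (P \<eta>) = \<eta>" for \<eta> unfolding P_def by (rule dual_im_dual_proj[OF sp])
  have Pim: "P (dual_map im \<alpha>) = \<alpha>" if "\<alpha> \<in> annihilator (gm + q)" for \<alpha>
    unfolding P_def by (rule dual_proj_dual_im[OF sp that])
  have \<psi>: "smooth_map vec_atlas AM U \<psi>"
    using smooth_map_on_open[OF smooth_atlas_vec AM assms(15)] assms(18) by (simp add: diffeo_onto_image_def)
  have T: "has_tangent vec_atlas AM \<psi> x (T x)" if "x \<in> U" for x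
    unfolding T_def by (rule smooth_map_has_tangent[OF smooth_atlas_vec AM \<psi> that])
  note lin_T0 = has_tangent_linear[OF T[OF assms(16)]]
  have A: "A x = DJ (T 0 x)" for x by (simp add: assms(23) DJ_def T_def)
  have lin_A: "linear A"
    using linear_compose[OF lin_T0 lin_DJ] by (simp add: A[abs_def] comp_def)
  note bijA = assms(24)
  have AW: "A w \<in> annihilator (gm + q)" if "w \<in> W" for w using bijA that by (auto simp: bij_betw_def)
  have AV: "A v = 0" if v: "v \<in> V" for v
  proof -
    note c = assms(22)[folded DJ_def T_def]
    have "0 \<in> orbit_directions G AG AM \<phi> (range im) me" "T 0 v \<in> T 0 ` V"
      using c v by (auto simp: complement_in_def)
    then have "0 + T 0 v \<in> orbit_directions G AG AM \<phi> (range im) me + T 0 ` V" by (rule set_plus_intro)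
    then have "T 0 v \<in> {u. DJ u = 0}" using c by (simp add: complement_in_def)
    then show ?thesis by (simp add: A)
  qed
  define B where "B \<eta> = inv_into W A (P \<eta>)" for \<eta>
  have B: "B \<eta> \<in> W" "A (B \<eta>) = P \<eta>" for \<eta>
    using inv_into_into[of "P \<eta>" A W] f_inv_into_f[of "P \<eta>" A W] P_ann[of \<eta>] bijA
    by (simp_all add: B_def bij_betw_def)
  have BA: "B (dual_map im (A w)) = w" if "w \<in> W" for w
    using bijA that by (simp add: B_def Pim[OF AW[OF that]] bij_betw_def)
  have lin_B: "linear B"
    unfolding B_def[abs_def] by (rule linear_inv_into_comp[OF lin_A sW bijA lin_P P_ann])
  note bl_B = linear_imp_bounded_linear[OF lin_B]
  \<comment> \<open>\<open>B\<close> is $A^{-1} \mathbb{P}_{\mathfrak{m}}^*$, so that \<open>\<Psi>\<close> is \<open>\<psi>\<close> after \<open>L\<close>. As \<open>A\<close> vanishes on \<open>V\<close>, the summand in \<open>W\<close> can be read off \<open>A x\<close>; this is \<open>M\<close>, a left inverse of \<open>L\<close>.\<close>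
  define L where "L p = snd p + B (fst p)" for p
  define M where "M x = (dual_map im (A x), x - B (dual_map im (A x)))" for x
  have bl_L: "bounded_linear L"
    unfolding L_def
    by (intro bounded_linear_add bounded_linear_snd bounded_linear_compose[OF bl_B] bounded_linear_fst)
  have "linear (\<lambda>x. dual_map im (A x))"
    using linear_compose[OF lin_A linear_dual_map] by (simp add: comp_def)
  note bl_dA = linear_imp_bounded_linear[OF this]
  have bl_M: "bounded_linear M"
    unfolding M_def
    by (intro bounded_linear_Pair bounded_linear_sub bounded_linear_ident bl_dA bounded_linear_compose[OF bl_B])
  have M_L: "M (L p) = p" if "snd p \<in> V" for p
    using that by (simp add: M_def L_def linear_add[OF lin_A] AV B imP)
  have \<Psi>: "\<Psi> = (\<lambda>p. \<psi> (L p))"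
    by (simp add: assms(28) L_def B_def P_def fun_eq_iff)
  have L0: "L (0, 0) = 0" by (simp add: L_def linear_0[OF lin_B])
  \<comment> \<open>As a preimage under a continuous map on the whole dual space, the domain inherits relative openness from \<open>N\<close>.\<close>
  have dom: "(dual_map im \<circ> A) ` N = B -` N" if "N \<subseteq> W" for N
  proof (intro equalityI subsetI)
    fix \<eta> assume "\<eta> \<in> (dual_map im \<circ> A) ` N"
    then show "\<eta> \<in> B -` N" using BA that by auto
  next
    fix \<eta> assume "\<eta> \<in> B -` N"
    then have "B \<eta> \<in> N" "\<eta> = (dual_map im \<circ> A) (B \<eta>)" by (simp_all add: B imP)
    then show "\<eta> \<in> (dual_map im \<circ> A) ` N" by blast
  qed
  have LU: "L p \<in> V'' + W''" if "p \<in> (dual_map im \<circ> A) ` W'' \<times> V''" "W'' \<subseteq> W" for p V'' W''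
    using that dom[OF that(2)] by (auto simp: L_def intro: set_plus_intro)
  have tan: "tangent_along AM \<Psi> p u = T (L p) (L u)" if "L p \<in> U" for p u
    unfolding \<Psi> by (rule tangent_along_compose_linear[OF AM T[OF that] bounded_linear.linear[OF bl_L]])
  have part1: "openin (top_of_set (UNIV \<times> V)) ((dual_map im \<circ> A) ` W'' \<times> V'') \<and>
          (0, 0) \<in> (dual_map im \<circ> A) ` W'' \<times> V'' \<and>
          diffeo_onto_image vec_atlas AM ((dual_map im \<circ> A) ` W'' \<times> V'') \<Psi> \<and>
          SM1 me \<Psi> \<and> SM3 J gm im q V \<Psi>"
    if nb: "nbhd_of_0_in V V''" "nbhd_of_0_in W W''" and sub: "V'' + W'' \<subseteq> U" for V'' W''
  proof (intro conjI)
    obtain O1 O2 where O: "open O1" "W'' = W \<inter> O1" "open O2" "V'' = V \<inter> O2"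
      using nb by (auto simp: nbhd_of_0_in_def openin_open)
    have W''W: "W'' \<subseteq> W" using O by blast
    have "B -` W'' = B -` O1" using B O(2) by auto
    then have "(dual_map im \<circ> A) ` W'' \<times> V'' = (UNIV \<times> V) \<inter> (B -` O1 \<times> O2)"
      using dom[OF W''W] O(4) by auto
    moreover have "open (B -` O1 \<times> O2)"
      using O bl_B by (intro open_Times open_vimage linear_continuous_on)
    ultimately show "openin (top_of_set (UNIV \<times> V)) ((dual_map im \<circ> A) ` W'' \<times> V'')"
      by (metis openin_open_Int)
    show "(0, 0) \<in> (dual_map im \<circ> A) ` W'' \<times> V''"
      using nb dom[OF W''W] linear_0[OF lin_B] by (simp add: nbhd_of_0_in_def)
    show "diffeo_onto_image vec_atlas AM ((dual_map im \<circ> A) ` W'' \<times> V'') \<Psi>"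
      unfolding \<Psi>
    proof (rule diffeo_onto_image_compose_linear[OF AM assms(18) bl_L bl_M])
      show "L ` ((dual_map im \<circ> A) ` W'' \<times> V'') \<subseteq> U" using LU[OF _ W''W] sub by blast
      show "M (L p) = p" if "p \<in> (dual_map im \<circ> A) ` W'' \<times> V''" for p
        using that O(4) by (intro M_L) auto
    qed
    show "SM1 me \<Psi>" by (simp add: SM1_def \<Psi> L0 assms(21))
    show "SM3 J gm im q V \<Psi>"
      unfolding SM3_def
    proof (intro allI ballI)
      fix \<delta>\<eta> \<delta>v assume v: "\<delta>v \<in> V"
      have "has_tangent vec_atlas vec_atlas (\<lambda>x. J (\<psi> x)) (L (0, 0)) (\<lambda>x. DJ (T 0 x))"
        unfolding L0
        by (rule has_tangent_compose[OF smooth_atlas_vec AM T[OF assms(16)]]) (simp add: assms(21) J')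
      from tangent_along_compose_linear[OF smooth_atlas_vec this bounded_linear.linear[OF bl_L]]
      have "tangent_along vec_atlas (J \<circ> \<Psi>) (0, 0) (\<delta>\<eta>, \<delta>v) = A (L (\<delta>\<eta>, \<delta>v))"
        by (simp add: \<Psi> comp_def A)
      also have "\<dots> = P \<delta>\<eta>" by (simp add: L_def linear_add[OF lin_A] AV[OF v] B)
      finally show "tangent_along vec_atlas (J \<circ> \<Psi>) (0, 0) (\<delta>\<eta>, \<delta>v) = dual_map (splitting_proj gm im q) \<delta>\<eta>"
        by (simp add: P_def)
    qed
  qed
  \<comment> \<open>Subtract a generator from \<open>q\<close>, then a vector from \<open>W\<close>; what remains lies in the kernel of the derivative of \<open>J\<close>.\<close>
  have trans: "\<exists>\<zeta>\<in>range im + q. \<exists>y\<in>V + W. u = inf_generator G AG AM \<phi> \<zeta> (\<psi> 0) + tangent_map vec_atlas AM \<psi> 0 y" for u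
  proof -
    obtain b where b: "b \<in> q" "DJ (u - \<xi> me b) \<in> annihilator (gm + q)"
      using momentum_residual_annihilates[OF LG act AM assms(2,6) gm_eq gmu_eq assms(14), of u]
      unfolding DJ_def \<xi>_def by blast
    then have "DJ (u - \<xi> me b) \<in> A ` W" using bijA by (simp add: bij_betw_def)
    then obtain w where w: "w \<in> W" "A w = DJ (u - \<xi> me b)" by (metis imageE)
    have "u - \<xi> me b - T 0 w \<in> {u. DJ u = 0}" using w by (simp add: linear_diff[OF lin_DJ] A)
    from complement_in_plus[OF assms(22)[folded DJ_def T_def] this]
    obtain k v where kv: "v \<in> V" "u - \<xi> me b - T 0 w = \<xi> me (im k) + T 0 v"
      by (auto simp: orbit_directions_def \<xi>_def)
    have "u = \<xi> me (im k + b) + T 0 (v + w)"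
      using kv(2) by (simp add: linear_add[OF lin_\<xi>] linear_add[OF lin_T0] algebra_simps)
    moreover have "im k + b \<in> range im + q" "v + w \<in> V + W"
      using b w kv by (auto intro: set_plus_intro)
    ultimately show ?thesis unfolding \<xi>_def T_def assms(21) by blast
  qed
  have sVW: "subspace (V + W)" "subspace (range im + q)"
    by (intro subspace_set_plus sV sW sq linear_subspace_image[OF assms(11)] subspace_UNIV)+
  obtain N where N: "open N" "0 \<in> N" "N \<subseteq> U"
      "\<And>x u. x \<in> N \<Longrightarrow> \<exists>\<zeta>\<in>range im + q. \<exists>y\<in>V + W. u = inf_generator G AG AM \<phi> \<zeta> (\<psi> x) + tangent_map vec_atlas AM \<psi> x y"
    using transversality_open[OF LG act AM \<psi> assms(16) sVW(2,1) trans] by metis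
  obtain e where e: "e > 0" "ball 0 e \<subseteq> N" using N(1,2) open_contains_ball by blast
  define V0 where "V0 = V' \<inter> ball 0 (e / 2)"
  define W0 where "W0 = W' \<inter> ball 0 (e / 2)"
  have nb0: "nbhd_of_0_in V V0" "nbhd_of_0_in W W0" "V0 \<subseteq> V'" "W0 \<subseteq> W'"
    using nbhd_of_0_in_ball[OF _ half_gt_zero[OF e(1)]] assms(25,26) by (auto simp: V0_def W0_def)
  have slice: "slice_mapping G AG AM \<phi> J me im q V ((dual_map im \<circ> A) ` W'' \<times> V'') \<Psi>"
    if nb: "nbhd_of_0_in V V''" "nbhd_of_0_in W W''" and sub: "V'' \<subseteq> V0" "W'' \<subseteq> W0" for V'' W''
  proof -
    have VW: "V'' + W'' \<subseteq> U"
      using set_plus_mono2[of V'' V' W'' W'] sub nb0 assms(27) by blast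
    have W''W: "W'' \<subseteq> W" using nb by (auto simp: nbhd_of_0_in_def openin_subset dest: openin_imp_subset)
    have inN: "L p \<in> N" if p: "p \<in> (dual_map im \<circ> A) ` W'' \<times> V''" for p
    proof -
      obtain v w where "v \<in> V''" "w \<in> W''" "L p = v + w"
        using LU[OF p W''W] by (auto simp: set_plus_def)
      then have "norm v < e / 2" "norm w < e / 2" using sub by (auto simp: V0_def W0_def)
      then have "norm (v + w) < e" using norm_triangle_ineq[of v w] by linarith
      then show ?thesis using e(2) \<open>L p = v + w\<close> by auto
    qed
    have "SM2 G AG AM \<phi> im q V ((dual_map im \<circ> A) ` W'' \<times> V'') \<Psi>"
      unfolding SM2_def
    proof (intro ballI equalityI subsetI UNIV_I)
      fix p u assume p: "p \<in> (dual_map im \<circ> A) ` W'' \<times> V''"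
      obtain \<zeta> v w where z: "\<zeta> \<in> range im + q" "v \<in> V" "w \<in> W"
          "u = inf_generator G AG AM \<phi> \<zeta> (\<psi> (L p)) + T (L p) (v + w)"
      proof -
        obtain \<zeta> y where "\<zeta> \<in> range im + q" "y \<in> V + W"
            "u = inf_generator G AG AM \<phi> \<zeta> (\<psi> (L p)) + T (L p) y"
          using N(4)[OF inN[OF p], of u] unfolding T_def by blast
        then show thesis using that by (auto simp: set_plus_def[of V])
      qed
      have "v + w = L (dual_map im (A w), v)" by (simp add: L_def BA[OF z(3)])
      then have "T (L p) (v + w) = tangent_along AM \<Psi> p (dual_map im (A w), v)"
        using tan[of p] inN[OF p] N(3) by auto
      then have "T (L p) (v + w) \<in> tangent_along AM \<Psi> p ` (UNIV \<times> V)" using z(2) by auto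
      moreover have "inf_generator G AG AM \<phi> \<zeta> (\<psi> (L p)) \<in> orbit_directions G AG AM \<phi> (range im + q) (\<Psi> p)"
        using z(1) by (simp add: orbit_directions_def \<Psi>)
      ultimately show "u \<in> orbit_directions G AG AM \<phi> (range im + q) (\<Psi> p) + tangent_along AM \<Psi> p ` (UNIV \<times> V)"
        unfolding z(4) by (rule set_plus_intro[rotated])
    qed
    then show ?thesis
      using part1[OF nb VW] sV by (simp add: slice_mapping_def flip: assms(9))
  qed
  show ?thesis
    using part1[OF assms(25,26,27)] nb0 slice by blast
qed

end
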